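(* Every pure $(G,L)$-pair is spherical: if $(G,L)$ is a pure $(G,L)$-pair and $\rho$ is an irreducible unitary representation of $G$ in a Hilbert space $H$, then the space of $L$-fixed vectors in $H$ has dimension at most one.
   Context: Classical groups. A matrix $g$ over $\mathbb R,\mathbb C$ or $\mathbb H$ with rows and columns indexed by a countable basis is finite if $g-1$ has only finitely many nonzero entries. All groups below consist of finite invertible matrices satisfying the usual identities. The irreducible classical groups and their maximal heavy subgroups are: $\mathrm{GL}(\infty,\mathbb R)\supset \mathrm O(\infty)$; $\mathrm{GL}(\infty,\mathbb C)\supset \mathrm U(\infty)$; $\mathrm{GL}(\infty,\mathbb H)\supset\mathrm{Sp}(\infty)$; $\mathrm U(\infty,\infty)\supset \mathrm U(\infty)\times \mathrm U(\infty)$; $\mathrm{Sp}(2\infty,\mathbb R)\supset \mathrm U(\infty)$; $\mathrm{Sp}(2\infty,\mathbb C)\supset\mathrm{Sp}(\infty)$; $\mathrm{Sp}(\infty,\infty)\supset\mathrm{Sp}(\infty)\times\mathrm{Sp}(\infty)$; $\mathrm O(\infty,\infty)\supset\mathrm O(\infty)\times\mathrm O(\infty)$; $\mathrm O(\infty,\mathbb C)\supset\mathrm O(\infty)$; $\mathrm{SO}^*(2\infty)\supset\mathrm U(\infty)$; $\mathrm U(p,\infty)\supset\mathrm U(\infty)$; $\mathrm O(p,\infty)\supset\mathrm O(\infty)$; $\mathrm{Sp}(p,\infty)\supset\mathrm{Sp}(\infty)$ with $0\le p<\infty$ (for $p=0$: the groups $\mathrm U(\infty),\mathrm O(\infty),\mathrm{Sp}(\infty)$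 themselves). Here $\mathrm{Sp}(\infty)$ is the quaternionic unitary group. A classical group is a finite product of irreducible ones; its maximal heavy subgroup $K$ is the product of the maximal heavy subgroups of the factors. A heavy group is a finite product of groups $\mathrm O(\infty),\mathrm U(\infty),\mathrm{Sp}(\infty)$ (called irreducible heavy groups). Straight homomorphisms. Trivial homomorphisms between irreducible heavy groups are: the identity maps, elementwise complex conjugation of $\mathrm U(\infty)$, and the obvious maps $\mathrm O(\infty)\to\mathrm U(\infty)$, $\mathrm O(\infty)\to\mathrm{Sp}(\infty)$, $\mathrm U(\infty)\to\mathrm{Sp}(\infty)$, $\mathrm U(\infty)\to\mathrm O(2\infty)$, $\mathrm{Sp}(\infty)\to\mathrm O(4\infty)$, $\mathrm{Sp}(\infty)\to\mathrm U(2\infty)$. For $L=L_1\times\dots\times L_p$ heavy and $K$ irreducible heavy, a homomorphism $L\to K$ is straight if it has the block diagonal form $(g_1,\dots,g_p)\mapsto\mathrm{diag}(1_a,\tau_1(g_{m_1}),\dots,\tau_N(g_{m_N}))$ with $\tau_j$ trivial, $0<N<\infty$, $a\in\{0,1,2,\dots,\infty\}$ (not required to be faithful). For $K=K_1\times\dots\times K_q$, a straight homomorphism $L\to K$ is a product of straight homomorphisms $L\to K_i$. A $(G,L)$-pair consists of a classical group $G$ with maximal heavy subgroup $K$ and a heavy group $L$ straightly embedded in $K$. The pair is pure if the centralizer of $L$ in $G$ is trivial; equivalently, no unit block $1_a$ with $a>0$ occurs in the straight embedding, and no groups $\mathrm U(p,\infty)$, $\mathrm O(p,\infty)$, $\mathrm{Sp}(p,\infty)$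 with $p>0$ occur among the factors of $G$. *)

theory Defs
  imports Complex_Main "HOL-Algebra.Product_Groups"
begin

section \<open>Quaternions\<close>

datatype quat = Quat (qre: real) (qim1: real) (qim2: real) (qim3: real)

instantiation quat :: ring_1
begin

definition zero_quat :: quat where "0 = Quat 0 0 0 0"

definition one_quat :: quat where "1 = Quat 1 0 0 0"

definition plus_quat :: "quat \<Rightarrow> quat \<Rightarrow> quat" where
  "p + q = Quat (qre p + qre q) (qim1 p + qim1 q) (qim2 p + qim2 q) (qim3 p + qim3 q)"

definition minus_quat :: "quat \<Rightarrow> quat \<Rightarrow> quat" where
  "p - q = Quat (qre p - qre q) (qim1 p - qim1 q) (qim2 p - qim2 q) (qim3 p - qim3 q)"

definition uminus_quat :: "quat \<Rightarrow> quat" where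
  "- q = Quat (- qre q) (- qim1 q) (- qim2 q) (- qim3 q)"

definition times_quat :: "quat \<Rightarrow> quat \<Rightarrow> quat" where
  "p * q = Quat
     (qre p * qre q - qim1 p * qim1 q - qim2 p * qim2 q - qim3 p * qim3 q)
     (qre p * qim1 q + qim1 p * qre q + qim2 p * qim3 q - qim3 p * qim2 q)
     (qre p * qim2 q - qim1 p * qim3 q + qim2 p * qre q + qim3 p * qim1 q)
     (qre p * qim3 q + qim1 p * qim2 q - qim2 p * qim1 q + qim3 p * qre q)"

instance
  by standard
    (auto simp: zero_quat_def one_quat_def plus_quat_def minus_quat_def uminus_quat_def
      times_quat_def algebra_simps)

end

definition qcnj :: "quat \<Rightarrow> quat" where
  "qcnj q = Quat (qre q) (- qim1 q) (- qim2 q) (- qim3 q)"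

text \<open>
  The real and complex numbers are regarded as subfields of the quaternions, so that a matrix
  over any of the three is a matrix over the quaternions with entries in \<open>scalars F\<close>.
\<close>

datatype fld = RR | CC | HH

fun scalars :: "fld \<Rightarrow> quat set" where
  "scalars RR = {q. qim1 q = 0 \<and> qim2 q = 0 \<and> qim3 q = 0}"
| "scalars CC = {q. qim2 q = 0 \<and> qim3 q = 0}"
| "scalars HH = UNIV"


section \<open>Finite matrices\<close>

type_synonym 'i qmat = "'i \<Rightarrow> 'i \<Rightarrow> quat"

definition mat_one :: "'i qmat" where
  "mat_one = (\<lambda>x y. if x = y then 1 else 0)"

text \<open>All matrices multiplied below have finitely supported rows.\<close>

definition mat_mult :: "'i qmat \<Rightarrow> 'i qmat \<Rightarrow> 'i qmat" where
  "mat_mult g h = (\<lambda>x y. \<Sum>z | g x z \<noteq> 0. g x z * h z y)"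

definition mat_transpose :: "'i qmat \<Rightarrow> 'i qmat" where
  "mat_transpose g = (\<lambda>x y. g y x)"

definition mat_adjoint :: "'i qmat \<Rightarrow> 'i qmat" where
  "mat_adjoint g = (\<lambda>x y. qcnj (g y x))"

text \<open>
  Finite matrices over \<open>F\<close> with rows and columns indexed by the set \<open>I\<close>; outside \<open>I \<times> I\<close> they
  are continued by the identity matrix.
\<close>

definition finite_matrices :: "'i set \<Rightarrow> fld \<Rightarrow> 'i qmat set" where
  "finite_matrices I F = {g.
     finite {(x, y). g x y \<noteq> mat_one x y} \<and>
     {(x, y). g x y \<noteq> mat_one x y} \<subseteq> I \<times> I \<and>
     (\<forall>x y. g x y \<in> scalars F)}"

definition GL :: "'i set \<Rightarrow> fld \<Rightarrow> 'i qmat set" where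
  "GL I F = {g \<in> finite_matrices I F.
     \<exists>h \<in> finite_matrices I F. mat_mult g h = mat_one \<and> mat_mult h g = mat_one}"

definition preserves_bilinear :: "'i qmat \<Rightarrow> 'i qmat \<Rightarrow> bool" where
  "preserves_bilinear B g \<longleftrightarrow> mat_mult (mat_transpose g) (mat_mult B g) = B"

definition preserves_sesquilinear :: "'i qmat \<Rightarrow> 'i qmat \<Rightarrow> bool" where
  "preserves_sesquilinear B g \<longleftrightarrow> mat_mult (mat_adjoint g) (mat_mult B g) = B"

definition mat_group :: "'i qmat set \<Rightarrow> 'i qmat monoid" where
  "mat_group S = \<lparr>carrier = S, monoid.mult = mat_mult, one = mat_one\<rparr>"


section \<open>Heavy groups\<close>

text \<open>The unitary group over \<open>F\<close>: this is O(\<open>\<infinity>\<close>), U(\<open>\<infinity>\<close>), Sp(\<open>\<infinity>\<close>) for \<open>F = RR, CC, HH\<close>.\<close>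

definition irr_heavy_group :: "fld \<Rightarrow> nat qmat monoid" where
  "irr_heavy_group F = mat_group {g \<in> GL UNIV F. preserves_sesquilinear mat_one g}"

definition heavy_group :: "fld list \<Rightarrow> (nat \<Rightarrow> nat qmat) monoid" where
  "heavy_group Ls = product_group {..<length Ls} (\<lambda>m. irr_heavy_group (Ls ! m))"


section \<open>Classical groups\<close>

datatype classical =
    GL_inf fld              \<comment> \<open>GL(\<open>\<infinity>\<close>, F)\<close>
  | U_inf_inf fld           \<comment> \<open>O(\<open>\<infinity>,\<infinity>\<close>), U(\<open>\<infinity>,\<infinity>\<close>), Sp(\<open>\<infinity>,\<infinity>\<close>)\<close>
  | U_fin_inf nat fld       \<comment> \<open>O(p,\<open>\<infinity>\<close>), U(p,\<open>\<infinity>\<close>), Sp(p,\<open>\<infinity>\<close>)\<close>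
  | Sp_2inf_R               \<comment> \<open>Sp(2\<open>\<infinity>\<close>, R)\<close>
  | Sp_2inf_C               \<comment> \<open>Sp(2\<open>\<infinity>\<close>, C)\<close>
  | O_inf_C                 \<comment> \<open>O(\<open>\<infinity>\<close>, C)\<close>
  | SO_star_2inf            \<comment> \<open>SO*(2\<open>\<infinity>\<close>)\<close>

text \<open>
  The common index type of all classical groups is \<open>nat + nat\<close>. Groups with a single infinite
  basis only use the right summand; U(p,\<open>\<infinity>\<close>) and its analogues use \<open>p\<close> elements of the left one.
\<close>

definition basis_fin :: "nat \<Rightarrow> (nat + nat) set" where
  "basis_fin p = Inl ` {..<p} \<union> range Inr"

fun block_diag :: "nat qmat \<Rightarrow> nat qmat \<Rightarrow> (nat + nat) qmat" where
  "block_diag A D (Inl i) (Inl j) = A i j"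
| "block_diag A D (Inr i) (Inr j) = D i j"
| "block_diag A D _ _ = 0"

definition indefinite_form :: "(nat + nat) qmat" where
  "indefinite_form = block_diag mat_one (\<lambda>i j. - mat_one i j)"

fun symplectic_form :: "(nat + nat) qmat" where
  "symplectic_form (Inl i) (Inr j) = mat_one i j"
| "symplectic_form (Inr i) (Inl j) = - mat_one i j"
| "symplectic_form _ _ = 0"

text \<open>
  SO*(2n) is realised as the group of complex matrices preserving a symmetric bilinear form and a
  skew-Hermitian form.
\<close>

fun irr_classical_carrier :: "classical \<Rightarrow> (nat + nat) qmat set" where
  "irr_classical_carrier (GL_inf F) = GL (basis_fin 0) F"
| "irr_classical_carrier (U_inf_inf F) =
     {g \<in> GL UNIV F. preserves_sesquilinear indefinite_form g}"
| "irr_classical_carrier (U_fin_inf p F) =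
     {g \<in> GL (basis_fin p) F. preserves_sesquilinear indefinite_form g}"
| "irr_classical_carrier Sp_2inf_R = {g \<in> GL UNIV RR. preserves_bilinear symplectic_form g}"
| "irr_classical_carrier Sp_2inf_C = {g \<in> GL UNIV CC. preserves_bilinear symplectic_form g}"
| "irr_classical_carrier O_inf_C = {g \<in> GL (basis_fin 0) CC. preserves_bilinear mat_one g}"
| "irr_classical_carrier SO_star_2inf =
     {g \<in> GL UNIV CC. preserves_bilinear mat_one g \<and> preserves_sesquilinear symplectic_form g}"

definition classical_group :: "classical list \<Rightarrow> (nat \<Rightarrow> (nat + nat) qmat) monoid" where
  "classical_group Gs =
     product_group {..<length Gs} (\<lambda>i. mat_group (irr_classical_carrier (Gs ! i)))"


section \<open>Straight homomorphisms\<close>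

definition qunit :: "nat \<Rightarrow> quat" where
  "qunit t = [Quat 1 0 0 0, Quat 0 1 0 0, Quat 0 0 1 0, Quat 0 0 0 1] ! t"

definition qcomponent :: "quat \<Rightarrow> nat \<Rightarrow> real" where
  "qcomponent q s = [qre q, qim1 q, qim2 q, qim3 q] ! s"

text \<open>
  Matrix of left multiplication by \<open>q\<close> in the real basis \<open>1, i\<close> of the complex numbers
  (for \<open>s, t < 2\<close>) or \<open>1, i, j, k\<close> of the quaternions (for \<open>s, t < 4\<close>).
\<close>

definition real_block :: "quat \<Rightarrow> nat \<Rightarrow> nat \<Rightarrow> quat" where
  "real_block q s t = Quat (qcomponent (q * qunit t) s) 0 0 0"

text \<open>For \<open>q = z + w j\<close> with complex \<open>z\<close>, \<open>w\<close>: the matrix with rows \<open>(z, w)\<close> and \<open>(- cnj w, cnj z)\<close>.\<close>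

definition complex_block :: "quat \<Rightarrow> nat \<Rightarrow> nat \<Rightarrow> quat" where
  "complex_block q s t =
     (let z = Quat (qre q) (qim1 q) 0 0; w = Quat (qim2 q) (qim3 q) 0 0
      in [[z, w], [- qcnj w, qcnj z]] ! s ! t)"

text \<open>Replace every entry by a block; only block indices below the block size are meaningful.\<close>

definition expand :: "(quat \<Rightarrow> nat \<Rightarrow> nat \<Rightarrow> quat) \<Rightarrow> nat qmat \<Rightarrow> (nat \<times> nat) qmat" where
  "expand c g = (\<lambda>(k, s) (l, t). c (g k l) s t)"

text \<open>
  \<open>trivial_hom F F' d \<tau>\<close>: \<open>\<tau>\<close> is a trivial homomorphism from the unitary group over \<open>F\<close> to that
  over \<open>F'\<close>, the target matrices being indexed by \<open>UNIV \<times> {..<d}\<close>.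
\<close>

inductive trivial_hom :: "fld \<Rightarrow> fld \<Rightarrow> nat \<Rightarrow> (nat qmat \<Rightarrow> (nat \<times> nat) qmat) \<Rightarrow> bool" where
  inclusion: "scalars F \<subseteq> scalars F' \<Longrightarrow> trivial_hom F F' 1 (expand (\<lambda>q s t. q))"
| conjugation: "trivial_hom CC CC 1 (expand (\<lambda>q s t. qcnj q))"
| U_to_O: "trivial_hom CC RR 2 (expand real_block)"
| Sp_to_O: "trivial_hom HH RR 4 (expand real_block)"
| Sp_to_U: "trivial_hom HH CC 2 (expand complex_block)"

text \<open>
  Block diagonal form of a homomorphism from the heavy group \<open>Ls\<close> to the unitary group over \<open>F\<close>.
  A triple \<open>(m, d, \<tau>)\<close> in \<open>bs\<close> stands for the block \<open>\<tau> (g\<^sub>m)\<close>, and \<open>\<beta> j\<close> places the basis of the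
  \<open>j\<close>-th block inside the basis \<open>nat\<close> of the target. The basis elements not hit by any block
  carry the unit block \<open>1\<^sub>a\<close>, where \<open>a\<close> is their number (possibly infinite).
\<close>

definition block_index :: "(nat \<times> nat \<times> (nat qmat \<Rightarrow> (nat \<times> nat) qmat)) list \<Rightarrow> nat
    \<Rightarrow> (nat \<times> nat) set" where
  "block_index bs j = UNIV \<times> {..<fst (snd (bs ! j))}"

definition straight_irr :: "fld list \<Rightarrow> fld \<Rightarrow> ((nat \<Rightarrow> nat qmat) \<Rightarrow> nat qmat) \<Rightarrow> bool" where
  "straight_irr Ls F \<phi> \<longleftrightarrow>
     (\<exists>bs \<beta>. bs \<noteq> [] \<and>
        (\<forall>(m, d, \<tau>) \<in> set bs. m < length Ls \<and> trivial_hom (Ls ! m) F d \<tau>) \<and>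
        inj_on (\<lambda>(j, u). \<beta> j u) (SIGMA j:{..<length bs}. block_index bs j) \<and>
        (\<forall>g \<in> carrier (heavy_group Ls).
           (\<forall>j < length bs. \<forall>u \<in> block_index bs j. \<forall>v \<in> block_index bs j.
              case bs ! j of (m, d, \<tau>) \<Rightarrow> \<phi> g (\<beta> j u) (\<beta> j v) = \<tau> (g m) u v) \<and>
           (\<forall>x y. \<not> (\<exists>j < length bs. x \<in> \<beta> j ` block_index bs j \<and> y \<in> \<beta> j ` block_index bs j)
              \<longrightarrow> \<phi> g x y = mat_one x y)))"

definition straight_hom :: "fld list \<Rightarrow> 'k set \<Rightarrow> ('k \<Rightarrow> fld)
    \<Rightarrow> ((nat \<Rightarrow> nat qmat) \<Rightarrow> 'k \<Rightarrow> nat qmat) \<Rightarrow> bool" where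
  "straight_hom Ls I K \<phi> \<longleftrightarrow>
     \<phi> \<in> hom (heavy_group Ls) (product_group I (\<lambda>i. irr_heavy_group (K i))) \<and>
     (\<forall>i \<in> I. straight_irr Ls (K i) (\<lambda>g. \<phi> g i))"


section \<open>Maximal heavy subgroups and pairs\<close>

fun heavy_factors :: "classical \<Rightarrow> fld list" where
  "heavy_factors (GL_inf F) = [F]"
| "heavy_factors (U_inf_inf F) = [F, F]"
| "heavy_factors (U_fin_inf p F) = [F]"
| "heavy_factors Sp_2inf_R = [CC]"
| "heavy_factors Sp_2inf_C = [HH]"
| "heavy_factors O_inf_C = [RR]"
| "heavy_factors SO_star_2inf = [CC]"

text \<open>
  A matrix indexed by \<open>UNIV \<times> {..<2}\<close> read as a 2 by 2 block matrix. For \<open>A + i B\<close> in U(\<open>\<infinity>\<close>) the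
  matrix \<open>two_blocks (expand real_block (A + i B))\<close> has block rows \<open>(A, - B)\<close> and \<open>(B, A)\<close>; for
  \<open>A + B j\<close> in Sp(\<open>\<infinity>\<close>) the matrix \<open>two_blocks (expand complex_block (A + B j))\<close> has block rows
  \<open>(A, B)\<close> and \<open>(- cnj B, cnj A)\<close>.
\<close>

definition two_blocks :: "(nat \<times> nat) qmat \<Rightarrow> (nat + nat) qmat" where
  "two_blocks M =
     (let pos = case_sum (\<lambda>k. (k, 0)) (\<lambda>k. (k, 1)) in (\<lambda>x y. M (pos x) (pos y)))"

text \<open>The embedding of the maximal heavy subgroup into an irreducible classical group.\<close>

fun heavy_embed :: "classical \<Rightarrow> (nat \<Rightarrow> nat qmat) \<Rightarrow> (nat + nat) qmat" where
  "heavy_embed (GL_inf F) \<kappa> = block_diag mat_one (\<kappa> 0)"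
| "heavy_embed (U_inf_inf F) \<kappa> = block_diag (\<kappa> 0) (\<kappa> 1)"
| "heavy_embed (U_fin_inf p F) \<kappa> = block_diag mat_one (\<kappa> 0)"
| "heavy_embed Sp_2inf_R \<kappa> = two_blocks (expand real_block (\<kappa> 0))"
| "heavy_embed Sp_2inf_C \<kappa> = two_blocks (expand complex_block (\<kappa> 0))"
| "heavy_embed O_inf_C \<kappa> = block_diag mat_one (\<kappa> 0)"
| "heavy_embed SO_star_2inf \<kappa> = two_blocks (expand real_block (\<kappa> 0))"

text \<open>The irreducible factors of the maximal heavy subgroup \<open>K\<close> of \<open>classical_group Gs\<close>.\<close>

definition max_heavy_index :: "classical list \<Rightarrow> (nat \<times> nat) set" where
  "max_heavy_index Gs = (SIGMA i:{..<length Gs}. {..<length (heavy_factors (Gs ! i))})"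

definition max_heavy_factor :: "classical list \<Rightarrow> nat \<times> nat \<Rightarrow> fld" where
  "max_heavy_factor Gs = (\<lambda>(i, s). heavy_factors (Gs ! i) ! s)"

definition max_heavy_embed :: "classical list \<Rightarrow> (nat \<times> nat \<Rightarrow> nat qmat)
    \<Rightarrow> nat \<Rightarrow> (nat + nat) qmat" where
  "max_heavy_embed Gs \<kappa> = (\<lambda>i\<in>{..<length Gs}. heavy_embed (Gs ! i) (\<lambda>s. \<kappa> (i, s)))"

definition straight_pair :: "classical list \<Rightarrow> fld list
    \<Rightarrow> ((nat \<Rightarrow> nat qmat) \<Rightarrow> nat \<times> nat \<Rightarrow> nat qmat) \<Rightarrow> bool" where
  "straight_pair Gs Ls \<phi> \<longleftrightarrow>
     straight_hom Ls (max_heavy_index Gs) (max_heavy_factor Gs) \<phi> \<and>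
     inj_on \<phi> (carrier (heavy_group Ls))"

definition image_in_G :: "classical list \<Rightarrow> fld list
    \<Rightarrow> ((nat \<Rightarrow> nat qmat) \<Rightarrow> nat \<times> nat \<Rightarrow> nat qmat) \<Rightarrow> (nat \<Rightarrow> (nat + nat) qmat) set" where
  "image_in_G Gs Ls \<phi> = (\<lambda>l. max_heavy_embed Gs (\<phi> l)) ` carrier (heavy_group Ls)"

definition centralizer :: "('a, 'b) monoid_scheme \<Rightarrow> 'a set \<Rightarrow> 'a set" where
  "centralizer G S = {g \<in> carrier G. \<forall>s \<in> S. g \<otimes>\<^bsub>G\<^esub> s = s \<otimes>\<^bsub>G\<^esub> g}"

definition pure_pair :: "classical list \<Rightarrow> fld list
    \<Rightarrow> ((nat \<Rightarrow> nat qmat) \<Rightarrow> nat \<times> nat \<Rightarrow> nat qmat) \<Rightarrow> bool" where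
  "pure_pair Gs Ls \<phi> \<longleftrightarrow>
     straight_pair Gs Ls \<phi> \<and>
     centralizer (classical_group Gs) (image_in_G Gs Ls \<phi>) = {\<one>\<^bsub>classical_group Gs\<^esub>}"


section \<open>Unitary representations\<close>

class complex_hilbert_space = banach +
  fixes scaleC :: "complex \<Rightarrow> 'a \<Rightarrow> 'a"
    and cinner :: "'a \<Rightarrow> 'a \<Rightarrow> complex"
  assumes scaleC_add_right: "scaleC c (x + y) = scaleC c x + scaleC c y"
    and scaleC_add_left: "scaleC (c + d) x = scaleC c x + scaleC d x"
    and scaleC_scaleC: "scaleC c (scaleC d x) = scaleC (c * d) x"
    and scaleR_scaleC: "scaleR r x = scaleC (complex_of_real r) x"
    and cinner_commute: "cinner x y = cnj (cinner y x)"
    and cinner_add_left: "cinner (x + y) z = cinner x z + cinner y z"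
    and cinner_scaleC_left: "cinner (scaleC c x) y = c * cinner x y"
    and cinner_self: "cinner x x = complex_of_real ((norm x)\<^sup>2)"

global_interpretation complex_vector:
  vector_space "scaleC :: complex \<Rightarrow> 'a \<Rightarrow> 'a::complex_hilbert_space"
proof
  fix x :: 'a
  show "scaleC 1 x = x"
    using scaleR_scaleC[of 1 x] by simp
qed (simp_all add: scaleC_add_right scaleC_add_left scaleC_scaleC)

definition unitary_group :: "('h::complex_hilbert_space \<Rightarrow> 'h) monoid" where
  "unitary_group =
     \<lparr>carrier = {U. Vector_Spaces.linear scaleC scaleC U \<and> surj U \<and>
                    (\<forall>x y. cinner (U x) (U y) = cinner x y)},
      monoid.mult = (\<circ>), one = id\<rparr>"

definition irreducible_unitary_rep :: "('g, 'm) monoid_scheme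
    \<Rightarrow> ('g \<Rightarrow> 'h::complex_hilbert_space \<Rightarrow> 'h) \<Rightarrow> bool" where
  "irreducible_unitary_rep G \<rho> \<longleftrightarrow>
     \<rho> \<in> hom G unitary_group \<and>
     (\<exists>x::'h. x \<noteq> 0) \<and>
     (\<forall>S. closed S \<and> complex_vector.subspace S \<and> (\<forall>g \<in> carrier G. \<rho> g ` S \<subseteq> S)
        \<longrightarrow> S = {0} \<or> S = UNIV)"

definition fixed_vectors :: "('g \<Rightarrow> 'h \<Rightarrow> 'h) \<Rightarrow> 'g set \<Rightarrow> 'h set" where
  "fixed_vectors \<rho> L = {x. \<forall>l \<in> L. \<rho> l x = x}"

text \<open>
  Not expressed by \<open>complex_vector.dim\<close>, which is \<open>0\<close> on infinite-dimensional subspaces.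
\<close>

definition has_dim_at_most :: "nat \<Rightarrow> 'h::complex_hilbert_space set \<Rightarrow> bool" where
  "has_dim_at_most n V \<longleftrightarrow>
     (\<exists>B. finite B \<and> card B \<le> n \<and> complex_vector.independent B \<and> complex_vector.span B = V)"

end

theory Submission
  imports Defs "HOL-Analysis.Analysis"
begin

text \<open>
  Write \<open>P\<close> for the orthogonal projection onto the space \<open>V\<close> of \<open>L\<close>-fixed vectors. The theorem holds
  because the compressed operators \<open>P \<rho>(g) P\<close> commute with each other, as in the theory of Gelfand
  pairs, and because by irreducibility of \<open>\<rho>\<close> no closed subspace of
  \<open>V\<close> other than \<open>0\<close> and \<open>V\<close> is invariant under them.

  The commutation rests on involutions \<open>\<theta>\<^sub>N\<close> in \<open>L\<close>: in every factor of \<open>L\<close> take the permutation matrix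
  that swaps the first \<open>N\<close> basis vectors with the next \<open>N\<close>. In a pure pair there are no unit blocks and
  no finite parts \<open>p > 0\<close>, since a reflection in a basis vector of such a part would centralize \<open>L\<close>
  (\<open>pure_pair_no_unit_block\<close>, \<open>pure_pair_no_finite_part\<close>). Hence the image of \<open>\<theta>\<^sub>N\<close> in \<open>G\<close> is a permutation
  matrix that finally moves every finite set of relevant basis vectors off itself, and for all
  \<open>g\<close>, \<open>h\<close> in \<open>G\<close> the elements \<open>\<theta>\<^sub>N g \<theta>\<^sub>N\<close> and \<open>h\<close> have disjoint supports and commute when \<open>N\<close> is large
  (\<open>pure_pair_eventually_commute\<close>).

  This has two consequences. First, \<open>\<theta>\<^sub>N\<close> tends to \<open>P\<close> weakly against vectors \<open>\<rho>(g) v\<close> with \<open>v\<close> in \<open>V\<close>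
  (\<open>theta_limit\<close>): such a vector is finally fixed by \<open>\<theta>\<^sub>N l \<theta>\<^sub>N\<close> for each \<open>l\<close> in \<open>L\<close>, so \<open>\<rho>(\<theta>\<^sub>N) x\<close> has
  asymptotically the same coefficients as \<open>\<rho>(\<theta>\<^sub>N) \<rho>(l) x\<close>, thus the same as \<open>\<rho>(\<theta>\<^sub>N) P x = P x\<close>, because
  \<open>P x\<close> lies in the closed convex hull of the vectors \<open>\<rho>(l) x\<close>. Secondly,
  \<open>g \<theta>\<^sub>N h = \<theta>\<^sub>N (\<theta>\<^sub>N g \<theta>\<^sub>N) h = \<theta>\<^sub>N h (\<theta>\<^sub>N g \<theta>\<^sub>N)\<close> lies in the same double coset of \<open>L\<close> as \<open>h \<theta>\<^sub>N g\<close>. Passing to the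
  limit, \<open>P \<rho>(g) P \<rho>(h) P = P \<rho>(h) P \<rho>(g) P\<close> (\<open>compressions_commute\<close>).

  It remains to apply Schur's lemma to the self-adjoint operators \<open>P \<rho>(g) P + P \<rho>(g\<inverse>) P\<close> and
  \<open>\<i> (P \<rho>(g) P - P \<rho>(g\<inverse>) P)\<close>. The spectral theorem is replaced by the square root \<open>R\<close> of \<open>T\<^sup>2\<close>: from
  \<open>(R - T) (R + T) = 0\<close> and irreducibility it follows that \<open>T = R\<close> or \<open>T = - R\<close>, so every operator
  \<open>T - \<lambda> P\<close> is semidefinite, which forces \<open>T\<close> to be a multiple of \<open>P\<close>
  (\<open>sign_definite_if_irreducible\<close>, \<open>selfadjoint_scalar_if_irreducible\<close>). Finally, for a nonzero \<open>v\<close> in \<open>V\<close>,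
  any \<open>w\<close> in \<open>V\<close> orthogonal to \<open>v\<close> is orthogonal to all \<open>\<rho>(g) v\<close>, hence is zero.
\<close>

section \<open>Complex Hilbert spaces\<close>

lemma cinner_add_right: "cinner x (y + z) = cinner x y + cinner x z"
  by (metis cinner_add_left cinner_commute complex_cnj_add)

lemma cinner_scaleC_right: "cinner x (scaleC c y) = cnj c * cinner x y"
  by (metis cinner_commute cinner_scaleC_left complex_cnj_mult)

lemma cinner_minus_left: "cinner (- x) y = - cinner x y"
  using cinner_scaleC_left[of "-1" x y] by simp

lemma cinner_minus_right: "cinner x (- y) = - cinner x y"
  using cinner_scaleC_right[of x "-1" y] by simp

lemma cinner_diff_left: "cinner (x - y) z = cinner x z - cinner y z"
  using cinner_add_left[of x "- y" z] by (simp add: cinner_minus_left)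

lemma cinner_diff_right: "cinner x (y - z) = cinner x y - cinner x z"
  using cinner_add_right[of x y "- z"] by (simp add: cinner_minus_right)

lemma cinner_zero_left [simp]: "cinner 0 y = 0"
  using cinner_diff_left[of 0 0 y] by simp

lemma cinner_zero_right [simp]: "cinner x 0 = 0"
  using cinner_diff_right[of x 0 0] by simp

lemma cinner_scaleR_left: "cinner (scaleR r x) y = of_real r * cinner x y"
  by (simp add: scaleR_scaleC cinner_scaleC_left)

lemma cinner_scaleR_right: "cinner x (scaleR r y) = of_real r * cinner x y"
  by (simp add: scaleR_scaleC cinner_scaleC_right)

lemmas cinner_simps = cinner_add_left cinner_add_right cinner_diff_left cinner_diff_right
  cinner_minus_left cinner_minus_right cinner_scaleC_left cinner_scaleC_right
  cinner_scaleR_left cinner_scaleR_right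

lemma norm_scaleC: "norm (scaleC c x) = cmod c * norm x"
proof -
  have "complex_of_real ((norm (scaleC c x))\<^sup>2) = c * cnj c * of_real ((norm x)\<^sup>2)"
    by (simp only: cinner_self[symmetric] cinner_scaleC_left cinner_scaleC_right ac_simps)
  also have "\<dots> = complex_of_real ((cmod c * norm x)\<^sup>2)"
    using complex_norm_square[of c] by (simp add: power_mult_distrib)
  finally show ?thesis
    by (metis norm_ge_zero mult_nonneg_nonneg of_real_eq_iff power2_eq_imp_eq)
qed

lemma power2_norm_cinner: "(norm x)\<^sup>2 = Re (cinner x x)"
  by (simp add: cinner_self)

lemma cinner_eq_0_iff [simp]: "cinner x x = 0 \<longleftrightarrow> x = 0"
  by (simp add: cinner_self)

lemma Re_cinner_commute: "Re (cinner x y) = Re (cinner y x)"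
  by (metis cinner_commute cnj.simps(1))

lemma norm_add_square: "(norm (x + y))\<^sup>2 = (norm x)\<^sup>2 + 2 * Re (cinner x y) + (norm y)\<^sup>2"
  by (simp add: power2_norm_cinner cinner_simps Re_cinner_commute[of y x])

lemma norm_diff_square: "(norm (x - y))\<^sup>2 = (norm x)\<^sup>2 - 2 * Re (cinner x y) + (norm y)\<^sup>2"
  by (simp add: power2_norm_cinner cinner_simps Re_cinner_commute[of y x])

lemma parallelogram:
  fixes x y :: "'h::complex_hilbert_space"
  shows "(norm (x + y))\<^sup>2 + (norm (x - y))\<^sup>2 = 2 * (norm x)\<^sup>2 + 2 * (norm y)\<^sup>2"
  by (simp add: norm_add_square norm_diff_square)

lemma Re_cinner_le: "Re (cinner x y) \<le> norm x * norm y"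
proof -
  have *: "2 * (norm x * norm y) * Re (cinner x y) \<le> 2 * (norm x * norm y)\<^sup>2"
    using zero_le_power2[of "norm (norm y *\<^sub>R x - norm x *\<^sub>R y)"]
    unfolding norm_diff_square
    by (simp add: cinner_simps power2_eq_square algebra_simps)
  show ?thesis
  proof (cases "norm x * norm y = 0")
    case True
    then show ?thesis by auto
  next
    case False
    then have "norm x * norm y > 0"
      by (metis less_eq_real_def mult_nonneg_nonneg norm_ge_zero)
    moreover have "(norm x * norm y) * Re (cinner x y) \<le> (norm x * norm y) * (norm x * norm y)"
      using * by (simp add: power2_eq_square mult.assoc)
    ultimately show ?thesis
      by (metis mult_le_cancel_left_pos)
  qed
qed

lemma norm_cinner_le: "cmod (cinner x y) \<le> norm x * norm y"
proof (cases "cinner x y = 0")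
  case False
  define c where "c = cnj (cinner x y) / of_real (cmod (cinner x y))"
  have "cmod c = 1"
    using False by (simp add: c_def norm_divide)
  moreover have "c * cinner x y = of_real (cmod (cinner x y))"
    using False complex_norm_square[of "cinner x y"]
    by (simp add: c_def power2_eq_square field_simps)
  ultimately have c: "cmod c = 1" "c * cinner x y = of_real (cmod (cinner x y))" .
  have "cmod (cinner x y) = Re (cinner (scaleC c x) y)"
    using c by (simp add: cinner_scaleC_left)
  also have "\<dots> \<le> norm (scaleC c x) * norm y" by (rule Re_cinner_le)
  finally show ?thesis using c by (simp add: norm_scaleC)
qed simp

lemma bounded_linear_cinner_left: "bounded_linear (\<lambda>x. cinner x y)"
  by (rule bounded_linear_intro[where K = "norm y"])
    (auto simp: cinner_simps scaleR_conv_of_real norm_cinner_le)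

lemma bounded_linear_scaleC: "bounded_linear (\<lambda>x :: 'h::complex_hilbert_space. scaleC c x)"
  by (rule bounded_linear_intro[where K = "cmod c"])
    (auto simp: scaleC_add_right scaleR_scaleC scaleC_scaleC norm_scaleC mult.commute)

text \<open>
  A minimizing sequence is Cauchy by the parallelogram law, as the midpoint of two of its terms lies
  in the convex set and cannot have smaller norm than the infimum.
\<close>

lemma min_norm_exists:
  fixes C :: "'h::complex_hilbert_space set"
  assumes "closed C" "convex C" "C \<noteq> {}"
  shows "\<exists>p\<in>C. \<forall>z\<in>C. norm p \<le> norm z"
proof -
  define d where "d = Inf (norm ` C)"
  have d_le: "d \<le> norm z" if "z \<in> C" for z
    unfolding d_def by (rule cInf_lower) (use that in \<open>auto intro: bdd_belowI[of _ 0]\<close>)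
  have d0: "0 \<le> d"
    unfolding d_def by (rule cInf_greatest) (use assms in auto)
  have "\<exists>z\<in>C. norm z < d + inverse (real (Suc n))" for n
  proof -
    have "Inf (norm ` C) < d + inverse (real (Suc n))"
      by (simp add: d_def)
    then obtain t where "t \<in> norm ` C" "t < d + inverse (real (Suc n))"
      using cInf_lessD[of "norm ` C"] assms(3) by blast
    then show ?thesis by auto
  qed
  then have "\<exists>z. \<forall>n. z n \<in> C \<and> norm (z n) < d + inverse (real (Suc n))"
    by (intro choice) blast
  then obtain z where z: "\<And>n. z n \<in> C" "\<And>n. norm (z n) < d + inverse (real (Suc n))"
    by blast
  have nz: "(\<lambda>n. norm (z n)) \<longlonglongrightarrow> d"
  proof (rule tendsto_sandwich[where f = "\<lambda>_. d" and h = "\<lambda>n. d + inverse (real (Suc n))"])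
    show "(\<lambda>n. d + inverse (real (Suc n))) \<longlonglongrightarrow> d"
      using tendsto_add[OF tendsto_const LIMSEQ_inverse_real_of_nat, of d] by simp
  qed (use z d_le in \<open>auto intro!: always_eventually less_imp_le\<close>)
  have est: "(norm (z m - z n))\<^sup>2 \<le> 2 * (norm (z m))\<^sup>2 + 2 * (norm (z n))\<^sup>2 - 4 * d\<^sup>2" for m n
  proof -
    have "(1/2) *\<^sub>R z m + (1/2) *\<^sub>R z n \<in> C"
      using assms(2) z(1) by (simp add: convexD)
    then have "d \<le> norm ((1/2) *\<^sub>R (z m + z n))"
      using d_le by (simp add: scaleR_add_right)
    then have "2 * d \<le> norm (z m + z n)" by simp
    then have "4 * d\<^sup>2 \<le> (norm (z m + z n))\<^sup>2"
      using power_mono[of "2 * d" _ 2] d0 by (simp add: power_mult_distrib)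
    then show ?thesis using parallelogram[of "z m" "z n"] by linarith
  qed
  have "Cauchy z"
  proof (rule metric_CauchyI)
    fix e :: real assume e: "0 < e"
    have "(\<lambda>n. (norm (z n))\<^sup>2) \<longlonglongrightarrow> d\<^sup>2" by (intro tendsto_intros nz)
    from LIMSEQ_D[OF this, of "e\<^sup>2 / 4"]
    obtain M where M: "\<And>n. n \<ge> M \<Longrightarrow> \<bar>(norm (z n))\<^sup>2 - d\<^sup>2\<bar> < e\<^sup>2 / 4"
      using e by auto
    show "\<exists>M. \<forall>m\<ge>M. \<forall>n\<ge>M. dist (z m) (z n) < e"
    proof (intro exI allI impI)
      fix m n assume "M \<le> m" "M \<le> n"
      then have "(norm (z m - z n))\<^sup>2 < e\<^sup>2"
        using M[of m] M[of n] est[of m n] by linarith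
      then show "dist (z m) (z n) < e"
        using e by (simp add: dist_norm power_less_imp_less_base)
    qed
  qed
  then obtain p where p: "z \<longlonglongrightarrow> p" using Cauchy_convergent convergent_def by blast
  have "p \<in> C" using closed_sequentially[OF assms(1)] z(1) p by blast
  moreover have "norm p = d"
    using LIMSEQ_unique[OF tendsto_norm[OF p] nz] .
  ultimately show ?thesis using d_le by auto
qed

lemma min_norm_unique:
  fixes C :: "'h::complex_hilbert_space set"
  assumes "convex C" "p \<in> C" "q \<in> C" "\<And>z. z \<in> C \<Longrightarrow> norm p \<le> norm z" "norm q = norm p"
  shows "q = p"
proof -
  have "(1/2) *\<^sub>R p + (1/2) *\<^sub>R q \<in> C"
    using assms by (simp add: convexD)
  then have "norm p \<le> norm ((1/2) *\<^sub>R (p + q))"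
    using assms(4) by (simp add: scaleR_add_right)
  then have "2 * norm p \<le> norm (p + q)" by simp
  then have "4 * (norm p)\<^sup>2 \<le> (norm (p + q))\<^sup>2"
    using power_mono[of "2 * norm p" _ 2] by (simp add: power_mult_distrib)
  then have "(norm (p - q))\<^sup>2 \<le> 0" using parallelogram[of p q] unfolding assms(5) by linarith
  then show ?thesis by simp
qed

section \<open>Square roots of operators\<close>

text \<open>
  The iteration computes \<open>Y = 1 - sqrt (1 - S)\<close>, the fixed point of \<open>Y = (S + Y\<^sup>2) / 2\<close>. The same recursion
  in the scalar case \<open>S = 1\<close> dominates its norms.
\<close>

primrec sqrt_iter :: "('a::banach \<Rightarrow>\<^sub>L 'a) \<Rightarrow> nat \<Rightarrow> ('a \<Rightarrow>\<^sub>L 'a)" where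
  "sqrt_iter S 0 = 0"
| "sqrt_iter S (Suc n) = (1/2) *\<^sub>R (S + (sqrt_iter S n o\<^sub>L sqrt_iter S n))"

primrec sqrt_iter_bound :: "nat \<Rightarrow> real" where
  "sqrt_iter_bound 0 = 0"
| "sqrt_iter_bound (Suc n) = (1 + (sqrt_iter_bound n)\<^sup>2) / 2"

lemma sqrt_iter_bound: "0 \<le> sqrt_iter_bound n" "sqrt_iter_bound n \<le> 1"
proof -
  have "0 \<le> sqrt_iter_bound n \<and> sqrt_iter_bound n \<le> 1"
    by (induction n) (auto simp: power_le_one)
  then show "0 \<le> sqrt_iter_bound n" "sqrt_iter_bound n \<le> 1" by auto
qed

lemma incseq_sqrt_iter_bound: "incseq sqrt_iter_bound"
proof (rule incseq_SucI)
  fix n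
  show "sqrt_iter_bound n \<le> sqrt_iter_bound (Suc n)"
    using zero_le_power2[of "1 - sqrt_iter_bound n"] by (simp add: power2_diff)
qed

lemma sqrt_iter_commute: "B o\<^sub>L S = S o\<^sub>L B \<Longrightarrow> B o\<^sub>L sqrt_iter S n = sqrt_iter S n o\<^sub>L B"
proof (induction n)
  case (Suc n)
  then have "B (S x) = S (B x)" "B (sqrt_iter S n x) = sqrt_iter S n (B x)" for x
    by (metis blinfun_apply_blinfun_compose)+
  then show ?case
    by (auto intro!: blinfun_eqI simp: blinfun.bilinear_simps)
qed (auto intro!: blinfun_eqI simp: blinfun.bilinear_simps)

lemma norm_sqrt_iter: "norm S \<le> 1 \<Longrightarrow> norm (sqrt_iter S n) \<le> sqrt_iter_bound n"
proof (induction n)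
  case (Suc n)
  let ?Y = "sqrt_iter S n"
  have "norm (S + (?Y o\<^sub>L ?Y)) \<le> norm S + norm ?Y * norm ?Y"
    using norm_triangle_ineq[of S "?Y o\<^sub>L ?Y"] norm_blinfun_compose[of ?Y ?Y] by linarith
  also have "\<dots> \<le> 1 + (sqrt_iter_bound n)\<^sup>2"
    using Suc sqrt_iter_bound by (auto intro!: add_mono mult_mono simp: power2_eq_square)
  finally show ?case by simp
qed simp

text \<open>
  All iterates are polynomials in \<open>S\<close>, so they commute and the difference of their squares factors;
  the increments are then dominated by those of the scalar sequence. This gives convergence in norm
  even for \<open>norm S = 1\<close>, where the recursion is not a contraction.
\<close>

lemma norm_sqrt_iter_diff:
  assumes "norm S \<le> 1"
  shows "norm (sqrt_iter S (n + k) - sqrt_iter S n) \<le> sqrt_iter_bound (n + k) - sqrt_iter_bound n"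
proof (induction n)
  case 0
  then show ?case using norm_sqrt_iter[OF assms] by simp
next
  case (Suc n)
  let ?Z = "sqrt_iter S (n + k)" and ?Y = "sqrt_iter S n"
  let ?z = "sqrt_iter_bound (n + k)" and ?y = "sqrt_iter_bound n"
  have "?Y o\<^sub>L ?Z = ?Z o\<^sub>L ?Y"
    using sqrt_iter_commute[of ?Z S n] sqrt_iter_commute[of S S "n + k"] by simp
  then have "?Y (?Z x) = ?Z (?Y x)" for x
    by (metis blinfun_apply_blinfun_compose)
  then have "(?Z o\<^sub>L ?Z) - (?Y o\<^sub>L ?Y) = (?Z - ?Y) o\<^sub>L (?Z + ?Y)"
    by (intro blinfun_eqI) (simp add: blinfun.bilinear_simps)
  then have "sqrt_iter S (Suc n + k) - sqrt_iter S (Suc n) = (1/2) *\<^sub>R ((?Z - ?Y) o\<^sub>L (?Z + ?Y))"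
    by (simp add: algebra_simps)
  then have "norm (sqrt_iter S (Suc n + k) - sqrt_iter S (Suc n))
      \<le> (1/2) * (norm (?Z - ?Y) * norm (?Z + ?Y))"
    by (simp add: norm_blinfun_compose)
  also have "\<dots> \<le> (1/2) * ((?z - ?y) * (?z + ?y))"
  proof (intro mult_left_mono mult_mono)
    show "norm (?Z + ?Y) \<le> ?z + ?y"
      using norm_sqrt_iter[OF assms] by (meson add_mono norm_triangle_le)
    show "0 \<le> ?z - ?y" using incseq_sqrt_iter_bound by (simp add: incseq_def)
  qed (use Suc in auto)
  also have "\<dots> = sqrt_iter_bound (Suc n + k) - sqrt_iter_bound (Suc n)"
    by (simp add: power2_eq_square algebra_simps diff_divide_distrib)
  finally show ?case .
qed

text \<open>
  The operator \<open>1 - Y\<close> is a square root of \<open>1 - S\<close>; as a limit of polynomials in \<open>S\<close> it commutes with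
  everything that commutes with \<open>S\<close>.
\<close>

lemma operator_sqrt:
  fixes S :: "'a::banach \<Rightarrow>\<^sub>L 'a"
  assumes "norm S \<le> 1"
  obtains Y where "norm Y \<le> 1" "2 *\<^sub>R Y = S + (Y o\<^sub>L Y)"
    "\<And>B. B o\<^sub>L S = S o\<^sub>L B \<Longrightarrow> B o\<^sub>L Y = Y o\<^sub>L B"
proof -
  have "convergent sqrt_iter_bound"
    by (rule Bseq_monoseq_convergent)
      (use sqrt_iter_bound incseq_sqrt_iter_bound in \<open>auto intro!: BseqI'[where K=1] simp: monoseq_iff\<close>)
  then have C: "Cauchy sqrt_iter_bound" by (rule convergent_Cauchy)
  have "Cauchy (sqrt_iter S)"
  proof (rule metric_CauchyI)
    fix e :: real assume "0 < e"
    from CauchyD[OF C this]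
    obtain M where M: "\<And>m n. m \<ge> M \<Longrightarrow> n \<ge> M \<Longrightarrow> \<bar>sqrt_iter_bound m - sqrt_iter_bound n\<bar> < e"
      by auto
    have "dist (sqrt_iter S m) (sqrt_iter S n) < e" if le: "M \<le> n" "n \<le> m" for m n
    proof -
      obtain k where "m = n + k" using le_Suc_ex[OF le(2)] by blast
      then have "norm (sqrt_iter S m - sqrt_iter S n) \<le> sqrt_iter_bound m - sqrt_iter_bound n"
        using norm_sqrt_iter_diff[OF assms] by simp
      also have "\<dots> < e" using M[of m n] le by simp
      finally show ?thesis by (simp add: dist_norm)
    qed
    then have "dist (sqrt_iter S m) (sqrt_iter S n) < e" if "M \<le> n" "M \<le> m" for m n
      using that nat_le_linear[of m n] dist_commute[of "sqrt_iter S m"] by fastforce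
    then show "\<exists>M. \<forall>m\<ge>M. \<forall>n\<ge>M. dist (sqrt_iter S m) (sqrt_iter S n) < e"
      by blast
  qed
  then obtain Y where Y: "sqrt_iter S \<longlonglongrightarrow> Y" using Cauchy_convergent convergent_def by blast
  have "norm Y \<le> 1"
  proof (rule LIMSEQ_le_const2[OF tendsto_norm[OF Y]])
    show "\<exists>N. \<forall>n\<ge>N. norm (sqrt_iter S n) \<le> 1"
      using norm_sqrt_iter[OF assms] sqrt_iter_bound order_trans by blast
  qed
  moreover have "2 *\<^sub>R Y = S + (Y o\<^sub>L Y)"
  proof (rule LIMSEQ_unique)
    show "(\<lambda>n. 2 *\<^sub>R sqrt_iter S (Suc n)) \<longlonglongrightarrow> 2 *\<^sub>R Y"
      by (intro tendsto_intros LIMSEQ_Suc Y)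
    show "(\<lambda>n. 2 *\<^sub>R sqrt_iter S (Suc n)) \<longlonglongrightarrow> S + (Y o\<^sub>L Y)"
      unfolding sqrt_iter.simps scaleR_scaleR
      by (simp, intro tendsto_intros bounded_bilinear.tendsto[OF bounded_bilinear_blinfun_compose] Y)
  qed
  moreover have "B o\<^sub>L Y = Y o\<^sub>L B" if "B o\<^sub>L S = S o\<^sub>L B" for B
  proof (rule LIMSEQ_unique)
    show "(\<lambda>n. B o\<^sub>L sqrt_iter S n) \<longlonglongrightarrow> (B o\<^sub>L Y)"
      by (intro bounded_bilinear.tendsto[OF bounded_bilinear_blinfun_compose] tendsto_const Y)
    show "(\<lambda>n. B o\<^sub>L sqrt_iter S n) \<longlonglongrightarrow> (Y o\<^sub>L B)"
      unfolding sqrt_iter_commute[OF that]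
      by (intro bounded_bilinear.tendsto[OF bounded_bilinear_blinfun_compose] tendsto_const Y)
  qed
  ultimately show ?thesis using that by blast
qed


section \<open>Schur's lemma\<close>

text \<open>
  The family \<open>\<A>\<close> acts irreducibly on the range of the projection \<open>P\<close>; in the form used here this says
  that an operator commuting with \<open>\<A>\<close> and vanishing at a nonzero vector of the range vanishes on the
  whole range. A self-adjoint operator \<open>T\<close> on the range, scaled to a contraction \<open>U\<close>, has an absolute
  value \<open>R \<ge> 0\<close> with \<open>R\<^sup>2 = U\<^sup>2\<close> that commutes with \<open>\<A>\<close>. As \<open>R - U\<close> vanishes on the range of \<open>R + U\<close>,
  one of the two factors is zero.
\<close>

lemma sign_definite_if_irreducible:
  fixes P T :: "'h::complex_hilbert_space \<Rightarrow>\<^sub>L 'h"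
  assumes P_idem: "P o\<^sub>L P = P" and P_adj: "\<And>x y. cinner (P x) y = cinner x (P y)"
    and PT: "P o\<^sub>L T = T" and TP: "T o\<^sub>L P = T"
    and T_adj: "\<And>x y. cinner (T x) y = cinner x (T y)"
    and P_comm: "\<And>A. A \<in> \<A> \<Longrightarrow> A o\<^sub>L P = P o\<^sub>L A"
    and T_comm: "\<And>A. A \<in> \<A> \<Longrightarrow> A o\<^sub>L T = T o\<^sub>L A"
    and irr: "\<And>X v. (\<And>A. A \<in> \<A> \<Longrightarrow> A o\<^sub>L X = X o\<^sub>L A) \<Longrightarrow> P v = v \<Longrightarrow> v \<noteq> 0 \<Longrightarrow> X v = 0
      \<Longrightarrow> X o\<^sub>L P = 0"
  shows "(\<forall>x. 0 \<le> Re (cinner (T x) x)) \<or> (\<forall>x. Re (cinner (T x) x) \<le> 0)"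
proof -
  define r where "r = inverse (norm T + 1)"
  define U where "U = r *\<^sub>R T"
  have r: "r > 0" "norm U \<le> 1"
    by (auto simp: r_def U_def add_nonneg_pos divide_simps)
  have PU: "P (U x) = U x" and UP: "U (P x) = U x" for x
    using PT TP unfolding U_def
    by (metis blinfun.scaleR_left blinfun.scaleR_right blinfun_apply_blinfun_compose)+
  have PP: "P (P x) = P x" for x
    using P_idem by (metis blinfun_apply_blinfun_compose)
  have U_adj: "cinner (U x) y = cinner x (U y)" for x y
    by (simp add: U_def blinfun.scaleR_left cinner_simps T_adj)
  have U_comm: "A o\<^sub>L U = U o\<^sub>L A" if "A \<in> \<A>" for A
    using T_comm[OF that] unfolding U_def
    by (simp add: bounded_bilinear.scaleR_left[OF bounded_bilinear_blinfun_compose]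
        bounded_bilinear.scaleR_right[OF bounded_bilinear_blinfun_compose])
  have norm_U: "norm (U x) \<le> norm x" for x
    using norm_blinfun[of U x] r(2) by (meson mult_left_le_one_le norm_ge_zero order_trans)
  have norm_P: "norm (P x) \<le> norm x" for x
  proof -
    have "(norm (P x))\<^sup>2 = Re (cinner (P x) x)"
      by (simp add: power2_norm_cinner P_adj PP)
    also have "\<dots> \<le> norm (P x) * norm x" by (rule Re_cinner_le)
    finally show ?thesis
      by (metis mult_le_cancel_left_pos norm_ge_zero order_le_less power2_eq_square)
  qed
  \<comment> \<open>the operator whose complement \<open>P - S\<close> in the range of \<open>P\<close> is \<open>U\<^sup>2\<close>\<close>
  define S where "S = P - (U o\<^sub>L U)"
  have "norm S \<le> 1"
  proof (rule norm_blinfun_bound)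
    fix x
    have "cinner (P x) (U (U x)) = cinner (U x) (U x)"
      by (simp add: UP flip: U_adj)
    then have "Re (cinner (P x) (U (U x))) = (norm (U x))\<^sup>2"
      by (simp only: power2_norm_cinner)
    then have "(norm (S x))\<^sup>2 = (norm (P x))\<^sup>2 - 2 * (norm (U x))\<^sup>2 + (norm (U (U x)))\<^sup>2"
      by (simp add: S_def blinfun.diff_left norm_diff_square)
    also have "\<dots> \<le> (norm x)\<^sup>2"
      using power_mono[OF norm_U[of "U x"] norm_ge_zero, of 2]
        power_mono[OF norm_P[of x] norm_ge_zero, of 2] zero_le_power2[of "norm (U x)"] by linarith
    finally have "norm (S x) \<le> norm x"
      by (rule power2_le_imp_le) simp
    then show "norm (S x) \<le> 1 * norm x" by simp
  qed simp
  then obtain Y where Y: "norm Y \<le> 1" "2 *\<^sub>R Y = S + (Y o\<^sub>L Y)"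
    and Y_comm: "\<And>B. B o\<^sub>L S = S o\<^sub>L B \<Longrightarrow> B o\<^sub>L Y = Y o\<^sub>L B"
    using operator_sqrt by blast
  have appl: "B o\<^sub>L C = C o\<^sub>L B \<Longrightarrow> B (C x) = C (B x)" for B C :: "'h \<Rightarrow>\<^sub>L 'h" and x
    by (metis blinfun_apply_blinfun_compose)
  have YP: "P (Y x) = Y (P x)" for x
    by (rule appl, rule Y_comm, rule blinfun_eqI)
      (simp add: S_def blinfun.bilinear_simps PU UP PP)
  have YU: "U (Y x) = Y (U x)" for x
    by (rule appl, rule Y_comm, rule blinfun_eqI)
      (simp add: S_def blinfun.bilinear_simps PU UP PP)
  have YA: "A (Y x) = Y (A x)" if "A \<in> \<A>" for A x
    by (rule appl, rule Y_comm, rule blinfun_eqI)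
      (simp add: S_def blinfun.bilinear_simps appl[OF U_comm[OF that]] appl[OF P_comm[OF that]])
  \<comment> \<open>\<open>1 - Y\<close> restricted to the range of \<open>P\<close>\<close>
  define R where "R = P - (P o\<^sub>L Y)"
  have YY: "Y (Y x) = 2 *\<^sub>R Y x - P x + U (U x)" for x
    using arg_cong[OF Y(2), of "\<lambda>B. blinfun_apply B x"]
    by (simp add: S_def blinfun.bilinear_simps algebra_simps)
  have RU: "R (R x) = U (U x)" "R (U x) = U (R x)" for x
    by (simp_all add: R_def blinfun.bilinear_simps YP PP PU UP YU YY)
       (simp add: YP[symmetric] PP PU UP YY blinfun.bilinear_simps scaleR_2)
  have R_pos: "0 \<le> Re (cinner (R x) x)" for x
  proof -
    have "Re (cinner (P (Y x)) x) = Re (cinner (Y (P x)) (P x))"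
      by (metis P_adj PP YP)
    also have "\<dots> \<le> norm (Y (P x)) * norm (P x)" by (rule Re_cinner_le)
    also have "\<dots> \<le> norm (P x) * norm (P x)"
      using norm_blinfun[of Y "P x"] mult_left_le_one_le[of "norm (P x)" "norm Y"] Y(1)
      by (intro mult_right_mono) auto
    also have "\<dots> = Re (cinner (P x) x)"
      by (metis P_adj PP power2_eq_square power2_norm_cinner)
    finally show ?thesis by (simp add: R_def blinfun.diff_left cinner_simps)
  qed
  have RT: "T x = inverse r *\<^sub>R U x" for x
    using r by (simp add: U_def blinfun.scaleR_left)
  show ?thesis
  proof (cases "\<forall>x. R x + U x = 0")
    case True
    then have "U x = - R x" for x by (simp add: eq_neg_iff_add_eq_0 add.commute)
    then have "Re (cinner (T x) x) \<le> 0" for x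
      using R_pos[of x] r by (simp add: RT cinner_simps mult_nonneg_nonneg)
    then show ?thesis by blast
  next
    case False
    then obtain x where x: "R x + U x \<noteq> 0" by blast
    have "(R - U) o\<^sub>L P = 0"
    proof (rule irr)
      show "A o\<^sub>L (R - U) = (R - U) o\<^sub>L A" if "A \<in> \<A>" for A
        by (rule blinfun_eqI) (simp add: R_def blinfun.bilinear_simps YA[OF that]
            appl[OF U_comm[OF that]] appl[OF P_comm[OF that]])
      show "P (R x + U x) = R x + U x"
        by (simp add: R_def blinfun.bilinear_simps PP PU)
      show "(R - U) (R x + U x) = 0"
        by (simp add: blinfun.bilinear_simps RU)
    qed (rule x)
    then have "(R - U) (P z) = 0" for z
      by (metis blinfun_apply_blinfun_compose zero_blinfun.rep_eq)
    then have "R (P z) = U z" for z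
      by (simp add: blinfun.diff_left UP)
    moreover have "R (P z) = R z" for z
      by (simp add: R_def blinfun.bilinear_simps PP YP)
    ultimately have "U x = R x" for x by simp
    then have "0 \<le> Re (cinner (T x) x)" for x
      using R_pos[of x] r by (simp add: RT cinner_simps mult_nonneg_nonneg)
    then show ?thesis by blast
  qed
qed

lemma nonneg_quadratic_linear_term:
  fixes a b :: real
  assumes "\<And>t. 0 \<le> 2 * t * a + t\<^sup>2 * b"
  shows "a = 0"
proof -
  \<comment> \<open>a value of \<open>t\<close> so small that the quadratic term cannot compensate the linear one\<close>
  define t where "t = inverse (\<bar>b\<bar> + 1)"
  have t: "t > 0" "t * \<bar>b\<bar> < 1" by (auto simp: t_def divide_simps)
  have *: "0 \<le> 2 * (- (t * a)) * a + (- (t * a))\<^sup>2 * b" by (rule assms)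
  have "(- (t * a))\<^sup>2 * b \<le> (t * a)\<^sup>2 * \<bar>b\<bar>"
    using mult_left_mono[OF abs_ge_self[of b] zero_le_power2[of "t * a"]] by simp
  also have "\<dots> = t * (t * \<bar>b\<bar>) * a\<^sup>2"
    by (simp add: power2_eq_square ac_simps)
  also have "\<dots> \<le> t * 1 * a\<^sup>2"
    using t by (intro mult_right_mono mult_left_mono) auto
  finally have "t * a\<^sup>2 \<le> 0" using * by (simp add: power2_eq_square algebra_simps)
  then show "a = 0"
    using t by (simp add: mult_le_0_iff)
qed

text \<open>
  For a vector \<open>v\<close> of the range choose \<open>c\<close> such that \<open>D = T - c P\<close> satisfies \<open>\<langle>D v, v\<rangle> = 0\<close>. As \<open>D\<close> is
  semidefinite, \<open>v\<close> is an extremum of its quadratic form, whence \<open>D v = 0\<close> and, by irreducibility,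
  \<open>D = 0\<close>.
\<close>

lemma selfadjoint_scalar_if_irreducible:
  fixes P T :: "'h::complex_hilbert_space \<Rightarrow>\<^sub>L 'h"
  assumes P_idem: "P o\<^sub>L P = P" and P_adj: "\<And>x y. cinner (P x) y = cinner x (P y)"
    and PT: "P o\<^sub>L T = T" and TP: "T o\<^sub>L P = T"
    and T_adj: "\<And>x y. cinner (T x) y = cinner x (T y)"
    and P_comm: "\<And>A. A \<in> \<A> \<Longrightarrow> A o\<^sub>L P = P o\<^sub>L A"
    and T_comm: "\<And>A. A \<in> \<A> \<Longrightarrow> A o\<^sub>L T = T o\<^sub>L A"
    and irr: "\<And>X v. (\<And>A. A \<in> \<A> \<Longrightarrow> A o\<^sub>L X = X o\<^sub>L A) \<Longrightarrow> P v = v \<Longrightarrow> v \<noteq> 0 \<Longrightarrow> X v = 0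
      \<Longrightarrow> X o\<^sub>L P = 0"
  shows "\<exists>c::real. T = c *\<^sub>R P"
proof (cases "P = 0")
  case True
  then have "T = 0 *\<^sub>R P" using PT by (simp add: True)
  then show ?thesis by blast
next
  case False
  then obtain u where u: "P u \<noteq> 0" by (metis blinfun_eqI zero_blinfun.rep_eq)
  define v where "v = P u"
  have v: "P v = v" "v \<noteq> 0"
    using P_idem u by (auto simp: v_def) (metis blinfun_apply_blinfun_compose)
  define c where "c = Re (cinner (T v) v) / (norm v)\<^sup>2"
  define D where "D = T - c *\<^sub>R P"
  have app: "P (P x) = P x" "P (T x) = T x" "T (P x) = T x" for x
    using P_idem PT TP by (metis blinfun_apply_blinfun_compose)+
  have Dv: "Re (cinner (D v) v) = 0"
    using v by (simp add: D_def c_def blinfun.bilinear_simps cinner_simps flip: power2_norm_cinner)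
  have D_adj: "cinner (D x) y = cinner x (D y)" for x y
    by (simp add: D_def blinfun.bilinear_simps cinner_simps P_adj T_adj)
  have appl: "B o\<^sub>L C = C o\<^sub>L B \<Longrightarrow> B (C x) = C (B x)" for B C :: "'h \<Rightarrow>\<^sub>L 'h" and x
    by (metis blinfun_apply_blinfun_compose)
  have D_comm: "A o\<^sub>L D = D o\<^sub>L A" if "A \<in> \<A>" for A
    by (rule blinfun_eqI) (simp add: D_def blinfun.bilinear_simps
        appl[OF P_comm[OF that]] appl[OF T_comm[OF that]])
  have sign: "(\<forall>x. 0 \<le> Re (cinner (D x) x)) \<or> (\<forall>x. Re (cinner (D x) x) \<le> 0)"
  proof (rule sign_definite_if_irreducible[where P = P and \<A> = \<A>])
    show "P o\<^sub>L D = D" "D o\<^sub>L P = D"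
      by (auto intro!: blinfun_eqI simp: app D_def blinfun.bilinear_simps)
  qed (fact P_idem P_adj D_adj P_comm D_comm irr)+
  \<comment> \<open>the quadratic form along the direction \<open>D v\<close>, where its derivative at \<open>v\<close> is \<open>2 (norm (D v))\<^sup>2\<close>\<close>
  have quad: "Re (cinner (D (v + t *\<^sub>R D v)) (v + t *\<^sub>R D v))
      = 2 * t * (norm (D v))\<^sup>2 + t\<^sup>2 * Re (cinner (D (D v)) (D v))" for t
  proof -
    have "Re (cinner (D (D v)) v) = (norm (D v))\<^sup>2"
      by (simp add: D_adj power2_norm_cinner)
    then show ?thesis
      using Dv by (simp add: blinfun.bilinear_simps cinner_simps power2_norm_cinner)
        (simp add: power2_eq_square algebra_simps)
  qed
  have "(norm (D v))\<^sup>2 = 0"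
  proof (cases "\<forall>x. 0 \<le> Re (cinner (D x) x)")
    case True
    then show ?thesis
      using nonneg_quadratic_linear_term[of "(norm (D v))\<^sup>2"] quad by metis
  next
    case False
    then have "\<forall>x. Re (cinner (D x) x) \<le> 0" using sign by blast
    then have "0 \<le> 2 * t * (- (norm (D v))\<^sup>2) + t\<^sup>2 * (- Re (cinner (D (D v)) (D v)))" for t
      using quad[of t] by (smt (verit) mult_minus_right)
    then show ?thesis
      using nonneg_quadratic_linear_term[of "- (norm (D v))\<^sup>2"] by fastforce
  qed
  then have "D o\<^sub>L P = 0"
    by (intro irr[OF _ v]) (use D_comm in auto)
  then have "D (P x) = 0" for x
    by (metis blinfun_apply_blinfun_compose zero_blinfun.rep_eq)
  then have "T x = c *\<^sub>R P x" for x
    by (simp add: D_def blinfun.bilinear_simps app)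
  then have "T = c *\<^sub>R P"
    by (intro blinfun_eqI) (simp add: blinfun.bilinear_simps)
  then show ?thesis by blast
qed

lemma closed_zero_set: "bounded_linear f \<Longrightarrow> closed {x. f x = 0}"
proof -
  assume "bounded_linear f"
  then have "closed (f -` {0})"
    by (rule continuous_closed_vimage[OF closed_singleton linear_continuous_at])
  then show ?thesis by (simp only: vimage_def singleton_iff)
qed

section \<open>Unitary representations\<close>

locale unitary_rep = group G for G (structure) +
  fixes \<rho> :: "'a \<Rightarrow> 'h::complex_hilbert_space \<Rightarrow> 'h"
  assumes hom: "\<rho> \<in> hom G unitary_group"
begin

lemma rho_unitary:
  assumes "g \<in> carrier G"
  shows "Vector_Spaces.linear scaleC scaleC (\<rho> g)" "cinner (\<rho> g x) (\<rho> g y) = cinner x y"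
  using hom_in_carrier[OF hom assms] by (simp_all add: unitary_group_def)

lemma rho_mult: "g \<in> carrier G \<Longrightarrow> h \<in> carrier G \<Longrightarrow> \<rho> (g \<otimes> h) x = \<rho> g (\<rho> h x)"
  using hom_mult[OF hom] by (simp add: unitary_group_def)

lemma rho_add: "g \<in> carrier G \<Longrightarrow> \<rho> g (x + y) = \<rho> g x + \<rho> g y"
  using rho_unitary(1)[of g] by (simp add: Vector_Spaces.linear_iff)

lemma rho_scaleC: "g \<in> carrier G \<Longrightarrow> \<rho> g (scaleC c x) = scaleC c (\<rho> g x)"
  using rho_unitary(1)[of g] by (simp add: Vector_Spaces.linear_iff)

lemma rho_norm: "g \<in> carrier G \<Longrightarrow> norm (\<rho> g x) = norm x"
  by (rule power2_eq_imp_eq) (simp_all add: power2_norm_cinner rho_unitary(2))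

lemma rho_bounded_linear: "g \<in> carrier G \<Longrightarrow> bounded_linear (\<rho> g)"
  by (rule bounded_linear_intro[where K = 1])
    (auto simp: rho_add rho_scaleC scaleR_scaleC rho_norm)

lemma rho_one: "\<rho> \<one> x = x"
proof -
  have "norm (\<rho> \<one> (\<rho> \<one> x - x)) = 0"
    using rho_mult[of \<one> \<one> x] bounded_linear.linear[OF rho_bounded_linear[of \<one>]]
    by (simp add: linear_diff)
  then show ?thesis by (simp add: rho_norm)
qed

lemma rho_adjoint: "g \<in> carrier G \<Longrightarrow> cinner (\<rho> g x) y = cinner x (\<rho> (inv g) y)"
  using rho_unitary(2)[of g x "\<rho> (inv g) y"] by (simp add: rho_one flip: rho_mult)

end

locale fixed_vectors_rep = unitary_rep G \<rho>
  for G (structure) and \<rho> :: "'a \<Rightarrow> 'h::complex_hilbert_space \<Rightarrow> 'h" +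
  fixes L :: "'a set"
  assumes L_subset: "L \<subseteq> carrier G"
    and L_nonempty: "L \<noteq> {}"
    and L_mult: "l \<in> L \<Longrightarrow> l' \<in> L \<Longrightarrow> l \<otimes> l' \<in> L"
begin

abbreviation V :: "'h set" where "V \<equiv> fixed_vectors \<rho> L"

abbreviation orbit_hull :: "'h \<Rightarrow> 'h set" where
  "orbit_hull x \<equiv> closure (convex hull ((\<lambda>l. \<rho> l x) ` L))"

lemma L_carrier [simp]: "l \<in> L \<Longrightarrow> l \<in> carrier G"
  using L_subset by blast

lemma V_iff: "v \<in> V \<longleftrightarrow> (\<forall>l\<in>L. \<rho> l v = v)"
  by (simp add: fixed_vectors_def)

lemma V_add: "v \<in> V \<Longrightarrow> w \<in> V \<Longrightarrow> v + w \<in> V"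
  by (simp add: V_iff rho_add)

lemma V_scaleC: "v \<in> V \<Longrightarrow> scaleC c v \<in> V"
  by (simp add: V_iff rho_scaleC)

lemma orbit_hull_subset:
  assumes "closed C" "convex C" "\<And>l. l \<in> L \<Longrightarrow> \<rho> l x \<in> C"
  shows "orbit_hull x \<subseteq> C"
  using assms by (intro closure_minimal hull_minimal) auto

lemma orbit_hull_invariant:
  assumes "l \<in> L" "z \<in> orbit_hull x"
  shows "\<rho> l z \<in> orbit_hull x"
proof -
  have bl: "bounded_linear (\<rho> l)" using assms by (simp add: rho_bounded_linear)
  have "orbit_hull x \<subseteq> \<rho> l -` orbit_hull x"
  proof (rule orbit_hull_subset)
    show "closed (\<rho> l -` orbit_hull x)"
      using bl by (intro continuous_closed_vimage) (auto intro: linear_continuous_at)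
    show "convex (\<rho> l -` orbit_hull x)"
      using bounded_linear.linear[OF bl] by (intro convex_linear_vimage) (auto intro: convex_closure)
    show "\<rho> k x \<in> \<rho> l -` orbit_hull x" if "k \<in> L" for k
    proof -
      have "\<rho> l (\<rho> k x) = \<rho> (l \<otimes> k) x" using that assms by (simp add: rho_mult)
      moreover have "\<rho> (l \<otimes> k) x \<in> orbit_hull x"
        using that assms(1)
        by (intro subsetD[OF closure_subset] hull_inc image_eqI[OF refl]) (rule L_mult)
      ultimately show ?thesis by simp
    qed
  qed
  then show ?thesis using assms by blast
qed

text \<open>
  The point of smallest norm in the closed convex hull of an orbit is unique, hence fixed by \<open>L\<close>; and
  the inner product with a fixed vector is constant on the hull. So this point is the orthogonal
  projection of \<open>x\<close>, and this description puts the projection into the hull, which \<open>theta_limit\<close> needs.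
\<close>

lemma projection_exists: "\<exists>p\<in>V. p \<in> orbit_hull x \<and> (\<forall>v\<in>V. cinner p v = cinner x v)"
proof -
  have "orbit_hull x \<noteq> {}" using L_nonempty by simp
  then obtain p where p: "p \<in> orbit_hull x" "\<And>z. z \<in> orbit_hull x \<Longrightarrow> norm p \<le> norm z"
    using min_norm_exists[of "orbit_hull x"] by (meson closed_closure convex_closure convex_convex_hull)
  have "p \<in> V"
    unfolding V_iff
    by (intro ballI, rule min_norm_unique[of "orbit_hull x"])
      (use p in \<open>auto intro: convex_closure orbit_hull_invariant simp: rho_norm\<close>)
  moreover have "cinner p v = cinner x v" if v: "v \<in> V" for v
  proof -
    have bl: "bounded_linear (\<lambda>z. cinner z v)" by (rule bounded_linear_cinner_left)
    have "orbit_hull x \<subseteq> (\<lambda>z. cinner z v) -` {cinner x v}"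
    proof (rule orbit_hull_subset)
      show "closed ((\<lambda>z. cinner z v) -` {cinner x v})"
        using bl by (intro continuous_closed_vimage) (auto intro: linear_continuous_at)
      show "convex ((\<lambda>z. cinner z v) -` {cinner x v})"
        using bounded_linear.linear[OF bl] by (intro convex_linear_vimage) auto
      show "\<rho> l x \<in> (\<lambda>z. cinner z v) -` {cinner x v}" if "l \<in> L" for l
        using that v rho_unitary(2)[of l x v] by (simp add: V_iff)
    qed
    then show ?thesis using p(1) by blast
  qed
  ultimately show ?thesis using p(1) by blast
qed

definition proj :: "'h \<Rightarrow> 'h" where
  "proj x = (SOME p. p \<in> V \<and> p \<in> orbit_hull x \<and> (\<forall>v\<in>V. cinner p v = cinner x v))"

lemma proj: "proj x \<in> V" "proj x \<in> orbit_hull x" "v \<in> V \<Longrightarrow> cinner (proj x) v = cinner x v"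
proof -
  have "proj x \<in> V \<and> proj x \<in> orbit_hull x \<and> (\<forall>v\<in>V. cinner (proj x) v = cinner x v)"
    unfolding proj_def by (rule someI_ex) (use projection_exists in blast)
  then show "proj x \<in> V" "proj x \<in> orbit_hull x" "v \<in> V \<Longrightarrow> cinner (proj x) v = cinner x v"
    by auto
qed

lemma proj_unique:
  assumes "p \<in> V" "\<And>v. v \<in> V \<Longrightarrow> cinner p v = cinner x v"
  shows "proj x = p"
proof -
  have "p + scaleC (-1) (proj x) \<in> V" using assms(1) proj(1) by (intro V_add V_scaleC)
  then have d: "p - proj x \<in> V" by simp
  then have "cinner (p - proj x) (p - proj x) = 0"
    unfolding cinner_diff_left[of p "proj x"] using assms(2) proj(3) by simp
  then show ?thesis by simp
qed

lemma proj_fixed: "v \<in> V \<Longrightarrow> proj v = v"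
  by (rule proj_unique) auto

lemma proj_add: "proj (x + y) = proj x + proj y"
  by (rule proj_unique) (auto simp: proj V_add cinner_simps)

lemma proj_scaleC: "proj (scaleC c x) = scaleC c (proj x)"
  by (rule proj_unique) (auto simp: proj V_scaleC cinner_simps)

lemma proj_adjoint: "cinner (proj x) y = cinner x (proj y)"
proof -
  have "cinner (proj x) y = cnj (cinner (proj y) (proj x))"
    using cinner_commute[of "proj x" y] proj(3)[OF proj(1), of y x] by simp
  also have "\<dots> = cinner x (proj y)"
    using cinner_commute[of "proj x" "proj y"] proj(3)[OF proj(1), of x y] by simp
  finally show ?thesis .
qed

lemma proj_norm: "norm (proj x) \<le> norm x"
proof -
  have "(norm (proj x))\<^sup>2 = Re (cinner x (proj x))"
    unfolding power2_norm_cinner proj(3)[OF proj(1)] ..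
  also have "\<dots> \<le> norm x * norm (proj x)" by (rule Re_cinner_le)
  finally show ?thesis
    by (metis mult_le_cancel_right_pos norm_ge_zero order_le_less power2_eq_square)
qed

lemma proj_bounded_linear: "bounded_linear proj"
  by (rule bounded_linear_intro[where K = 1])
    (auto simp: proj_add proj_scaleC scaleR_scaleC proj_norm)

end

locale asymptotically_commuting_rep = fixed_vectors_rep G \<rho> L
  for G (structure) and \<rho> :: "'a \<Rightarrow> 'h::complex_hilbert_space \<Rightarrow> 'h" and L +
  fixes \<theta> :: "nat \<Rightarrow> 'a"
  assumes theta: "\<theta> N \<in> L" "\<theta> N \<otimes> \<theta> N = \<one>"
    and theta_commute: "a \<in> carrier G \<Longrightarrow> b \<in> carrier G \<Longrightarrow>
      \<forall>\<^sub>F N in sequentially. (\<theta> N \<otimes> a \<otimes> \<theta> N) \<otimes> b = b \<otimes> (\<theta> N \<otimes> a \<otimes> \<theta> N)"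
begin

lemma theta_carrier [simp]: "\<theta> N \<in> carrier G"
  using theta(1) by simp

lemma rho_theta_theta: "\<rho> (\<theta> N) (\<rho> (\<theta> N) x) = x"
  using theta(2) rho_mult[of "\<theta> N" "\<theta> N" x] by (simp add: rho_one)

lemma inv_theta: "inv (\<theta> N) = \<theta> N"
  using theta(2) by (simp add: inv_equality)

text \<open>
  The vectors \<open>z\<close> for which \<open>\<rho>(\<theta>\<^sub>N) z\<close> and \<open>\<rho>(\<theta>\<^sub>N) x\<close> have asymptotically the same coefficient at \<open>y\<close>
  form a closed convex set. It contains the orbit of \<open>x\<close>, because \<open>\<theta>\<^sub>N l\<close> and \<open>\<theta>\<^sub>N\<close> differ by the factor
  \<open>\<theta>\<^sub>N l \<theta>\<^sub>N\<close> on the left, which finally fixes \<open>y\<close>. So it contains the projection of \<open>x\<close>, which each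
  \<open>\<theta>\<^sub>N\<close> fixes.
\<close>

lemma theta_limit:
  assumes y: "\<And>l. l \<in> L \<Longrightarrow> \<forall>\<^sub>F N in sequentially. \<rho> (\<theta> N \<otimes> l \<otimes> \<theta> N) y = y"
  shows "(\<lambda>N. cinner (\<rho> (\<theta> N) x) y) \<longlonglongrightarrow> cinner (proj x) y"
proof -
  define C where "C = {z. (\<lambda>N. cinner (\<rho> (\<theta> N) (z - x)) y) \<longlonglongrightarrow> 0}"
  have rho_lin: "linear (\<rho> (\<theta> N))" for N
    by (simp add: bounded_linear.linear rho_bounded_linear)
  have "convex C"
  proof (rule convexI)
    fix u v :: 'h and s t :: real
    assume *: "u \<in> C" "v \<in> C" "s + t = 1"
    have "s *\<^sub>R u + t *\<^sub>R v - x = s *\<^sub>R (u - x) + t *\<^sub>R (v - x)"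
      using *(3) by (simp add: algebra_simps flip: scaleR_add_left)
    then have "cinner (\<rho> (\<theta> N) (s *\<^sub>R u + t *\<^sub>R v - x)) y
        = of_real s * cinner (\<rho> (\<theta> N) (u - x)) y + of_real t * cinner (\<rho> (\<theta> N) (v - x)) y" for N
      using rho_lin by (simp add: linear_add linear_scale cinner_simps)
    moreover have "(\<lambda>N. complex_of_real s * cinner (\<rho> (\<theta> N) (u - x)) y
        + of_real t * cinner (\<rho> (\<theta> N) (v - x)) y) \<longlonglongrightarrow> of_real s * 0 + of_real t * 0"
      using * unfolding C_def by (intro tendsto_intros) auto
    ultimately show "s *\<^sub>R u + t *\<^sub>R v \<in> C" by (simp add: C_def)
  qed
  moreover have "closed C"
    unfolding closed_sequential_limits
  proof (intro allI impI, elim conjE)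
    fix z w assume z: "\<forall>n. z n \<in> C" "z \<longlonglongrightarrow> w"
    have "\<forall>\<^sub>F N in sequentially. cmod (cinner (\<rho> (\<theta> N) (w - x)) y) < e" if e: "e > 0" for e
    proof -
      have "(\<lambda>n. norm (z n - w) * norm y) \<longlonglongrightarrow> 0 * norm y"
        using z(2) by (intro tendsto_intros) (simp add: LIM_zero tendsto_norm_zero)
      then have "\<forall>\<^sub>F n in sequentially. norm (z n - w) * norm y < e / 2"
        using e by (intro order_tendstoD) auto
      then obtain n where n: "norm (z n - w) * norm y < e / 2"
        using eventually_happens trivial_limit_sequentially by blast
      have "(\<lambda>N. cinner (\<rho> (\<theta> N) (z n - x)) y) \<longlonglongrightarrow> 0" using z(1) by (simp add: C_def)
      from order_tendstoD(2)[OF tendsto_norm[OF this], of "e / 2"]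
      have "\<forall>\<^sub>F N in sequentially. cmod (cinner (\<rho> (\<theta> N) (z n - x)) y) < e / 2" using e by simp
      then show ?thesis
      proof eventually_elim
        case (elim N)
        have "w - x = (z n - x) - (z n - w)" by simp
        then have "cinner (\<rho> (\<theta> N) (w - x)) y
            = cinner (\<rho> (\<theta> N) (z n - x)) y - cinner (\<rho> (\<theta> N) (z n - w)) y"
          using rho_lin by (simp add: linear_diff cinner_simps)
        moreover have "cmod (cinner (\<rho> (\<theta> N) (z n - w)) y) \<le> norm (z n - w) * norm y"
          using norm_cinner_le[of "\<rho> (\<theta> N) (z n - w)" y] by (simp add: rho_norm)
        ultimately show ?case
          using elim n norm_triangle_ineq4 by (smt (verit) field_sum_of_halves)
      qed
    qed
    then show "w \<in> C"
      unfolding C_def by (auto simp: tendsto_iff)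
  qed
  moreover have "\<rho> l x \<in> C" if l: "l \<in> L" for l
  proof -
    have "\<forall>\<^sub>F N in sequentially. \<rho> (\<theta> N \<otimes> inv l \<otimes> \<theta> N) y = y"
      using y[OF l]
    proof eventually_elim
      case (elim N)
      let ?m = "\<theta> N \<otimes> l \<otimes> \<theta> N"
      have "\<theta> N \<otimes> inv l \<otimes> \<theta> N = inv ?m"
        using l by (simp add: inv_mult_group inv_theta m_assoc)
      moreover have "\<rho> (inv ?m) (\<rho> ?m y) = y"
        using l rho_mult[of "inv ?m" ?m y] by (simp add: rho_one)
      ultimately show ?case using elim by simp
    qed
    then have "\<forall>\<^sub>F N in sequentially. 0 = cinner (\<rho> (\<theta> N) (\<rho> l x - x)) y"
    proof eventually_elim
      case (elim N)
      have "cinner (\<rho> (\<theta> N) (\<rho> l x)) y = cinner (\<rho> (\<theta> N) x) (\<rho> (\<theta> N \<otimes> inv l \<otimes> \<theta> N) y)"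
        using l by (simp add: rho_adjoint rho_mult inv_theta rho_theta_theta)
      then show ?case
        using elim rho_lin by (simp add: linear_diff cinner_simps)
    qed
    then show ?thesis
      unfolding C_def by (simp add: tendsto_eventually eventually_mono[OF _ sym])
  qed
  ultimately have "orbit_hull x \<subseteq> C" by (intro orbit_hull_subset)
  then have "(\<lambda>N. cinner (\<rho> (\<theta> N) (proj x - x)) y) \<longlonglongrightarrow> 0"
    using proj(2) by (auto simp: C_def)
  moreover have "\<rho> (\<theta> N) (proj x) = proj x" for N
    using proj(1) theta(1) by (simp add: V_iff)
  ultimately have "(\<lambda>N. cinner (proj x) y - cinner (\<rho> (\<theta> N) x) y) \<longlonglongrightarrow> 0"
    using rho_lin by (simp add: linear_diff cinner_simps)
  from tendsto_diff[OF tendsto_const[of "cinner (proj x) y"] this] show ?thesis by simp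
qed

lemma eventually_fixes_translate:
  assumes g: "g \<in> carrier G" and v: "v \<in> V" and l: "l \<in> L"
  shows "\<forall>\<^sub>F N in sequentially. \<rho> (\<theta> N \<otimes> l \<otimes> \<theta> N) (\<rho> g v) = \<rho> g v"
  using theta_commute[of l g]
proof (rule eventually_mono)
  fix N assume *: "\<theta> N \<otimes> l \<otimes> \<theta> N \<otimes> g = g \<otimes> (\<theta> N \<otimes> l \<otimes> \<theta> N)"
  have "\<theta> N \<otimes> l \<otimes> \<theta> N \<in> L" using l theta(1) L_mult by simp
  then show "\<rho> (\<theta> N \<otimes> l \<otimes> \<theta> N) (\<rho> g v) = \<rho> g v"
    using g v arg_cong[OF *, of "\<lambda>a. \<rho> a v"] by (simp add: rho_mult V_iff)
qed (use g l in auto)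

text \<open>
  Both sides are limits of the coefficients of \<open>g \<theta>\<^sub>N h\<close> and \<open>h \<theta>\<^sub>N g\<close> between fixed vectors, and for large
  \<open>N\<close> these two elements lie in the same double coset of \<open>L\<close>.
\<close>

lemma compressions_commute:
  assumes g: "g \<in> carrier G" and h: "h \<in> carrier G" and v: "v \<in> V"
  shows "proj (\<rho> g (proj (\<rho> h v))) = proj (\<rho> h (proj (\<rho> g v)))"
proof (rule proj_unique[OF proj(1)])
  fix w assume w: "w \<in> V"
  have lim: "(\<lambda>N. cinner (\<rho> (\<theta> N) (\<rho> b v)) (\<rho> (inv a) w)) \<longlonglongrightarrow> cinner (proj (\<rho> b v)) (\<rho> (inv a) w)"
    if "a \<in> carrier G" "b \<in> carrier G" for a b
    using that w by (intro theta_limit eventually_fixes_translate) auto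
  have "\<forall>\<^sub>F N in sequentially. cinner (\<rho> (\<theta> N) (\<rho> h v)) (\<rho> (inv g) w)
      = cinner (\<rho> (\<theta> N) (\<rho> g v)) (\<rho> (inv h) w)"
    using theta_commute[OF g h]
  proof eventually_elim
    case (elim N)
    have "g \<otimes> \<theta> N \<otimes> h = \<theta> N \<otimes> ((\<theta> N \<otimes> g \<otimes> \<theta> N) \<otimes> h)"
      using g h theta(2)[of N] by (simp add: m_assoc[symmetric])
    then have "\<rho> g (\<rho> (\<theta> N) (\<rho> h v)) = \<rho> (\<theta> N) (\<rho> h (\<rho> (\<theta> N) (\<rho> g (\<rho> (\<theta> N) v))))"
      using g h arg_cong[OF elim, of "\<lambda>a. \<rho> (\<theta> N) (\<rho> a v)"] 
      by (simp add: rho_mult rho_theta_theta)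
    moreover have "\<rho> (\<theta> N) v = v" using v theta(1) by (simp add: V_iff)
    moreover have "cinner (\<rho> (\<theta> N) z) w = cinner z w" for z
      using w theta(1) by (simp add: rho_adjoint inv_theta V_iff)
    ultimately show ?case
      using g h by (simp add: rho_adjoint[symmetric])
  qed
  then have "(\<lambda>N. cinner (\<rho> (\<theta> N) (\<rho> g v)) (\<rho> (inv h) w)) \<longlonglongrightarrow> cinner (proj (\<rho> h v)) (\<rho> (inv g) w)"
    using lim[OF g h] tendsto_cong by force
  then have "cinner (proj (\<rho> h v)) (\<rho> (inv g) w) = cinner (proj (\<rho> g v)) (\<rho> (inv h) w)"
    using lim[OF h g] LIMSEQ_unique by blast
  then show "cinner (proj (\<rho> h (proj (\<rho> g v)))) w = cinner (\<rho> g (proj (\<rho> h v))) w"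
    using g h w by (simp add: proj rho_adjoint)
qed

definition proj_op :: "'h \<Rightarrow>\<^sub>L 'h" where
  "proj_op = Blinfun proj"

definition compression :: "'a \<Rightarrow> 'h \<Rightarrow>\<^sub>L 'h" where
  "compression g = Blinfun (\<lambda>x. proj (\<rho> g (proj x)))"

definition scalar_op :: "complex \<Rightarrow> 'h \<Rightarrow>\<^sub>L 'h" where
  "scalar_op c = Blinfun (scaleC c)"

lemma proj_op_apply [simp]: "proj_op x = proj x"
  by (simp add: proj_op_def bounded_linear_Blinfun_apply proj_bounded_linear)

lemma compression_apply [simp]: "g \<in> carrier G \<Longrightarrow> compression g x = proj (\<rho> g (proj x))"
  unfolding compression_def
  by (subst bounded_linear_Blinfun_apply)
    (auto intro!: bounded_linear_compose[OF proj_bounded_linear]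
      bounded_linear_compose[OF rho_bounded_linear] proj_bounded_linear)

lemma scalar_op_apply [simp]: "scalar_op c x = scaleC c x"
  by (simp add: scalar_op_def bounded_linear_Blinfun_apply bounded_linear_scaleC)

lemma irreducible_invariant_UNIV:
  assumes irr: "irreducible_unitary_rep G \<rho>"
    and "closed S" "complex_vector.subspace S" "\<And>g x. g \<in> carrier G \<Longrightarrow> x \<in> S \<Longrightarrow> \<rho> g x \<in> S"
    and "v \<in> S" "v \<noteq> 0"
  shows "x \<in> S"
proof -
  have "S = {0} \<or> S = UNIV"
    using irr assms(2-4) unfolding irreducible_unitary_rep_def by (auto simp: image_subset_iff)
  then show ?thesis using assms(5,6) by auto
qed

text \<open>
  The vectors \<open>x\<close> such that \<open>X\<close> kills the projections of all translates of \<open>x\<close> form a closed invariant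
  subspace. Including the complex scalars in the commuting family makes this subspace complex.
\<close>

lemma compressions_irreducible:
  assumes irr: "irreducible_unitary_rep G \<rho>"
    and X: "\<And>A. A \<in> compression ` carrier G \<union> range scalar_op \<Longrightarrow> A o\<^sub>L X = X o\<^sub>L A"
    and v: "proj_op v = v" "v \<noteq> 0" "X v = 0"
  shows "X o\<^sub>L proj_op = 0"
proof -
  have X_app: "A (X x) = X (A x)" if "A \<in> compression ` carrier G \<union> range scalar_op" for A x
    using X[OF that] by (metis blinfun_apply_blinfun_compose)
  define S where "S = (\<Inter>g\<in>carrier G. {x. X (proj (\<rho> g x)) = 0})"
  have "x \<in> S" for x
  proof (rule irreducible_invariant_UNIV[OF irr])
    show "closed S"
      unfolding S_def
      by (intro closed_INT ballI closed_zero_set bounded_linear_compose[OF blinfun.bounded_linear_right]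
          bounded_linear_compose[OF proj_bounded_linear] rho_bounded_linear)
    show "complex_vector.subspace S"
    proof (rule complex_vector.subspaceI)
      show "0 \<in> S"
        using rho_scaleC[of _ 0 0] proj_scaleC[of 0 0] by (simp add: S_def blinfun.zero_right)
      show "x + y \<in> S" if "x \<in> S" "y \<in> S" for x y
        using that by (simp add: S_def rho_add proj_add blinfun.add_right)
      show "scaleC c x \<in> S" if "x \<in> S" for c x
        using that X_app[of "scalar_op c", symmetric] by (simp add: S_def rho_scaleC proj_scaleC)
    qed
    show "\<rho> g x \<in> S" if "g \<in> carrier G" "x \<in> S" for g x
      using that by (simp add: S_def flip: rho_mult)
    have "X (proj (\<rho> g v)) = 0" if "g \<in> carrier G" for g
      using X_app[of "compression g" v] that v by (simp add: proj_op_apply[symmetric] del: proj_op_apply)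
    then show "v \<in> S" by (simp add: S_def)
  qed (rule v)
  then have "X (proj x) = 0" for x
    unfolding S_def using rho_one by (metis (mono_tags, lifting) INT_E mem_Collect_eq one_closed)
  then show ?thesis by (intro blinfun_eqI) simp
qed

text \<open>
  Schur's lemma applies to the real and the imaginary part of the compression of \<open>\<rho>(g)\<close>, the adjoint of
  which is the compression of \<open>\<rho>(g\<inverse>)\<close>. Both have the form \<open>z A + cnj z A\<^sup>*\<close>, with \<open>z = 1\<close> and \<open>z = \<i>\<close>.
\<close>

lemma compression_scalar:
  assumes irr: "irreducible_unitary_rep G \<rho>" and g: "g \<in> carrier G"
  shows "\<exists>c. \<forall>x. proj (\<rho> g (proj x)) = scaleC c (proj x)"
proof -
  let ?A = "compression ` carrier G \<union> range scalar_op"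
  let ?g' = "compression (inv g)"
  have pp: "proj (proj x) = proj x" for x by (simp add: proj_fixed proj)
  have P_comm: "A o\<^sub>L proj_op = proj_op o\<^sub>L A" if "A \<in> ?A" for A
    using that by (auto intro!: blinfun_eqI simp: pp proj_scaleC)
  have C_comm: "A o\<^sub>L compression a = compression a o\<^sub>L A" if "A \<in> ?A" "a \<in> carrier G" for A a
    using that by (auto intro!: blinfun_eqI compressions_commute
        simp: pp proj proj_scaleC rho_scaleC)
  have app: "A (compression a x) = compression a (A x)" if "A \<in> ?A" "a \<in> carrier G" for A a x
    using C_comm[OF that] by (metis blinfun_apply_blinfun_compose)
  have A_scaleC: "A (scaleC c x) = scaleC c (A x)" if "A \<in> ?A" for A c x
    using that by (auto simp: proj_scaleC rho_scaleC scaleC_scaleC mult.commute)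
  have adj: "cinner (compression a x) y = cinner x (compression (inv a) y)" if "a \<in> carrier G" for a x y
    using that by (simp add: proj_adjoint rho_adjoint)
  have selfadj: "\<exists>c::real. T = c *\<^sub>R proj_op"
    if "T = (scalar_op z o\<^sub>L compression g) + (scalar_op (cnj z) o\<^sub>L ?g')" for T z
  proof (rule selfadjoint_scalar_if_irreducible[where \<A> = ?A])
    have T: "T x = scaleC z (compression g x) + scaleC (cnj z) (?g' x)" for x
      unfolding that by (simp add: blinfun.add_left)
    show "proj_op o\<^sub>L proj_op = proj_op" by (intro blinfun_eqI) (simp add: pp)
    show "cinner (proj_op x) y = cinner x (proj_op y)" for x y by (simp add: proj_adjoint)
    show "proj_op o\<^sub>L T = T" "T o\<^sub>L proj_op = T"
      using g by (auto intro!: blinfun_eqI simp: T proj_add proj_scaleC pp)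
    show "cinner (T x) y = cinner x (T y)" for x y
      using adj[OF g, of x y] adj[of "inv g" x y] g by (simp add: T cinner_simps del: compression_apply)
    show "A o\<^sub>L T = T o\<^sub>L A" if "A \<in> ?A" for A
      by (intro blinfun_eqI) (use g that in \<open>simp add: T blinfun.add_right A_scaleC app del: compression_apply\<close>)
  qed (use P_comm compressions_irreducible[OF irr] in auto)
  obtain c d :: real where
    c: "(scalar_op 1 o\<^sub>L compression g) + (scalar_op (cnj 1) o\<^sub>L ?g') = c *\<^sub>R proj_op" and
    d: "(scalar_op \<i> o\<^sub>L compression g) + (scalar_op (cnj \<i>) o\<^sub>L ?g') = d *\<^sub>R proj_op"
    using selfadj by metis
  have "compression g x = scaleC ((complex_of_real c - \<i> * complex_of_real d) / 2) (proj x)" for x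
  proof -
    have 1: "compression g x + ?g' x = scaleC c (proj x)"
      using arg_cong[OF c, of "\<lambda>B. blinfun_apply B x"]
      by (simp add: blinfun.add_left blinfun.scaleR_left scaleR_scaleC del: compression_apply)
    have "scaleC \<i> (compression g x) + scaleC (-\<i>) (?g' x) = scaleC d (proj x)"
      using arg_cong[OF d, of "\<lambda>B. blinfun_apply B x"]
      by (simp add: blinfun.add_left blinfun.scaleR_left scaleR_scaleC del: compression_apply)
    then have "scaleC (-\<i>) (scaleC \<i> (compression g x) + scaleC (-\<i>) (?g' x)) = scaleC (-\<i> * d) (proj x)"
      by (simp only: scaleC_scaleC)
    moreover have "scaleC (-\<i>) (scaleC \<i> (compression g x) + scaleC (-\<i>) (?g' x)) = compression g x - ?g' x"
      unfolding scaleC_add_right scaleC_scaleC by (simp del: compression_apply)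
    ultimately have 2: "compression g x - ?g' x = scaleC (-\<i> * d) (proj x)" by (simp only:)
    have "scaleC 2 (compression g x) = (compression g x + ?g' x) + (compression g x - ?g' x)"
      using scaleC_add_left[of 1 1 "compression g x"] by (simp del: compression_apply)
    also have "\<dots> = scaleC (complex_of_real c - \<i> * complex_of_real d) (proj x)"
      unfolding 1 2 by (simp add: complex_vector.scale_left_diff_distrib)
    finally have "scaleC (1/2) (scaleC 2 (compression g x)) = scaleC (1/2) (scaleC (complex_of_real c - \<i> * complex_of_real d) (proj x))"
      by simp
    then show ?thesis by (simp add: scaleC_scaleC del: compression_apply)
  qed
  then have "proj (\<rho> g (proj x)) = scaleC ((complex_of_real c - \<i> * complex_of_real d) / 2) (proj x)" for x
    by (simp only: compression_apply[OF g])
  then show ?thesis by blast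
qed

theorem fixed_vectors_dim_le_1:
  assumes irr: "irreducible_unitary_rep G \<rho>"
  shows "has_dim_at_most 1 V"
proof (cases "V \<subseteq> {0}")
  case True
  then have "V = {0}" using rho_scaleC[of _ 0 0] by (auto simp: V_iff)
  then show ?thesis
    unfolding has_dim_at_most_def
    by (intro exI[of _ "{}"]) (simp add: complex_vector.independent_empty)
next
  case False
  then obtain v where v: "v \<in> V" "v \<noteq> 0" by blast
  have orth: "w = 0" if w: "w \<in> V" "cinner v w = 0" for w
  proof -
    define S where "S = (\<Inter>g\<in>carrier G. {x. cinner (\<rho> g x) w = 0})"
    have "x \<in> S" for x
    proof (rule irreducible_invariant_UNIV[OF irr])
      show "closed S"
        unfolding S_def
        by (intro closed_INT ballI closed_zero_set bounded_linear_compose[OF bounded_linear_cinner_left]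
            rho_bounded_linear)
      show "complex_vector.subspace S"
      proof (rule complex_vector.subspaceI)
        show "0 \<in> S"
          using rho_scaleC[of _ 0 0] by (simp add: S_def)
      qed (auto simp: S_def rho_add rho_scaleC cinner_simps)
      show "\<rho> g x \<in> S" if "g \<in> carrier G" "x \<in> S" for g x
        using that by (simp add: S_def flip: rho_mult)
      have "cinner (\<rho> g v) w = 0" if g: "g \<in> carrier G" for g
      proof -
        obtain c where "proj (\<rho> g (proj v)) = scaleC c (proj v)"
          using compression_scalar[OF irr g] by blast
        then have "cinner (proj (\<rho> g v)) w = 0"
          using v w by (simp add: proj_fixed cinner_simps)
        then show ?thesis using w by (simp add: proj)
      qed
      then show "v \<in> S" by (simp add: S_def)
    qed (rule v)
    then have "cinner (\<rho> \<one> w) w = 0" by (simp add: S_def)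
    then show ?thesis by (simp add: rho_one)
  qed
  have "V = complex_vector.span {v}"
  proof
    show "complex_vector.span {v} \<subseteq> V"
      using v by (auto simp: complex_vector.span_singleton intro: V_scaleC)
    show "V \<subseteq> complex_vector.span {v}"
    proof
      fix w assume w: "w \<in> V"
      define c where "c = cnj (cinner v w) / cinner v v"
      have "w + scaleC (-1) (scaleC c v) \<in> V" using v w by (intro V_add V_scaleC)
      moreover have "cnj (cinner v v) = cinner v v" by (metis cinner_commute)
      then have "cinner v (w + scaleC (-1) (scaleC c v)) = 0"
        using v by (simp add: cinner_simps c_def)
      ultimately have "w + scaleC (-1) (scaleC c v) = 0" by (rule orth)
      then have "w = scaleC c v" by simp
      then show "w \<in> complex_vector.span {v}" by (auto simp: complex_vector.span_singleton)
    qed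
  qed
  then show ?thesis
    unfolding has_dim_at_most_def
    by (intro exI[of _ "{v}"]) (use v in \<open>simp add: complex_vector.independent_insert complex_vector.independent_empty\<close>)
qed

end

section \<open>Groups of finite matrices\<close>

lemmas quat_defs = zero_quat_def one_quat_def plus_quat_def minus_quat_def uminus_quat_def
  times_quat_def qcnj_def

lemma qcnj_mult: "qcnj (p * q) = qcnj q * qcnj p"
  by (simp add: quat_defs algebra_simps)

lemma qcnj_add: "qcnj (p + q) = qcnj p + qcnj q"
  by (simp add: quat_defs)

lemma qcnj_0 [simp]: "qcnj 0 = 0" and qcnj_1 [simp]: "qcnj 1 = 1"
  by (simp_all add: quat_defs)

lemma qcnj_sum: "qcnj (sum f S) = (\<Sum>x\<in>S. qcnj (f x))"
  by (induction S rule: infinite_finite_induct) (simp_all add: qcnj_add)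

lemma scalars_RR_subset: "scalars RR \<subseteq> scalars F"
  by (cases F) auto

lemma scalars_closed [simp]:
  "0 \<in> scalars F" "1 \<in> scalars F"
  "p \<in> scalars F \<Longrightarrow> q \<in> scalars F \<Longrightarrow> p + q \<in> scalars F"
  "p \<in> scalars F \<Longrightarrow> q \<in> scalars F \<Longrightarrow> p * q \<in> scalars F"
  "p \<in> scalars F \<Longrightarrow> - p \<in> scalars F"
  "p \<in> scalars F \<Longrightarrow> qcnj p \<in> scalars F"
  by (cases F; simp add: quat_defs)+

lemma scalars_sum: "(\<And>x. x \<in> S \<Longrightarrow> f x \<in> scalars F) \<Longrightarrow> sum f S \<in> scalars F"
  by (induction S rule: infinite_finite_induct) simp_all

lemma scalars_commute: "p \<in> scalars F \<Longrightarrow> q \<in> scalars F \<Longrightarrow> F \<noteq> HH \<Longrightarrow> p * q = q * p"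
  by (cases F; simp add: quat_defs)

lemma qcnj_real: "p \<in> scalars RR \<Longrightarrow> qcnj p = p"
  by (cases p) (simp add: quat_defs)

definition row_finite :: "'i qmat \<Rightarrow> bool" where
  "row_finite g \<longleftrightarrow> (\<forall>x. finite {z. g x z \<noteq> 0})"

lemma mat_mult_eq:
  assumes "finite S" "\<And>z. g x z \<noteq> 0 \<Longrightarrow> z \<in> S"
  shows "mat_mult g h x y = (\<Sum>z\<in>S. g x z * h z y)"
  unfolding mat_mult_def
proof (rule sum.mono_neutral_left)
  show "{z. g x z \<noteq> 0} \<subseteq> S" using assms(2) by blast
  show "\<forall>z\<in>S - {z. g x z \<noteq> 0}. g x z * h z y = 0" by simp
qed (rule assms(1))

lemma mat_mult_single:
  assumes "\<And>z. z \<noteq> w \<Longrightarrow> g x z = 0"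
  shows "mat_mult g h x y = g x w * h w y"
  using mat_mult_eq[of "{w}" g x h y] assms by fastforce

lemma row_finite_mult:
  assumes "row_finite g" "row_finite h"
  shows "row_finite (mat_mult g h)"
  unfolding row_finite_def
proof
  fix x
  have "{z. mat_mult g h x z \<noteq> 0} \<subseteq> (\<Union>w\<in>{w. g x w \<noteq> 0}. {z. h w z \<noteq> 0})"
    unfolding mat_mult_def by (auto elim!: sum.not_neutral_contains_not_neutral)
  then show "finite {z. mat_mult g h x z \<noteq> 0}"
    by (rule finite_subset) (use assms in \<open>auto simp: row_finite_def\<close>)
qed

lemma mat_mult_assoc:
  assumes "row_finite g" "row_finite h"
  shows "mat_mult (mat_mult g h) k = mat_mult g (mat_mult h k)"
proof (intro ext)
  fix x y
  let ?S = "{z. g x z \<noteq> 0}"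
  let ?T = "\<Union>z\<in>?S. {w. h z w \<noteq> 0}"
  have fin: "finite ?S" "finite ?T" using assms by (auto simp: row_finite_def)
  have gh: "mat_mult g h x w = (\<Sum>z\<in>?S. g x z * h z w)" for w
    by (rule mat_mult_eq) (use fin in auto)
  have hk: "mat_mult h k z y = (\<Sum>w\<in>?T. h z w * k w y)" if "z \<in> ?S" for z
    by (rule mat_mult_eq) (use fin that in auto)
  have "mat_mult (mat_mult g h) k x y = (\<Sum>w\<in>?T. mat_mult g h x w * k w y)"
  proof (rule mat_mult_eq)
    fix w assume "mat_mult g h x w \<noteq> 0"
    then show "w \<in> ?T"
      unfolding gh by (auto elim!: sum.not_neutral_contains_not_neutral)
  qed (rule fin)
  also have "\<dots> = (\<Sum>w\<in>?T. \<Sum>z\<in>?S. g x z * (h z w * k w y))"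
    by (simp add: gh sum_distrib_right mult.assoc)
  also have "\<dots> = (\<Sum>z\<in>?S. g x z * mat_mult h k z y)"
    by (subst sum.swap) (auto intro!: sum.cong simp: hk sum_distrib_left)
  also have "\<dots> = mat_mult g (mat_mult h k) x y"
    by (rule mat_mult_eq[symmetric]) (use fin in auto)
  finally show "mat_mult (mat_mult g h) k x y = mat_mult g (mat_mult h k) x y" .
qed

lemma mat_one_scalars [simp]: "mat_one x y \<in> scalars F"
  by (simp add: mat_one_def)

lemma row_finite_one [simp]: "row_finite mat_one"
  by (simp add: row_finite_def mat_one_def)

lemma mat_mult_one_left [simp]: "mat_mult mat_one g = g"
  by (intro ext, subst mat_mult_single) (auto simp: mat_one_def)

lemma mat_mult_one_right:
  assumes "row_finite g"
  shows "mat_mult g mat_one = g"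
proof (intro ext)
  fix x y
  have "mat_mult g mat_one x y = (\<Sum>z\<in>insert y {z. g x z \<noteq> 0}. g x z * mat_one z y)"
    by (rule mat_mult_eq) (use assms in \<open>auto simp: row_finite_def\<close>)
  also have "\<dots> = (\<Sum>z\<in>insert y {z. g x z \<noteq> 0}. if z = y then g x z else 0)"
    by (intro sum.cong) (auto simp: mat_one_def)
  also have "\<dots> = g x y"
    by (subst sum.delta) (use assms in \<open>auto simp: row_finite_def\<close>)
  finally show "mat_mult g mat_one x y = g x y" .
qed

definition supported :: "'i set \<Rightarrow> 'i qmat \<Rightarrow> bool" where
  "supported D g \<longleftrightarrow> (\<forall>x y. x \<notin> D \<or> y \<notin> D \<longrightarrow> g x y = mat_one x y)"

lemma supportedD: "supported D g \<Longrightarrow> x \<notin> D \<or> y \<notin> D \<Longrightarrow> g x y = mat_one x y"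
  by (simp add: supported_def)

lemma supported_mono: "supported D g \<Longrightarrow> D \<subseteq> E \<Longrightarrow> supported E g"
  by (auto simp: supported_def)

lemma supported_one [simp]: "supported D mat_one"
  by (simp add: supported_def)

lemma supported_entry: "supported D g \<Longrightarrow> g x z \<noteq> 0 \<Longrightarrow> z \<in> insert x D"
  by (cases "z \<in> D") (auto simp: supported_def mat_one_def split: if_splits)

lemma supported_row_finite: "finite D \<Longrightarrow> supported D g \<Longrightarrow> row_finite g"
  unfolding row_finite_def
proof
  fix x
  assume "finite D" "supported D g"
  then show "finite {z. g x z \<noteq> 0}"
    using finite_subset[of "{z. g x z \<noteq> 0}" "insert x D"] supported_entry[of D g x] by blast
qed

lemma finite_matrices_iff:
  "g \<in> finite_matrices I F \<longleftrightarrow>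
    (\<exists>D. finite D \<and> D \<subseteq> I \<and> supported D g) \<and> (\<forall>x y. g x y \<in> scalars F)"
proof -
  let ?S = "{(x, y). g x y \<noteq> mat_one x y}"
  have "finite ?S \<and> ?S \<subseteq> I \<times> I \<longleftrightarrow> (\<exists>D. finite D \<and> D \<subseteq> I \<and> supported D g)"
  proof
    assume *: "finite ?S \<and> ?S \<subseteq> I \<times> I"
    have "x \<in> fst ` ?S \<and> y \<in> snd ` ?S" if "g x y \<noteq> mat_one x y" for x y
    proof -
      have "(x, y) \<in> ?S" using that by simp
      then show ?thesis
        using image_eqI[of x fst "(x, y)" ?S] image_eqI[of y snd "(x, y)" ?S] by simp
    qed
    then have "supported (fst ` ?S \<union> snd ` ?S) g"
      unfolding supported_def Un_iff by blast
    moreover have "finite (fst ` ?S \<union> snd ` ?S)" "fst ` ?S \<union> snd ` ?S \<subseteq> I"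
      using * by (simp, fastforce)
    ultimately show "\<exists>D. finite D \<and> D \<subseteq> I \<and> supported D g" by blast
  next
    assume "\<exists>D. finite D \<and> D \<subseteq> I \<and> supported D g"
    then obtain D where D: "finite D" "D \<subseteq> I" "supported D g" by blast
    then have "?S \<subseteq> D \<times> D" by (auto simp: supported_def)
    moreover have "finite (D \<times> D)" using D(1) by simp
    moreover have "D \<times> D \<subseteq> I \<times> I" using D(2) by blast
    ultimately show "finite ?S \<and> ?S \<subseteq> I \<times> I"
      by (intro conjI) (rule finite_subset, assumption+, rule subset_trans)
  qed
  then show ?thesis
    unfolding finite_matrices_def mem_Collect_eq by (simp only: conj_assoc[symmetric])
qed

lemma finite_matrices_row_finite: "g \<in> finite_matrices I F \<Longrightarrow> row_finite g"
  by (auto simp: finite_matrices_iff intro: supported_row_finite)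

lemma supported_mult:
  assumes "finite D" "supported D g" "supported D h"
  shows "supported D (mat_mult g h)"
  unfolding supported_def
proof (intro allI impI)
  fix x y assume xy: "x \<notin> D \<or> y \<notin> D"
  show "mat_mult g h x y = mat_one x y"
  proof (cases "x \<in> D")
    case False
    then have "mat_mult g h x y = g x x * h x y"
      using assms(2) by (intro mat_mult_single) (auto simp: supported_def mat_one_def)
    then show ?thesis
      using False assms(2,3) by (simp add: supported_def mat_one_def)
  next
    case True
    then have y: "y \<notin> D" using xy by simp
    have "mat_mult g h x y = (\<Sum>z\<in>insert x D. g x z * h z y)"
      using assms(1) supported_entry[OF assms(2)] by (intro mat_mult_eq) blast+
    also have "\<dots> = 0"
      using y True assms(3) by (intro sum.neutral) (auto simp: supported_def mat_one_def)
    finally show ?thesis using y True by (auto simp: mat_one_def)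
  qed
qed

lemma finite_matrices_mult:
  assumes "g \<in> finite_matrices I F" "h \<in> finite_matrices I F"
  shows "mat_mult g h \<in> finite_matrices I F"
proof -
  obtain D E where "finite D" "D \<subseteq> I" "supported D g" "finite E" "E \<subseteq> I" "supported E h"
    using assms unfolding finite_matrices_iff by blast
  then have "finite (D \<union> E) \<and> D \<union> E \<subseteq> I \<and> supported (D \<union> E) (mat_mult g h)"
    by (auto intro!: supported_mult intro: supported_mono)
  moreover have "mat_mult g h x y \<in> scalars F" for x y
    using assms unfolding mat_mult_def by (intro scalars_sum) (auto simp: finite_matrices_iff)
  ultimately show ?thesis unfolding finite_matrices_iff by blast
qed

lemma one_finite_matrices: "mat_one \<in> finite_matrices I F"
  unfolding finite_matrices_iff
  by (intro conjI exI[of _ "{}"]) simp_all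

lemma GL_I:
  "\<lbrakk>g \<in> finite_matrices I F; h \<in> finite_matrices I F; mat_mult g h = mat_one; mat_mult h g = mat_one\<rbrakk>
    \<Longrightarrow> g \<in> GL I F"
  by (auto simp: GL_def)

lemma GL_finite_matrices: "g \<in> GL I F \<Longrightarrow> g \<in> finite_matrices I F"
  by (simp add: GL_def)

lemma GL_row_finite: "g \<in> GL I F \<Longrightarrow> row_finite g"
  by (auto simp: GL_def intro: finite_matrices_row_finite)

lemma GL_entry: "g \<in> GL I F \<Longrightarrow> g x y \<in> scalars F"
  by (simp add: GL_def finite_matrices_iff)

lemma mat_group_simps [simp]:
  "carrier (mat_group S) = S" "(\<otimes>\<^bsub>mat_group S\<^esub>) = mat_mult" "\<one>\<^bsub>mat_group S\<^esub> = mat_one"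
  by (simp_all add: mat_group_def)

lemma group_GL: "group (mat_group (GL I F))"
proof (rule groupI; simp)
  fix g h assume gh: "g \<in> GL I F" "h \<in> GL I F"
  obtain g' where g': "g' \<in> finite_matrices I F" "mat_mult g g' = mat_one" "mat_mult g' g = mat_one"
    using gh by (auto simp: GL_def)
  obtain h' where h': "h' \<in> finite_matrices I F" "mat_mult h h' = mat_one" "mat_mult h' h = mat_one"
    using gh by (auto simp: GL_def)
  have rf: "row_finite g" "row_finite h" "row_finite g'" "row_finite h'"
    using gh g' h' by (auto intro: GL_row_finite finite_matrices_row_finite)
  show "mat_mult g h \<in> GL I F"
  proof (rule GL_I)
    show "mat_mult (mat_mult g h) (mat_mult h' g') = mat_one"
      using rf g' h' mat_mult_assoc[of h h' g'] by (simp add: mat_mult_assoc row_finite_mult)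
    show "mat_mult (mat_mult h' g') (mat_mult g h) = mat_one"
      using rf g' h' mat_mult_assoc[of g' g h] by (simp add: mat_mult_assoc row_finite_mult)
  qed (use gh g' h' in \<open>auto intro: finite_matrices_mult GL_finite_matrices\<close>)
next
  show "mat_one \<in> GL I F"
    by (rule GL_I[of _ _ _ mat_one]) (auto intro: one_finite_matrices)
next
  show "mat_mult (mat_mult x y) z = mat_mult x (mat_mult y z)"
    if "x \<in> GL I F" "y \<in> GL I F" "z \<in> GL I F" for x y z
    using that by (simp add: mat_mult_assoc GL_row_finite)
next
  show "\<exists>y\<in>GL I F. mat_mult y x = mat_one" if "x \<in> GL I F" for x
    using that by (auto simp: GL_def)
qed

subsection \<open>Groups preserving a form\<close>

lemma supported_transpose: "supported D g \<Longrightarrow> supported D (mat_transpose g)"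
  by (auto simp: supported_def mat_transpose_def mat_one_def)

lemma supported_adjoint: "supported D g \<Longrightarrow> supported D (mat_adjoint g)"
  by (auto simp: supported_def mat_adjoint_def mat_one_def)

lemma transpose_GL: "g \<in> GL I F \<Longrightarrow> mat_transpose g \<in> finite_matrices I F"
  unfolding GL_def finite_matrices_iff using supported_transpose
  by (auto simp: mat_transpose_def)

lemma adjoint_finite: "g \<in> finite_matrices I F \<Longrightarrow> mat_adjoint g \<in> finite_matrices I F"
  unfolding finite_matrices_iff using supported_adjoint
  by (auto simp: mat_adjoint_def)

lemma adjoint_mult:
  assumes "g \<in> finite_matrices I F" "h \<in> finite_matrices I F"
  shows "mat_adjoint (mat_mult g h) = mat_mult (mat_adjoint h) (mat_adjoint g)"
proof (intro ext)
  fix x y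
  obtain D where D: "finite D" "supported D g"
    using assms(1) unfolding finite_matrices_iff by blast
  obtain E where E: "finite E" "supported E h"
    using assms(2) unfolding finite_matrices_iff by blast
  let ?S = "insert x (insert y (D \<union> E))"
  have "mat_mult g h y x = (\<Sum>z\<in>?S. g y z * h z x)"
    using D E supported_entry[OF D(2)] by (intro mat_mult_eq) blast+
  moreover have "mat_mult (mat_adjoint h) (mat_adjoint g) x y = (\<Sum>z\<in>?S. mat_adjoint h x z * mat_adjoint g z y)"
    using D E supported_entry[OF supported_adjoint[OF E(2)]] by (intro mat_mult_eq) blast+
  ultimately show "mat_adjoint (mat_mult g h) x y = mat_mult (mat_adjoint h) (mat_adjoint g) x y"
    by (simp only: mat_adjoint_def qcnj_sum qcnj_mult)
qed

text \<open>
  Transposition reverses products only over a commutative field, in contrast to the adjoint.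
\<close>

lemma transpose_mult:
  assumes "g \<in> GL I F" "h \<in> GL I F" "F \<noteq> HH"
  shows "mat_transpose (mat_mult g h) = mat_mult (mat_transpose h) (mat_transpose g)"
proof (intro ext)
  fix x y
  obtain D where D: "finite D" "supported D g"
    using GL_finite_matrices[OF assms(1)] unfolding finite_matrices_iff by blast
  obtain E where E: "finite E" "supported E h"
    using GL_finite_matrices[OF assms(2)] unfolding finite_matrices_iff by blast
  let ?S = "insert x (insert y (D \<union> E))"
  have "mat_mult g h y x = (\<Sum>z\<in>?S. g y z * h z x)"
    using D E supported_entry[OF D(2)] by (intro mat_mult_eq) blast+
  also have "\<dots> = (\<Sum>z\<in>?S. h z x * g y z)"
    using assms by (intro sum.cong refl scalars_commute) (auto intro: GL_entry)
  finally have "mat_mult g h y x = (\<Sum>z\<in>?S. h z x * g y z)" .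
  moreover have "mat_mult (mat_transpose h) (mat_transpose g) x y
      = (\<Sum>z\<in>?S. mat_transpose h x z * mat_transpose g z y)"
    using D E supported_entry[OF supported_transpose[OF E(2)]] by (intro mat_mult_eq) blast+
  ultimately show "mat_transpose (mat_mult g h) x y = mat_mult (mat_transpose h) (mat_transpose g) x y"
    by (simp only: mat_transpose_def)
qed

text \<open>
  A common argument for bilinear and sesquilinear forms, where \<open>dag\<close> is the transpose or the adjoint.
\<close>

lemma form_subgroup:
  fixes dag :: "'i qmat \<Rightarrow> 'i qmat"
  assumes B: "row_finite B"
    and dag_fin: "\<And>g. g \<in> GL I F \<Longrightarrow> row_finite (dag g)"
    and dag_mult: "\<And>g h. g \<in> GL I F \<Longrightarrow> h \<in> GL I F \<Longrightarrow> dag (mat_mult g h) = mat_mult (dag h) (dag g)"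
    and dag_one: "dag mat_one = mat_one"
  shows "subgroup {g \<in> GL I F. mat_mult (dag g) (mat_mult B g) = B} (mat_group (GL I F))"
proof -
  interpret group "mat_group (GL I F)" by (rule group_GL)
  have prod: "mat_mult (dag (mat_mult g h)) (mat_mult B (mat_mult g h))
      = mat_mult (dag h) (mat_mult (mat_mult (dag g) (mat_mult B g)) h)"
    if "g \<in> GL I F" "h \<in> GL I F" for g h
    using that B by (simp add: dag_mult dag_fin GL_row_finite mat_mult_assoc row_finite_mult)
  show ?thesis
  proof (unfold_locales, goal_cases)
    case (2 x y)
    then show ?case using prod[of x y] m_closed[of x y] by simp
  next
    case 3
    then show ?case using one_closed B by (simp add: dag_one mat_mult_one_right)
  next
    case (4 x)
    let ?y = "inv\<^bsub>mat_group (GL I F)\<^esub> x"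
    have x: "x \<in> GL I F" "mat_mult (dag x) (mat_mult B x) = B" using 4 by auto
    then have y: "?y \<in> GL I F" "mat_mult x ?y = mat_one"
      using inv_closed[of x] r_inv[of x] by auto
    then have "mat_mult (dag ?y) (mat_mult B ?y) = B"
      using prod[OF x(1) y(1)] x B by (simp add: dag_one mat_mult_one_right)
    then show ?case using y by simp
  qed auto
qed

lemma row_finite_single:
  assumes "\<And>x z. z \<noteq> w x \<Longrightarrow> g x z = 0"
  shows "row_finite g"
  unfolding row_finite_def
proof
  fix x
  have "{z. g x z \<noteq> 0} \<subseteq> {w x}" using assms by blast
  then show "finite {z. g x z \<noteq> 0}" by (rule finite_subset) simp
qed

lemma row_finite_indefinite: "row_finite indefinite_form"
proof (rule row_finite_single[of "\<lambda>x. x"])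
  show "indefinite_form x z = 0" if "z \<noteq> x" for x z
    using that by (cases x; cases z) (simp_all add: indefinite_form_def mat_one_def)
qed

lemma row_finite_symplectic: "row_finite symplectic_form"
proof (rule row_finite_single[of "case_sum Inr Inl"])
  show "symplectic_form x z = 0" if "z \<noteq> case_sum Inr Inl x" for x z
    using that by (cases x; cases z) (simp_all add: mat_one_def)
qed

lemma adjoint_one: "mat_adjoint mat_one = mat_one" and transpose_one: "mat_transpose mat_one = mat_one"
  by (simp_all add: mat_adjoint_def mat_transpose_def mat_one_def fun_eq_iff)

lemma sesquilinear_subgroup:
  "row_finite B \<Longrightarrow> subgroup {g \<in> GL I F. preserves_sesquilinear B g} (mat_group (GL I F))"
  unfolding preserves_sesquilinear_def
  by (rule form_subgroup)
    (assumption | rule adjoint_one adjoint_mult GL_finite_matrices finite_matrices_row_finite adjoint_finite)+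

lemma bilinear_subgroup:
  "row_finite B \<Longrightarrow> F \<noteq> HH \<Longrightarrow> subgroup {g \<in> GL I F. preserves_bilinear B g} (mat_group (GL I F))"
  unfolding preserves_bilinear_def
  by (rule form_subgroup)
    (assumption | rule transpose_one transpose_mult finite_matrices_row_finite transpose_GL)+

lemma subgroup_group:
  assumes "subgroup H (mat_group S)" "group (mat_group S)"
  shows "group (mat_group H)"
proof -
  have "group ((mat_group S)\<lparr>carrier := H\<rparr>)"
    using assms by (rule subgroup.subgroup_is_group)
  moreover have "(mat_group S)\<lparr>carrier := H\<rparr> = mat_group H" by (simp add: mat_group_def)
  ultimately show ?thesis by simp
qed

lemma group_irr_classical: "group (mat_group (irr_classical_carrier c))"
proof (cases c)
  case (GL_inf F)
  then show ?thesis using group_GL by simp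
next
  case (U_inf_inf F)
  then show ?thesis
    using subgroup_group[OF sesquilinear_subgroup[OF row_finite_indefinite] group_GL] by simp
next
  case (U_fin_inf p F)
  then show ?thesis
    using subgroup_group[OF sesquilinear_subgroup[OF row_finite_indefinite] group_GL] by simp
next
  case Sp_2inf_R
  then show ?thesis
    using subgroup_group[OF bilinear_subgroup[OF row_finite_symplectic] group_GL] by simp
next
  case Sp_2inf_C
  then show ?thesis
    using subgroup_group[OF bilinear_subgroup[OF row_finite_symplectic] group_GL] by simp
next
  case O_inf_C
  then show ?thesis
    using subgroup_group[OF bilinear_subgroup[OF row_finite_one, of CC "basis_fin 0"] group_GL] by simp
next
  case SO_star_2inf
  have "irr_classical_carrier c = {g \<in> GL UNIV CC. preserves_bilinear mat_one g}
      \<inter> {g \<in> GL UNIV CC. preserves_sesquilinear symplectic_form g}"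
    using SO_star_2inf by auto
  moreover have "subgroup \<dots> (mat_group (GL UNIV CC))"
    by (intro group.subgroups_Inter_pair[OF group_GL] bilinear_subgroup sesquilinear_subgroup
        row_finite_one row_finite_symplectic) simp
  ultimately show ?thesis using subgroup_group[OF _ group_GL] by simp
qed

lemma group_irr_heavy: "group (irr_heavy_group F)"
  unfolding irr_heavy_group_def
  by (rule subgroup_group[OF sesquilinear_subgroup[OF row_finite_one] group_GL])

lemma carrier_irr_heavy:
  "g \<in> carrier (irr_heavy_group F) \<longleftrightarrow> g \<in> GL UNIV F \<and> mat_mult (mat_adjoint g) g = mat_one"
  by (simp add: irr_heavy_group_def preserves_sesquilinear_def)

lemma irr_heavy_simps [simp]:
  "(\<otimes>\<^bsub>irr_heavy_group F\<^esub>) = mat_mult" "\<one>\<^bsub>irr_heavy_group F\<^esub> = mat_one"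
  by (simp_all add: irr_heavy_group_def)

section \<open>Embedding the heavy subgroup\<close>

lemma finite_matrices_entry: "g \<in> finite_matrices I F \<Longrightarrow> g x y \<in> scalars F"
  by (simp add: finite_matrices_iff)

lemma GL_mono: "I \<subseteq> J \<Longrightarrow> scalars F \<subseteq> scalars F' \<Longrightarrow> g \<in> GL I F \<Longrightarrow> g \<in> GL J F'"
proof -
  assume *: "I \<subseteq> J" "scalars F \<subseteq> scalars F'" "g \<in> GL I F"
  have sub: "finite_matrices I F \<subseteq> finite_matrices J F'"
    using * unfolding finite_matrices_def by fastforce
  show ?thesis using *(3) sub unfolding GL_def by blast
qed

lemma block_diag_row: "block_diag A D (Inl i) z \<noteq> 0 \<Longrightarrow> z \<in> Inl ` {k. A i k \<noteq> 0}"
  "block_diag A D (Inr i) z \<noteq> 0 \<Longrightarrow> z \<in> Inr ` {k. D i k \<noteq> 0}"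
  by (cases z; simp)+

lemma block_diag_mult:
  assumes "row_finite A" "row_finite D"
  shows "mat_mult (block_diag A D) (block_diag A' D') = block_diag (mat_mult A A') (mat_mult D D')"
proof (intro ext)
  fix x y
  show "mat_mult (block_diag A D) (block_diag A' D') x y = block_diag (mat_mult A A') (mat_mult D D') x y"
  proof (cases x)
    case (Inl i)
    have "mat_mult (block_diag A D) (block_diag A' D') (Inl i) y
        = (\<Sum>z\<in>Inl ` {k. A i k \<noteq> 0}. block_diag A D (Inl i) z * block_diag A' D' z y)"
      using assms by (intro mat_mult_eq block_diag_row) (auto simp: row_finite_def)
    also have "\<dots> = (\<Sum>k | A i k \<noteq> 0. A i k * block_diag A' D' (Inl k) y)"
      by (subst sum.reindex) simp_all
    also have "\<dots> = block_diag (mat_mult A A') (mat_mult D D') (Inl i) y"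
      by (cases y) (simp_all add: mat_mult_def)
    finally show ?thesis using Inl by simp
  next
    case (Inr i)
    have "mat_mult (block_diag A D) (block_diag A' D') (Inr i) y
        = (\<Sum>z\<in>Inr ` {k. D i k \<noteq> 0}. block_diag A D (Inr i) z * block_diag A' D' z y)"
      using assms by (intro mat_mult_eq block_diag_row) (auto simp: row_finite_def)
    also have "\<dots> = (\<Sum>k | D i k \<noteq> 0. D i k * block_diag A' D' (Inr k) y)"
      by (subst sum.reindex) simp_all
    also have "\<dots> = block_diag (mat_mult A A') (mat_mult D D') (Inr i) y"
      by (cases y) (simp_all add: mat_mult_def)
    finally show ?thesis using Inr by simp
  qed
qed

lemma block_diag_ext:
  assumes "\<And>i j. f (Inl i) (Inl j) = A i j" "\<And>i j. f (Inr i) (Inr j) = D i j"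
    "\<And>i j. f (Inl i) (Inr j) = 0" "\<And>i j. f (Inr i) (Inl j) = 0"
  shows "f = block_diag A D"
proof (intro ext)
  fix x y
  show "f x y = block_diag A D x y"
    by (cases x; cases y) (simp_all add: assms)
qed

lemma block_diag_one: "block_diag mat_one mat_one = mat_one"
  by (rule block_diag_ext[symmetric]) (simp_all add: mat_one_def)

lemma adjoint_block_diag: "mat_adjoint (block_diag A D) = block_diag (mat_adjoint A) (mat_adjoint D)"
  by (rule block_diag_ext) (simp_all add: mat_adjoint_def)

lemma transpose_block_diag: "mat_transpose (block_diag A D) = block_diag (mat_transpose A) (mat_transpose D)"
  by (rule block_diag_ext) (simp_all add: mat_transpose_def)

lemma mat_one_sum:
  "mat_one (Inl i) (Inl j) = mat_one i j" "mat_one (Inr k) (Inr l) = mat_one k l"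
  "mat_one (Inl i) (Inr l) = 0" "mat_one (Inr k) (Inl j) = 0"
  by (simp_all add: mat_one_def)

lemma block_diag_finite_matrices:
  assumes "A \<in> finite_matrices I F" "D \<in> finite_matrices J F"
  shows "block_diag A D \<in> finite_matrices (Inl ` I \<union> Inr ` J) F"
proof -
  obtain P where P: "finite P" "P \<subseteq> I" "supported P A"
    using assms(1) unfolding finite_matrices_iff by blast
  obtain Q where Q: "finite Q" "Q \<subseteq> J" "supported Q D"
    using assms(2) unfolding finite_matrices_iff by blast
  have "supported (Inl ` P \<union> Inr ` Q) (block_diag A D)"
    unfolding supported_def
  proof (intro allI impI)
    fix x y :: "nat + nat" assume "x \<notin> Inl ` P \<union> Inr ` Q \<or> y \<notin> Inl ` P \<union> Inr ` Q"
    then show "block_diag A D x y = mat_one x y"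
      by (cases x; cases y)
        (auto simp: mat_one_sum image_iff intro!: supportedD[OF P(3)] supportedD[OF Q(3)])
  qed
  moreover have "block_diag A D x y \<in> scalars F" for x y
    using assms by (cases x; cases y) (simp_all add: finite_matrices_iff)
  moreover have "finite (Inl ` P \<union> Inr ` Q)" "Inl ` P \<union> Inr ` Q \<subseteq> Inl ` I \<union> Inr ` J"
    using P Q by auto
  ultimately show ?thesis unfolding finite_matrices_iff by blast
qed

lemma block_diag_GL:
  assumes "A \<in> GL I F" "D \<in> GL J F"
  shows "block_diag A D \<in> GL (Inl ` I \<union> Inr ` J) F"
proof -
  obtain A' where A': "A' \<in> finite_matrices I F" "mat_mult A A' = mat_one" "mat_mult A' A = mat_one"
    using assms(1) unfolding GL_def by blast
  obtain D' where D': "D' \<in> finite_matrices J F" "mat_mult D D' = mat_one" "mat_mult D' D = mat_one"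
    using assms(2) unfolding GL_def by blast
  show ?thesis
    by (rule GL_I[where h = "block_diag A' D'"])
      (use assms A' D' in \<open>simp_all add: block_diag_finite_matrices block_diag_mult block_diag_one
        GL_finite_matrices GL_row_finite finite_matrices_row_finite\<close>)
qed

lemma block_diag_preserves_indefinite:
  assumes "A \<in> GL I F" "D \<in> GL J F"
    and "mat_mult (mat_adjoint A) A = mat_one" "mat_mult (mat_adjoint D) D = mat_one"
  shows "preserves_sesquilinear indefinite_form (block_diag A D)"
proof -
  have rf: "row_finite (mat_adjoint A)" "row_finite (mat_adjoint D)"
    using finite_matrices_row_finite[OF adjoint_finite[OF GL_finite_matrices[OF assms(1)]]]
      finite_matrices_row_finite[OF adjoint_finite[OF GL_finite_matrices[OF assms(2)]]] by simp_all
  have "row_finite ((\<lambda>i j. - mat_one i j) :: nat qmat)"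
    using row_finite_one by (simp add: row_finite_def)
  moreover have "mat_mult (\<lambda>i j. - mat_one i j) D = (\<lambda>i j. - D i j)"
    by (intro ext, subst mat_mult_single) (auto simp: mat_one_def)
  ultimately have "mat_mult indefinite_form (block_diag A D) = block_diag A (\<lambda>i j. - D i j)"
    by (simp add: indefinite_form_def block_diag_mult)
  moreover have "mat_mult (mat_adjoint D) (\<lambda>i j. - D i j) = (\<lambda>i j. - mat_mult (mat_adjoint D) D i j)"
    by (intro ext) (simp add: mat_mult_def sum_negf)
  ultimately show ?thesis
    unfolding preserves_sesquilinear_def
    using assms(3,4) by (simp add: adjoint_block_diag block_diag_mult rf indefinite_form_def)
qed

lemma symplectic_mult_left:
  "mat_mult symplectic_form A (Inl i) y = A (Inr i) y"
  "mat_mult symplectic_form A (Inr i) y = - A (Inl i) y"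
proof -
  have "symplectic_form (Inl i) z = 0" if "z \<noteq> Inr i" for z
    using that by (cases z) (auto simp: mat_one_def)
  then show "mat_mult symplectic_form A (Inl i) y = A (Inr i) y"
    by (subst mat_mult_single) (auto simp: mat_one_def)
  have "symplectic_form (Inr i) z = 0" if "z \<noteq> Inl i" for z
    using that by (cases z) (auto simp: mat_one_def)
  then show "mat_mult symplectic_form A (Inr i) y = - A (Inl i) y"
    by (subst mat_mult_single) (auto simp: mat_one_def)
qed

lemma mat_mult_single_right:
  assumes "row_finite A" "\<And>z. z \<noteq> w \<Longrightarrow> B z y = 0"
  shows "mat_mult A B x y = A x w * B w y"
proof -
  let ?S = "insert w {z. A x z \<noteq> 0}"
  have fin: "finite ?S" using assms(1) by (simp add: row_finite_def)
  have "mat_mult A B x y = (\<Sum>z\<in>?S. A x z * B z y)"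
    using fin by (intro mat_mult_eq) simp_all
  also have "\<dots> = (\<Sum>z\<in>?S. if z = w then A x w * B w y else 0)"
    using assms(2) by (intro sum.cong) simp_all
  also have "\<dots> = A x w * B w y"
    using fin by (subst sum.delta) simp_all
  finally show ?thesis .
qed

lemma symplectic_mult_right:
  assumes "row_finite A"
  shows "mat_mult A symplectic_form x (Inr j) = A x (Inl j)"
    "mat_mult A symplectic_form x (Inl j) = - A x (Inr j)"
proof -
  have "symplectic_form z (Inr j) = 0" if "z \<noteq> Inl j" for z
    using that by (cases z) (auto simp: mat_one_def)
  then show "mat_mult A symplectic_form x (Inr j) = A x (Inl j)"
    by (subst mat_mult_single_right[OF assms]) (auto simp: mat_one_def)
  have "symplectic_form z (Inl j) = 0" if "z \<noteq> Inr j" for z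
    using that by (cases z) (auto simp: mat_one_def)
  then show "mat_mult A symplectic_form x (Inl j) = - A x (Inr j)"
    by (subst mat_mult_single_right[OF assms]) (auto simp: mat_one_def)
qed

abbreviation (input) idx :: "nat + nat \<Rightarrow> nat" where
  "idx x \<equiv> case_sum (\<lambda>k. k) (\<lambda>k. k) x"

abbreviation (input) side :: "nat + nat \<Rightarrow> nat" where
  "side x \<equiv> case_sum (\<lambda>k. 0) (\<lambda>k. 1) x"

lemma side_less: "side x < 2"
  by (cases x) simp_all

text \<open>
  The abstract properties of the \<open>2\<close> by \<open>2\<close> blocks that represent complex numbers over the reals and
  quaternions over the complex numbers. In both cases \<open>block_qcnj\<close> says that the block of the conjugate
  is the adjugate of the block; this is what makes the symplectic form invariant.
\<close>

locale block_embedding =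
  fixes c :: "quat \<Rightarrow> nat \<Rightarrow> nat \<Rightarrow> quat" and F F' :: fld
  assumes block_add: "s < 2 \<Longrightarrow> t < 2 \<Longrightarrow> c (p + q) s t = c p s t + c q s t"
    and block_mult: "p \<in> scalars F \<Longrightarrow> q \<in> scalars F \<Longrightarrow> s < 2 \<Longrightarrow> t < 2
      \<Longrightarrow> c (p * q) s t = c p s 0 * c q 0 t + c p s 1 * c q 1 t"
    and block_one: "s < 2 \<Longrightarrow> t < 2 \<Longrightarrow> c 1 s t = (if s = t then 1 else 0)"
    and block_scalars: "p \<in> scalars F \<Longrightarrow> s < 2 \<Longrightarrow> t < 2 \<Longrightarrow> c p s t \<in> scalars F'"
    and block_qcnj: "p \<in> scalars F \<Longrightarrow> c (qcnj p) 0 0 = c p 1 1"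
      "p \<in> scalars F \<Longrightarrow> c (qcnj p) 1 1 = c p 0 0"
      "p \<in> scalars F \<Longrightarrow> c (qcnj p) 0 1 = - c p 0 1"
      "p \<in> scalars F \<Longrightarrow> c (qcnj p) 1 0 = - c p 1 0"
begin

abbreviation E :: "nat qmat \<Rightarrow> (nat + nat) qmat" where
  "E g \<equiv> two_blocks (expand c g)"

lemma E_eq: "E g x y = c (g (idx x) (idx y)) (side x) (side y)"
  by (cases x; cases y) (simp_all add: two_blocks_def expand_def Let_def)

lemma block_zero: "s < 2 \<Longrightarrow> t < 2 \<Longrightarrow> c 0 s t = 0"
  using block_add[of s t 0 0] by simp

lemma block_sum: "s < 2 \<Longrightarrow> t < 2 \<Longrightarrow> c (sum f S) s t = (\<Sum>x\<in>S. c (f x) s t)"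
  by (induction S rule: infinite_finite_induct) (simp_all add: block_zero block_add)

lemma E_mult:
  assumes "row_finite g" "\<And>k l. g k l \<in> scalars F" "\<And>k l. h k l \<in> scalars F"
  shows "mat_mult (E g) (E h) = E (mat_mult g h)"
proof (intro ext)
  fix x y
  let ?S = "{l. g (idx x) l \<noteq> 0}"
  have fin: "finite ?S" using assms(1) by (simp add: row_finite_def)
  have "mat_mult (E g) (E h) x y = (\<Sum>z\<in>Inl ` ?S \<union> Inr ` ?S. E g x z * E h z y)"
  proof (rule mat_mult_eq)
    fix z assume "E g x z \<noteq> 0"
    then have "g (idx x) (idx z) \<noteq> 0"
      using block_zero[OF side_less side_less] unfolding E_eq by metis
    then show "z \<in> Inl ` ?S \<union> Inr ` ?S" by (cases z) simp_all
  qed (use fin in simp)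
  also have "\<dots> = (\<Sum>z\<in>Inl ` ?S. E g x z * E h z y) + (\<Sum>z\<in>Inr ` ?S. E g x z * E h z y)"
    using fin by (intro sum.union_disjoint) auto
  also have "\<dots> = (\<Sum>l\<in>?S. E g x (Inl l) * E h (Inl l) y) + (\<Sum>l\<in>?S. E g x (Inr l) * E h (Inr l) y)"
    by (simp add: sum.reindex)
  also have "\<dots> = (\<Sum>l\<in>?S. c (g (idx x) l * h l (idx y)) (side x) (side y))"
    unfolding E_eq block_mult[OF assms(2,3) side_less side_less] by (simp add: sum.distrib)
  also have "\<dots> = E (mat_mult g h) x y"
    unfolding E_eq mat_mult_def block_sum[OF side_less side_less] ..
  finally show "mat_mult (E g) (E h) x y = E (mat_mult g h) x y" .
qed

lemma E_one: "E mat_one = mat_one"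
proof (intro ext)
  fix x y
  show "E mat_one x y = mat_one x y"
    unfolding E_eq by (cases x; cases y) (simp_all add: mat_one_def block_one block_zero)
qed

lemma E_finite_matrices:
  assumes "g \<in> finite_matrices UNIV F"
  shows "E g \<in> finite_matrices UNIV F'"
proof -
  obtain D where D: "finite D" "supported D g"
    using assms unfolding finite_matrices_iff by blast
  have "supported (Inl ` D \<union> Inr ` D) (E g)"
    unfolding supported_def
  proof (intro allI impI)
    fix x y :: "nat + nat" assume "x \<notin> Inl ` D \<union> Inr ` D \<or> y \<notin> Inl ` D \<union> Inr ` D"
    then have "idx x \<notin> D \<or> idx y \<notin> D" by (cases x; cases y) auto
    then have "E g x y = E mat_one x y"
      unfolding E_eq using supportedD[OF D(2)] by simp
    then show "E g x y = mat_one x y" by (simp add: E_one)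
  qed
  moreover have "finite (Inl ` D \<union> Inr ` D)" using D by simp
  moreover have "E g x y \<in> scalars F'" for x y
    unfolding E_eq using assms by (intro block_scalars side_less) (simp add: finite_matrices_iff)
  ultimately show ?thesis unfolding finite_matrices_iff by blast
qed

lemma E_mult_finite:
  "g \<in> finite_matrices UNIV F \<Longrightarrow> h \<in> finite_matrices UNIV F \<Longrightarrow> mat_mult (E g) (E h) = E (mat_mult g h)"
  by (rule E_mult) (assumption | rule finite_matrices_row_finite finite_matrices_entry)+

lemma E_GL:
  assumes "g \<in> GL UNIV F"
  shows "E g \<in> GL UNIV F'"
proof -
  obtain h where h: "h \<in> finite_matrices UNIV F" "mat_mult g h = mat_one" "mat_mult h g = mat_one"
    using assms unfolding GL_def by blast
  show ?thesis
    by (rule GL_I[where h = "E h"])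
      (use h GL_finite_matrices[OF assms] in \<open>simp_all add: E_finite_matrices E_mult_finite E_one\<close>)
qed

text \<open>
  The transpose of \<open>E g\<close> is conjugate by the symplectic form to \<open>E\<close> of the adjoint of \<open>g\<close>: for a single
  block \<open>B\<close> this is the relation between its transpose and its adjugate.
\<close>

lemma transpose_E_symplectic:
  assumes "g \<in> GL UNIV F"
  shows "mat_mult (mat_transpose (E g)) symplectic_form = mat_mult symplectic_form (E (mat_adjoint g))"
proof (intro ext)
  fix x y
  have rf: "row_finite (mat_transpose (E g))"
    by (rule finite_matrices_row_finite[OF transpose_GL[OF E_GL[OF assms]]])
  show "mat_mult (mat_transpose (E g)) symplectic_form x y = mat_mult symplectic_form (E (mat_adjoint g)) x y"
    using block_qcnj[OF GL_entry[OF assms]]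
    by (cases x; cases y)
      (simp_all only: symplectic_mult_left symplectic_mult_right[OF rf],
        simp_all add: mat_transpose_def mat_adjoint_def E_eq)
qed

lemma E_adjoint_mult:
  assumes "g \<in> GL UNIV F" "mat_mult (mat_adjoint g) g = mat_one"
  shows "mat_mult (E (mat_adjoint g)) (E g) = mat_one"
  using assms by (simp add: E_mult_finite adjoint_finite GL_finite_matrices E_one)

lemma E_preserves_symplectic:
  assumes "g \<in> GL UNIV F" "mat_mult (mat_adjoint g) g = mat_one"
  shows "preserves_bilinear symplectic_form (E g)"
proof -
  have rf: "row_finite (mat_transpose (E g))" "row_finite (E (mat_adjoint g))"
    using finite_matrices_row_finite[OF transpose_GL[OF E_GL[OF assms(1)]]]
      finite_matrices_row_finite[OF E_finite_matrices[OF adjoint_finite[OF GL_finite_matrices[OF assms(1)]]]]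
    by simp_all
  have "mat_mult (mat_transpose (E g)) (mat_mult symplectic_form (E g))
      = mat_mult (mat_mult symplectic_form (E (mat_adjoint g))) (E g)"
    using rf row_finite_symplectic transpose_E_symplectic[OF assms(1)]
    by (simp flip: mat_mult_assoc)
  also have "\<dots> = symplectic_form"
    using rf row_finite_symplectic E_adjoint_mult[OF assms]
    by (simp add: mat_mult_assoc mat_mult_one_right)
  finally show ?thesis unfolding preserves_bilinear_def .
qed

end

global_interpretation real_embedding: block_embedding real_block CC RR
  by unfold_locales
    (auto dest!: less_2_cases simp: real_block_def qcomponent_def qunit_def quat_defs)

global_interpretation complex_embedding: block_embedding complex_block HH CC
  by unfold_locales
    (auto dest!: less_2_cases simp: complex_block_def Let_def quat_defs algebra_simps)

lemma real_embedding_transpose: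
  assumes "g \<in> GL UNIV CC"
  shows "mat_transpose (two_blocks (expand real_block g)) = two_blocks (expand real_block (mat_adjoint g))"
proof (intro ext)
  fix x y
  have "qim2 (g i j) = 0 \<and> qim3 (g i j) = 0" for i j
    using GL_entry[OF assms, of i j] by simp
  then show "mat_transpose (two_blocks (expand real_block g)) x y
      = two_blocks (expand real_block (mat_adjoint g)) x y"
    by (cases x; cases y) (simp_all add: mat_transpose_def mat_adjoint_def real_embedding.E_eq
        real_block_def qcomponent_def qunit_def quat_defs)
qed

lemma adjoint_real: "g \<in> GL I RR \<Longrightarrow> mat_adjoint g = mat_transpose g"
  using GL_entry[of g I RR] by (intro ext) (simp only: mat_adjoint_def mat_transpose_def qcnj_real)

lemma irr_classical_finite: "irr_classical_carrier c \<subseteq> finite_matrices UNIV HH"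
proof
  fix g assume "g \<in> irr_classical_carrier c"
  then have "\<exists>I F. g \<in> GL I F" by (cases c) auto
  then obtain I F where "g \<in> GL I F" by blast
  then have "g \<in> GL UNIV HH" by (rule GL_mono[rotated 2]) simp_all
  then show "g \<in> finite_matrices UNIV HH" by (rule GL_finite_matrices)
qed

lemma one_GL: "mat_one \<in> GL I F"
  using monoid.one_closed[OF group.is_monoid[OF group_GL[of I F]]] by simp

lemma basis_fin_eq: "basis_fin p = Inl ` {..<p} \<union> Inr ` UNIV"
  by (simp add: basis_fin_def)

lemma UNIV_sum_eq: "(UNIV :: ('a + 'b) set) = Inl ` UNIV \<union> Inr ` UNIV"
  by (simp add: UNIV_sum)

lemma lower_block_GL: "A \<in> GL UNIV F \<Longrightarrow> block_diag mat_one A \<in> GL (basis_fin p) F"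
  using block_diag_GL[OF one_GL, of A UNIV F "{..<p}"] by (simp only: basis_fin_eq)

text \<open>
  For \<open>2\<close> by \<open>2\<close> blocks, a unitary \<open>g\<close> yields \<open>E (g\<^sup>*) (E g) = 1\<close>, so \<open>transpose_E_symplectic\<close> gives the
  invariance of the symplectic form. Blocks of complex numbers are real, so for SO*(\<open>2\<infinity>\<close>)
  preserving the symplectic form as a sesquilinear form is the same as preserving it as a bilinear one.
\<close>

lemma heavy_embed_closed:
  assumes "\<And>s. s < length (heavy_factors c) \<Longrightarrow> \<kappa> s \<in> carrier (irr_heavy_group (heavy_factors c ! s))"
  shows "heavy_embed c \<kappa> \<in> irr_classical_carrier c"
proof (cases c)
  case (GL_inf F)
  then show ?thesis using assms[of 0] by (simp add: carrier_irr_heavy lower_block_GL)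
next
  case (U_inf_inf F)
  have "\<kappa> 0 \<in> carrier (irr_heavy_group F)" "\<kappa> 1 \<in> carrier (irr_heavy_group F)"
    using assms[of 0] assms[of 1] U_inf_inf by simp_all
  then show ?thesis
    using U_inf_inf block_diag_GL[of "\<kappa> 0" UNIV F "\<kappa> 1" UNIV]
      block_diag_preserves_indefinite[of "\<kappa> 0" UNIV F "\<kappa> 1" UNIV]
    by (simp add: carrier_irr_heavy UNIV_sum_eq)
next
  case (U_fin_inf p F)
  have k: "\<kappa> 0 \<in> GL UNIV F" "mat_mult (mat_adjoint (\<kappa> 0)) (\<kappa> 0) = mat_one"
    using assms[of 0] U_fin_inf by (simp_all add: carrier_irr_heavy)
  have "preserves_sesquilinear indefinite_form (block_diag mat_one (\<kappa> 0))"
    using one_GL[of UNIV F] k(1) _ k(2) by (rule block_diag_preserves_indefinite) (simp add: adjoint_one)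
  then show ?thesis
    using U_fin_inf lower_block_GL[OF k(1)] by simp
next
  case Sp_2inf_R
  then show ?thesis
    using assms[of 0] real_embedding.E_GL real_embedding.E_preserves_symplectic
    by (simp add: carrier_irr_heavy)
next
  case Sp_2inf_C
  then show ?thesis
    using assms[of 0] complex_embedding.E_GL complex_embedding.E_preserves_symplectic
    by (simp add: carrier_irr_heavy)
next
  case O_inf_C
  have k: "\<kappa> 0 \<in> GL UNIV RR" "mat_mult (mat_adjoint (\<kappa> 0)) (\<kappa> 0) = mat_one"
    using assms[of 0] O_inf_C by (simp_all add: carrier_irr_heavy)
  have "preserves_bilinear mat_one (block_diag mat_one (\<kappa> 0))"
    unfolding preserves_bilinear_def
    using k GL_row_finite[OF k(1)] finite_matrices_row_finite[OF transpose_GL[OF k(1)]]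
    by (simp add: transpose_block_diag block_diag_mult transpose_one adjoint_real block_diag_one)
  moreover have "block_diag mat_one (\<kappa> 0) \<in> GL (basis_fin 0) CC"
    by (rule GL_mono[OF subset_refl scalars_RR_subset lower_block_GL[OF k(1)]])
  ultimately show ?thesis using O_inf_C by simp
next
  case SO_star_2inf
  have k: "\<kappa> 0 \<in> GL UNIV CC" "mat_mult (mat_adjoint (\<kappa> 0)) (\<kappa> 0) = mat_one"
    using assms[of 0] SO_star_2inf by (simp_all add: carrier_irr_heavy)
  let ?E = "two_blocks (expand real_block (\<kappa> 0))"
  have E: "?E \<in> GL UNIV RR" using k(1) by (rule real_embedding.E_GL)
  have "preserves_bilinear mat_one ?E"
    unfolding preserves_bilinear_def
    using real_embedding.E_adjoint_mult[OF k] by (simp add: real_embedding_transpose[OF k(1)])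
  moreover have "preserves_sesquilinear symplectic_form ?E"
    using real_embedding.E_preserves_symplectic[OF k]
    by (simp add: preserves_bilinear_def preserves_sesquilinear_def adjoint_real[OF E])
  moreover have "?E \<in> GL UNIV CC"
    by (rule GL_mono[OF subset_refl scalars_RR_subset E])
  ultimately show ?thesis using SO_star_2inf by simp
qed

lemma heavy_embed_mult:
  assumes "\<And>s. s < length (heavy_factors c) \<Longrightarrow> \<kappa> s \<in> carrier (irr_heavy_group (heavy_factors c ! s))"
    and "\<And>s. s < length (heavy_factors c) \<Longrightarrow> \<mu> s \<in> carrier (irr_heavy_group (heavy_factors c ! s))"
  shows "heavy_embed c (\<lambda>s. mat_mult (\<kappa> s) (\<mu> s)) = mat_mult (heavy_embed c \<kappa>) (heavy_embed c \<mu>)"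
proof -
  have \<kappa>: "\<kappa> s \<in> finite_matrices UNIV (heavy_factors c ! s)" "row_finite (\<kappa> s)"
    if "s < length (heavy_factors c)" for s
    using assms(1)[OF that] GL_finite_matrices[of "\<kappa> s" UNIV "heavy_factors c ! s"]
      GL_row_finite[of "\<kappa> s" UNIV "heavy_factors c ! s"] by (simp_all add: carrier_irr_heavy)
  have \<mu>: "\<mu> s \<in> finite_matrices UNIV (heavy_factors c ! s)" if "s < length (heavy_factors c)" for s
    using assms(2)[OF that] GL_finite_matrices[of "\<mu> s" UNIV "heavy_factors c ! s"]
    by (simp add: carrier_irr_heavy)
  show ?thesis
    using \<kappa>[of 0] \<kappa>[of 1] \<mu>[of 0]
    by (cases c) (simp_all add: block_diag_mult real_embedding.E_mult_finite complex_embedding.E_mult_finite)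
qed

lemma heavy_embed_cong:
  "(\<And>s. s < length (heavy_factors c) \<Longrightarrow> \<kappa> s = \<mu> s) \<Longrightarrow> heavy_embed c \<kappa> = heavy_embed c \<mu>"
  by (cases c) simp_all

section \<open>Permutations and reflections\<close>

definition perm_mat :: "('i \<Rightarrow> 'i) \<Rightarrow> 'i qmat" where
  "perm_mat \<pi> = (\<lambda>x y. if y = \<pi> x then 1 else 0)"

lemma row_finite_perm_mat: "row_finite (perm_mat \<pi>)"
  by (simp add: row_finite_def perm_mat_def)

lemma perm_mat_mult_left: "mat_mult (perm_mat \<pi>) f x y = f (\<pi> x) y"
  by (subst mat_mult_single[of "\<pi> x"]) (simp_all add: perm_mat_def)

lemma perm_mat_mult_right:
  assumes "\<And>x. \<pi> (\<pi> x) = x" "row_finite f"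
  shows "mat_mult f (perm_mat \<pi>) x y = f x (\<pi> y)"
proof -
  have "mat_mult f (perm_mat \<pi>) x y = f x (\<pi> y) * perm_mat \<pi> (\<pi> y) y"
  proof (rule mat_mult_single_right[OF assms(2)])
    show "perm_mat \<pi> z y = 0" if "z \<noteq> \<pi> y" for z
      using that assms(1)[of z] by (auto simp: perm_mat_def)
  qed
  then show ?thesis by (simp add: perm_mat_def assms(1))
qed

lemma perm_mat_square: "(\<And>x. \<pi> (\<pi> x) = x) \<Longrightarrow> mat_mult (perm_mat \<pi>) (perm_mat \<pi>) = mat_one"
  by (intro ext) (simp add: perm_mat_mult_left, auto simp: perm_mat_def mat_one_def)

lemma perm_mat_conj:
  assumes "\<And>x. \<pi> (\<pi> x) = x" "row_finite f"
  shows "mat_mult (mat_mult (perm_mat \<pi>) f) (perm_mat \<pi>) = (\<lambda>x y. f (\<pi> x) (\<pi> y))"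
  by (intro ext) (simp add: perm_mat_mult_right[OF assms(1)] perm_mat_mult_left row_finite_mult
      row_finite_perm_mat assms(2))

lemma mat_mult_disjoint:
  assumes "supported D f" "supported E h" "D \<inter> E = {}" "row_finite f"
  shows "mat_mult f h x y = (if x \<in> D then f x y else h x y)"
proof (cases "x \<in> D")
  case True
  have "mat_mult f h x y = mat_mult f mat_one x y"
    unfolding mat_mult_def
  proof (rule sum.cong)
    fix z assume "z \<in> {z. f x z \<noteq> 0}"
    then have "z \<in> D" using True supported_entry[OF assms(1), of x z] by auto
    then have "z \<notin> E" using assms(3) by blast
    then show "f x z * h z y = f x z * mat_one z y" using supportedD[OF assms(2)] by simp
  qed simp
  then show ?thesis using True assms(4) by (simp add: mat_mult_one_right)
next
  case False
  then have "f x z = mat_one x z" for z using supportedD[OF assms(1)] by simp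
  then have "mat_mult f h x y = mat_one x x * h x y"
    by (subst mat_mult_single[of x]) (simp_all add: mat_one_def)
  then show ?thesis using False by (simp add: mat_one_def)
qed

lemma mat_mult_disjoint_commute:
  assumes "supported D f" "supported E h" "D \<inter> E = {}" "row_finite f" "row_finite h"
  shows "mat_mult f h = mat_mult h f"
proof (intro ext)
  fix x y
  have ED: "E \<inter> D = {}" using assms(3) by blast
  show "mat_mult f h x y = mat_mult h f x y"
    unfolding mat_mult_disjoint[OF assms(1-4)] mat_mult_disjoint[OF assms(2,1) ED assms(5)]
    using assms(3) supportedD[OF assms(1), of x y] supportedD[OF assms(2), of x y] by auto
qed

lemma involution_GL:
  assumes "g \<in> finite_matrices I F" "mat_mult g g = mat_one"
  shows "g \<in> GL I F"
  using GL_I[OF assms(1,1,2,2)] .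

definition swap :: "nat \<Rightarrow> nat \<Rightarrow> nat" where
  "swap N k = (if k < N then k + N else if k < 2 * N then k - N else k)"

lemma swap_swap [simp]: "swap N (swap N k) = k"
  by (auto simp: swap_def)

lemma eventually_swap_neq: "\<forall>\<^sub>F N in sequentially. swap N k \<noteq> l"
  using eventually_gt_at_top[of "max k l"] by eventually_elim (auto simp: swap_def)

lemma perm_mat_swap_heavy: "perm_mat (swap N) \<in> carrier (irr_heavy_group F)"
proof -
  have "supported {..<2 * N} (perm_mat (swap N))"
    unfolding supported_def
  proof (intro allI impI)
    fix x y assume "x \<notin> {..<2 * N} \<or> y \<notin> {..<2 * N}"
    then show "perm_mat (swap N) x y = mat_one x y"
      by (auto simp: perm_mat_def mat_one_def swap_def)
  qed
  moreover have "perm_mat (swap N) x y \<in> scalars F" for x y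
    by (simp add: perm_mat_def)
  ultimately have fin: "perm_mat (swap N) \<in> finite_matrices UNIV F"
    unfolding finite_matrices_iff by (intro conjI exI[of _ "{..<2 * N}"]) simp_all
  have sq: "mat_mult (perm_mat (swap N)) (perm_mat (swap N)) = mat_one"
    by (rule perm_mat_square) simp
  have "mat_adjoint (perm_mat (swap N)) x y = perm_mat (swap N) x y" for x y
    using swap_swap[of N x] swap_swap[of N y] by (auto simp: mat_adjoint_def perm_mat_def)
  then have "mat_adjoint (perm_mat (swap N)) = perm_mat (swap N)" by (intro ext)
  then show ?thesis
    using involution_GL[OF fin sq] sq by (simp add: carrier_irr_heavy)
qed

definition reflection :: "'i \<Rightarrow> 'i qmat" where
  "reflection e = (\<lambda>x y. if x = y then if x = e then - 1 else 1 else 0)"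

lemma reflection_supported: "supported {e} (reflection e)"
  by (auto simp: supported_def reflection_def mat_one_def)

lemma reflection_GL: "e \<in> I \<Longrightarrow> reflection e \<in> GL I F"
  and reflection_square: "mat_mult (reflection e) (reflection e) = mat_one"
  and reflection_adjoint: "mat_adjoint (reflection e) = reflection e"
proof -
  show sq: "mat_mult (reflection e) (reflection e) = mat_one"
  proof (intro ext)
    fix x y
    show "mat_mult (reflection e) (reflection e) x y = mat_one x y"
      by (subst mat_mult_single[of x]) (auto simp: reflection_def mat_one_def)
  qed
  show "mat_adjoint (reflection e) = reflection e"
    by (intro ext) (simp add: mat_adjoint_def reflection_def quat_defs)
  assume "e \<in> I"
  then have "reflection e \<in> finite_matrices I F"
    unfolding finite_matrices_iff
    by (intro conjI exI[of _ "{e}"] reflection_supported) (simp_all add: reflection_def)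
  then show "reflection e \<in> GL I F" using sq by (rule involution_GL)
qed

lemma reflection_heavy: "reflection e \<in> carrier (irr_heavy_group F)"
  by (simp add: carrier_irr_heavy reflection_GL reflection_adjoint reflection_square)

section \<open>Straight homomorphisms\<close>

text \<open>
  Trivial homomorphisms act on entries, and take \<open>0\<close> and \<open>1\<close> to the zero block and the identity block.
\<close>

lemma trivial_hom_perm:
  assumes "trivial_hom F F' d \<tau>" "s < d" "t < d"
  shows "\<tau> (perm_mat \<pi>) (k, s) (l, t) = (if l = \<pi> k \<and> t = s then 1 else 0)"
proof -
  have two: "n = 0 \<or> n = 1" if "n < 2" for n :: nat using that by auto
  have four: "n = 0 \<or> n = 1 \<or> n = 2 \<or> n = 3" if "n < 4" for n :: nat using that by auto
  show ?thesis
    using assms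
  proof cases
    case inclusion
    then show ?thesis using assms by (simp add: expand_def perm_mat_def)
  next
    case conjugation
    then show ?thesis using assms by (simp add: expand_def perm_mat_def)
  next
    case U_to_O
    then show ?thesis using assms two[of s] two[of t]
      by (auto simp: expand_def perm_mat_def real_block_def qcomponent_def qunit_def quat_defs)
  next
    case Sp_to_O
    then show ?thesis using assms four[of s] four[of t]
      by (auto simp: expand_def perm_mat_def real_block_def qcomponent_def qunit_def quat_defs)
  next
    case Sp_to_U
    then show ?thesis using assms two[of s] two[of t]
      by (auto simp: expand_def perm_mat_def complex_block_def Let_def quat_defs)
  qed
qed

definition shift :: "fld list \<Rightarrow> nat \<Rightarrow> nat \<Rightarrow> nat qmat" where
  "shift Ls N = (\<lambda>m\<in>{..<length Ls}. perm_mat (swap N))"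

lemma shift_carrier: "shift Ls N \<in> carrier (heavy_group Ls)"
  unfolding shift_def heavy_group_def using perm_mat_swap_heavy by auto

text \<open>
  Either some basis vector of the target is hit by no block, and then it spans a unit block, or the
  blocks exhaust the basis. In the second case the image of a permutation matrix permutes the basis
  vectors in each block according to their first index.
\<close>

lemma straight_irr_cases:
  assumes "straight_irr Ls F \<psi>"
  obtains (unit_block) e where
    "\<And>g y. g \<in> carrier (heavy_group Ls) \<Longrightarrow> \<psi> g e y = mat_one e y \<and> \<psi> g y e = mat_one y e"
  | (moving) \<pi> where "\<And>N. \<psi> (shift Ls N) = perm_mat (\<pi> N)" "\<And>N x. \<pi> N (\<pi> N x) = x"
      "\<And>a b. \<forall>\<^sub>F N in sequentially. \<pi> N a \<noteq> b"
proof -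
  obtain bs \<beta> where
    bs': "\<forall>(m, d, \<tau>) \<in> set bs. m < length Ls \<and> trivial_hom (Ls ! m) F d \<tau>" and
    inj: "inj_on (\<lambda>(j, u). \<beta> j u) (SIGMA j:{..<length bs}. block_index bs j)" and
    block: "\<forall>g \<in> carrier (heavy_group Ls).
           (\<forall>j < length bs. \<forall>u \<in> block_index bs j. \<forall>v \<in> block_index bs j.
              case bs ! j of (m, d, \<tau>) \<Rightarrow> \<psi> g (\<beta> j u) (\<beta> j v) = \<tau> (g m) u v) \<and>
           (\<forall>x y. \<not> (\<exists>j < length bs. x \<in> \<beta> j ` block_index bs j \<and> y \<in> \<beta> j ` block_index bs j)
              \<longrightarrow> \<psi> g x y = mat_one x y)"
    using assms unfolding straight_irr_def by (elim exE conjE) (rule that)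
  have bs: "m < length Ls \<and> trivial_hom (Ls ! m) F d \<tau>" if "(m, d, \<tau>) \<in> set bs" for m d \<tau>
    using bspec[OF bs' that] by simp
  have diag: "\<psi> g (\<beta> j u) (\<beta> j v) = \<tau> (g m) u v"
    if "g \<in> carrier (heavy_group Ls)" "j < length bs" "u \<in> block_index bs j" "v \<in> block_index bs j"
      and b: "bs ! j = (m, d, \<tau>)" for g j u v m d \<tau>
  proof -
    have "case bs ! j of (m, d, \<tau>) \<Rightarrow> \<psi> g (\<beta> j u) (\<beta> j v) = \<tau> (g m) u v"
      by (rule conjunct1[OF bspec[OF block that(1)], rule_format, OF that(2-4)])
    then show ?thesis by (simp add: b)
  qed
  have off: "\<psi> g x y = mat_one x y"
    if "g \<in> carrier (heavy_group Ls)"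
      "\<not> (\<exists>j<length bs. x \<in> \<beta> j ` block_index bs j \<and> y \<in> \<beta> j ` block_index bs j)" for g x y
    by (rule conjunct2[OF bspec[OF block that(1)], rule_format, OF that(2)])
  define S where "S = (SIGMA j:{..<length bs}. block_index bs j)"
  define f where "f = (\<lambda>(j, u). \<beta> j u)"
  have inj: "inj_on f S" using inj by (simp add: S_def f_def)
  have S_iff: "(j, k, s) \<in> S \<longleftrightarrow> j < length bs \<and> s < fst (snd (bs ! j))" for j k s
    by (auto simp: S_def block_index_def)
  have block_iff: "x \<in> \<beta> j ` block_index bs j \<longleftrightarrow> (\<exists>u. (j, u) \<in> S \<and> x = f (j, u))" if "j < length bs" for x j
    using that by (auto simp: S_def f_def)
  show ?thesis
  proof (cases "f ` S = UNIV")
    case False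
    then obtain e where "e \<notin> f ` S" by blast
    then have "\<not> (\<exists>u. (j, u) \<in> S \<and> e = f (j, u))" for j by blast
    then have "\<not> (\<exists>j<length bs. e \<in> \<beta> j ` block_index bs j)" using block_iff by blast
    then show ?thesis using off by (intro unit_block[of e]) blast
  next
    case True
    \<comment> \<open>the permutation in block coordinates; \<open>f\<close> translates them into basis vectors\<close>
    define move :: "nat \<Rightarrow> nat \<times> nat \<times> nat \<Rightarrow> nat \<times> nat \<times> nat"
      where "move N = (\<lambda>(j, k, s). (j, swap N k, s))" for N
    have move_S: "move N p \<in> S" if "p \<in> S" for N p
      using that by (cases p) (simp add: move_def S_iff)
    have move_move: "move N (move N p) = p" for N p
      by (cases p) (simp add: move_def)
    define \<pi> where "\<pi> N x = f (move N (inv_into S f x))" for N x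
    have inv_S: "inv_into S f x \<in> S" "f (inv_into S f x) = x" for x
      using True by (simp_all add: inv_into_into f_inv_into_f)
    have pi_f: "\<pi> N (f p) = f (move N p)" if "p \<in> S" for N p
      using that inj by (simp add: \<pi>_def)
    show ?thesis
    proof (rule moving)
      fix N
      show "\<pi> N (\<pi> N x) = x" for x
        using inv_S[of x] by (metis move_S move_move pi_f)
      show "\<psi> (shift Ls N) = perm_mat (\<pi> N)"
      proof (intro ext)
        fix x y
        obtain j k s where x: "(j, k, s) \<in> S" "x = f (j, k, s)" using inv_S by (metis prod_cases3)
        obtain j' k' s' where y: "(j', k', s') \<in> S" "y = f (j', k', s')" using inv_S by (metis prod_cases3)
        have "(j, swap N k, s) \<in> S" using x(1) by (simp add: S_iff)
        moreover have "\<pi> N x = f (j, swap N k, s)" using pi_f[OF x(1)] x(2) by (simp add: move_def)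
        ultimately have perm: "y = \<pi> N x \<longleftrightarrow> j' = j \<and> k' = swap N k \<and> s' = s"
          using y inj by (auto dest: inj_onD)
        show "\<psi> (shift Ls N) x y = perm_mat (\<pi> N) x y"
        proof (cases "j = j'")
          case True
          obtain m d \<tau> where b: "bs ! j = (m, d, \<tau>)" by (metis prod_cases3)
          have j: "j < length bs" "s < d" "s' < d" using x y b True by (simp_all add: S_iff)
          have m: "m < length Ls" "trivial_hom (Ls ! m) F d \<tau>"
            using bs[of m d \<tau>] nth_mem[OF j(1)] b by simp_all
          have "\<psi> (shift Ls N) x y = \<tau> (shift Ls N m) (k, s) (k', s')"
            using diag[OF shift_carrier j(1) _ _ b, of "(k, s)" "(k', s')" N] x y True b j
            by (simp add: f_def block_index_def)
          also have "\<dots> = (if k' = swap N k \<and> s' = s then 1 else 0)"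
            using m trivial_hom_perm[OF m(2) j(2,3)] by (simp add: shift_def)
          finally show ?thesis using perm True by (simp add: perm_mat_def)
        next
          case False
          have "\<not> (\<exists>i<length bs. x \<in> \<beta> i ` block_index bs i \<and> y \<in> \<beta> i ` block_index bs i)"
          proof (intro notI, elim exE conjE)
            fix i assume i: "i < length bs" "x \<in> \<beta> i ` block_index bs i" "y \<in> \<beta> i ` block_index bs i"
            then obtain u v where "(i, u) \<in> S" "x = f (i, u)" "(i, v) \<in> S" "y = f (i, v)"
              using block_iff by blast
            then have "(i, u) = (j, k, s)" "(i, v) = (j', k', s')"
              using x y inj by (simp_all add: inj_on_eq_iff)
            then show False using False by simp
          qed
          then have "\<psi> (shift Ls N) x y = mat_one x y" by (rule off[OF shift_carrier])
          moreover have "x \<noteq> y" using x y inj False by (auto dest: inj_onD)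
          ultimately show ?thesis using perm False by (simp add: perm_mat_def mat_one_def)
        qed
      qed
    next
      fix a b
      obtain j k s where a: "(j, k, s) \<in> S" "a = f (j, k, s)" using inv_S by (metis prod_cases3)
      obtain j' k' s' where b: "(j', k', s') \<in> S" "b = f (j', k', s')" using inv_S by (metis prod_cases3)
      show "\<forall>\<^sub>F N in sequentially. \<pi> N a \<noteq> b"
        using eventually_swap_neq[of k k']
      proof eventually_elim
        case (elim N)
        have "(j, swap N k, s) \<in> S" using a(1) by (simp add: S_iff)
        moreover have "\<pi> N a = f (j, swap N k, s)" using pi_f[OF a(1)] a(2) by (simp add: move_def)
        ultimately show ?case using b inj elim by (auto dest: inj_onD)
      qed
    qed
  qed
qed

section \<open>Pure pairs are spherical\<close>

lemma block_diag_perm_mat: "block_diag (perm_mat \<pi>) (perm_mat \<sigma>) = perm_mat (map_sum \<pi> \<sigma>)"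
  by (rule block_diag_ext[symmetric]) (simp_all add: perm_mat_def)

lemma perm_mat_id: "perm_mat (\<lambda>x. x) = mat_one"
  by (intro ext) (auto simp: perm_mat_def mat_one_def)

context block_embedding
begin

lemma E_perm_mat: "E (perm_mat \<pi>) = perm_mat (map_sum \<pi> \<pi>)"
proof (intro ext)
  fix x y
  show "E (perm_mat \<pi>) x y = perm_mat (map_sum \<pi> \<pi>) x y"
    unfolding E_eq by (cases x; cases y) (simp_all add: perm_mat_def block_one block_zero)
qed

end

text \<open>
  The basis vectors of a classical group with \<open>p = 0\<close>: all matrices of the group are supported there,
  and no vector of this set is fixed by all permutations that come from the heavy subgroup.
\<close>

definition moving_basis :: "classical \<Rightarrow> (nat + nat) set" where
  "moving_basis c = (case c of GL_inf F \<Rightarrow> range Inr | U_fin_inf p F \<Rightarrow> range Inr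
     | O_inf_C \<Rightarrow> range Inr | _ \<Rightarrow> UNIV)"

fun embedded_perm :: "classical \<Rightarrow> (nat \<Rightarrow> nat \<Rightarrow> nat) \<Rightarrow> nat + nat \<Rightarrow> nat + nat" where
  "embedded_perm (GL_inf F) \<pi> = map_sum (\<lambda>x. x) (\<pi> 0)"
| "embedded_perm (U_inf_inf F) \<pi> = map_sum (\<pi> 0) (\<pi> 1)"
| "embedded_perm (U_fin_inf p F) \<pi> = map_sum (\<lambda>x. x) (\<pi> 0)"
| "embedded_perm Sp_2inf_R \<pi> = map_sum (\<pi> 0) (\<pi> 0)"
| "embedded_perm Sp_2inf_C \<pi> = map_sum (\<pi> 0) (\<pi> 0)"
| "embedded_perm O_inf_C \<pi> = map_sum (\<lambda>x. x) (\<pi> 0)"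
| "embedded_perm SO_star_2inf \<pi> = map_sum (\<pi> 0) (\<pi> 0)"

lemma heavy_embed_perm_mat: "heavy_embed c (\<lambda>s. perm_mat (\<pi> s)) = perm_mat (embedded_perm c \<pi>)"
  by (cases c) (simp_all add: real_embedding.E_perm_mat complex_embedding.E_perm_mat
      flip: perm_mat_id block_diag_perm_mat)

lemma embedded_perm_involution:
  assumes "\<And>s x. s < length (heavy_factors c) \<Longrightarrow> \<pi> s (\<pi> s x) = x"
  shows "embedded_perm c \<pi> (embedded_perm c \<pi> x) = x"
  using assms[of 0] assms[of 1] by (cases c; cases x) simp_all

lemma embedded_perm_moving:
  assumes moving: "\<And>s a b. s < length (heavy_factors c) \<Longrightarrow> \<forall>\<^sub>F N in sequentially. \<pi> N s a \<noteq> b"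
    and a: "a \<in> moving_basis c"
  shows "\<forall>\<^sub>F N in sequentially. embedded_perm c (\<pi> N) a \<noteq> b"
proof -
  have inl: "\<forall>\<^sub>F N in sequentially. map_sum (f N) (\<sigma> N) (Inl k) \<noteq> b"
    if "\<And>l. \<forall>\<^sub>F N in sequentially. f N k \<noteq> l" for f \<sigma> :: "nat \<Rightarrow> nat \<Rightarrow> nat" and k
    using that by (cases b) simp_all
  have inr: "\<forall>\<^sub>F N in sequentially. map_sum (f N) (\<sigma> N) (Inr k) \<noteq> b"
    if "\<And>l. \<forall>\<^sub>F N in sequentially. \<sigma> N k \<noteq> l" for f \<sigma> :: "nat \<Rightarrow> nat \<Rightarrow> nat" and k
    using that by (cases b) simp_all
  have 0: "\<forall>\<^sub>F N in sequentially. \<pi> N 0 k \<noteq> l" for k l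
    by (rule moving) (cases c; simp)
  have 1: "\<forall>\<^sub>F N in sequentially. \<pi> N 1 k \<noteq> l" if "c = U_inf_inf F" for k l F
    by (rule moving) (simp add: that)
  show ?thesis
    using a 0 1
    by (cases c; cases a) (auto simp: moving_basis_def intro!: inl inr simp del: map_sum.simps)
qed

lemma irr_classical_moving_basis:
  assumes "\<And>p F. c = U_fin_inf p F \<Longrightarrow> p = 0"
  shows "irr_classical_carrier c \<subseteq> finite_matrices (moving_basis c) HH"
proof
  fix g assume g: "g \<in> irr_classical_carrier c"
  have "basis_fin 0 = range Inr" by (simp add: basis_fin_def)
  then have "\<exists>F. g \<in> GL (moving_basis c) F"
    using g assms by (cases c) (auto simp: moving_basis_def)
  then obtain F where "g \<in> GL (moving_basis c) F" ..
  then have "g \<in> GL (moving_basis c) HH" by (rule GL_mono[OF subset_refl, rotated]) simp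
  then show "g \<in> finite_matrices (moving_basis c) HH" by (rule GL_finite_matrices)
qed

text \<open>
  Conjugation by a permutation matrix transports the support of \<open>f\<close> along the permutation, finally to a
  set disjoint from the support of \<open>h\<close>.
\<close>

lemma eventually_conj_commute:
  assumes f: "f \<in> finite_matrices I F" and h: "h \<in> finite_matrices I F"
    and invol: "\<And>N x. \<pi> N (\<pi> N x) = x"
    and moving: "\<And>a b. a \<in> I \<Longrightarrow> \<forall>\<^sub>F N in sequentially. \<pi> N a \<noteq> b"
  shows "\<forall>\<^sub>F N in sequentially.
    mat_mult (mat_mult (mat_mult (perm_mat (\<pi> N)) f) (perm_mat (\<pi> N))) h
      = mat_mult h (mat_mult (mat_mult (perm_mat (\<pi> N)) f) (perm_mat (\<pi> N)))"
proof -
  obtain D where D: "finite D" "D \<subseteq> I" "supported D f"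
    using f unfolding finite_matrices_iff by blast
  obtain E where E: "finite E" "supported E h"
    using h unfolding finite_matrices_iff by blast
  have rf: "row_finite f" "row_finite h"
    using f h by (simp_all add: finite_matrices_row_finite)
  have "\<forall>\<^sub>F N in sequentially. \<forall>a\<in>D. \<forall>b\<in>E. \<pi> N a \<noteq> b"
    using D E moving by (intro eventually_ball_finite ballI) auto
  then show ?thesis
  proof eventually_elim
    case (elim N)
    have inj: "\<pi> N x = \<pi> N y \<longleftrightarrow> x = y" for x y using invol by metis
    have "supported (\<pi> N ` D) (\<lambda>x y. f (\<pi> N x) (\<pi> N y))"
      unfolding supported_def
    proof (intro allI impI)
      fix x y assume "x \<notin> \<pi> N ` D \<or> y \<notin> \<pi> N ` D"
      moreover have "z \<in> \<pi> N ` D" if "\<pi> N z \<in> D" for z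
        by (rule image_eqI[OF _ that]) (simp add: invol)
      ultimately have "\<pi> N x \<notin> D \<or> \<pi> N y \<notin> D" by blast
      then show "f (\<pi> N x) (\<pi> N y) = mat_one x y"
        using supportedD[OF D(3)] by (simp add: mat_one_def inj)
    qed
    then show ?case
      unfolding perm_mat_conj[OF invol rf(1)]
      using elim D(1) E rf
      by (intro mat_mult_disjoint_commute[where D = "\<pi> N ` D" and E = E])
        (auto intro: supported_row_finite)
  qed
qed

lemma straight_pair_mem:
  assumes "straight_pair Gs Ls \<phi>" "l \<in> carrier (heavy_group Ls)"
    and "i < length Gs" "s < length (heavy_factors (Gs ! i))"
  shows "\<phi> l (i, s) \<in> carrier (irr_heavy_group (heavy_factors (Gs ! i) ! s))"
proof -
  have "\<phi> \<in> hom (heavy_group Ls) (product_group (max_heavy_index Gs) (\<lambda>i. irr_heavy_group (max_heavy_factor Gs i)))"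
    using assms(1) by (simp add: straight_pair_def straight_hom_def)
  from hom_in_carrier[OF this assms(2)]
  have "\<phi> l \<in> (\<Pi>\<^sub>E p\<in>max_heavy_index Gs. carrier (irr_heavy_group (max_heavy_factor Gs p)))"
    by simp
  moreover have "(i, s) \<in> max_heavy_index Gs" using assms by (simp add: max_heavy_index_def)
  ultimately have "\<phi> l (i, s) \<in> carrier (irr_heavy_group (max_heavy_factor Gs (i, s)))"
    by (rule PiE_mem)
  then show ?thesis by (simp add: max_heavy_factor_def)
qed

lemma straight_pair_embed_closed:
  assumes "straight_pair Gs Ls \<phi>" "l \<in> carrier (heavy_group Ls)" "i < length Gs"
  shows "heavy_embed (Gs ! i) (\<lambda>s. \<phi> l (i, s)) \<in> irr_classical_carrier (Gs ! i)"
  using straight_pair_mem[OF assms] by (rule heavy_embed_closed)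

lemma irr_classical_row_finite: "g \<in> irr_classical_carrier c \<Longrightarrow> row_finite g"
  using irr_classical_finite finite_matrices_row_finite by blast

lemma irr_heavy_row_finite: "g \<in> carrier (irr_heavy_group F) \<Longrightarrow> row_finite g"
  unfolding carrier_irr_heavy by (blast intro: GL_row_finite)

lemma one_irr_classical: "mat_one \<in> irr_classical_carrier c"
  using monoid.one_closed[OF group.is_monoid[OF group_irr_classical[of c]]] by simp

lemma carrier_classical_group:
  "carrier (classical_group Gs) = (\<Pi>\<^sub>E i\<in>{..<length Gs}. irr_classical_carrier (Gs ! i))"
  by (simp add: classical_group_def)

lemma mult_classical_group:
  "g \<otimes>\<^bsub>classical_group Gs\<^esub> h = (\<lambda>i\<in>{..<length Gs}. mat_mult (g i) (h i))"
  by (simp add: classical_group_def)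

lemma one_classical_group: "\<one>\<^bsub>classical_group Gs\<^esub> = (\<lambda>i\<in>{..<length Gs}. mat_one)"
  by (simp add: classical_group_def)

lemma group_classical_group: "group (classical_group Gs)"
  unfolding classical_group_def by (rule product_group) (rule group_irr_classical)

lemma pure_pair_commuting_trivial:
  assumes pure: "pure_pair Gs Ls \<phi>" and i: "i < length Gs" and x: "x \<in> irr_classical_carrier (Gs ! i)"
    and comm: "\<And>l. l \<in> carrier (heavy_group Ls) \<Longrightarrow>
      mat_mult x (heavy_embed (Gs ! i) (\<lambda>s. \<phi> l (i, s))) = mat_mult (heavy_embed (Gs ! i) (\<lambda>s. \<phi> l (i, s))) x"
  shows "x = mat_one"
proof -
  have sp: "straight_pair Gs Ls \<phi>" using pure by (simp add: pure_pair_def)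
  define g where "g = (\<lambda>k\<in>{..<length Gs}. if k = i then x else mat_one)"
  have g: "g \<in> carrier (classical_group Gs)"
    unfolding carrier_classical_group g_def using x one_irr_classical by auto
  have "g \<otimes>\<^bsub>classical_group Gs\<^esub> max_heavy_embed Gs (\<phi> l)
      = max_heavy_embed Gs (\<phi> l) \<otimes>\<^bsub>classical_group Gs\<^esub> g" if l: "l \<in> carrier (heavy_group Ls)" for l
    unfolding mult_classical_group
  proof (rule restrict_ext)
    fix k assume k: "k \<in> {..<length Gs}"
    then have "k < length Gs" by simp
    then have "row_finite (heavy_embed (Gs ! k) (\<lambda>s. \<phi> l (k, s)))"
      by (rule irr_classical_row_finite[OF straight_pair_embed_closed[OF sp l]])
    then show "mat_mult (g k) (max_heavy_embed Gs (\<phi> l) k) = mat_mult (max_heavy_embed Gs (\<phi> l) k) (g k)"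
      using k comm[OF l] by (simp add: g_def max_heavy_embed_def mat_mult_one_right)
  qed
  then have "g \<in> centralizer (classical_group Gs) (image_in_G Gs Ls \<phi>)"
    using g by (simp add: centralizer_def image_in_G_def)
  then have "g = (\<lambda>i\<in>{..<length Gs}. mat_one)"
    using pure by (simp add: pure_pair_def one_classical_group)
  then have "g i = (\<lambda>i\<in>{..<length Gs}. mat_one) i" by simp
  then show ?thesis using i by (simp add: g_def)
qed

text \<open>
  The reflection in one of the \<open>p\<close> first basis vectors would centralize the heavy subgroup.
\<close>

lemma pure_pair_no_finite_part:
  assumes pure: "pure_pair Gs Ls \<phi>" and i: "i < length Gs" "Gs ! i = U_fin_inf p F"
  shows "p = 0"
proof (rule ccontr)
  assume "p \<noteq> 0"
  let ?x = "block_diag (reflection 0) mat_one"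
  have R: "reflection 0 \<in> GL {..<p} F" using \<open>p \<noteq> 0\<close> by (intro reflection_GL) simp
  have "?x \<in> GL (basis_fin p) F"
    unfolding basis_fin_eq by (intro block_diag_GL R one_GL)
  moreover have "preserves_sesquilinear indefinite_form ?x"
    using R one_GL[of UNIV F]
    by (rule block_diag_preserves_indefinite) (simp_all add: reflection_adjoint reflection_square adjoint_one)
  ultimately have x: "?x \<in> irr_classical_carrier (Gs ! i)" using i by simp
  have "?x = mat_one"
  proof (rule pure_pair_commuting_trivial[OF pure i(1) x])
    fix l assume l: "l \<in> carrier (heavy_group Ls)"
    have "\<phi> l (i, 0) \<in> carrier (irr_heavy_group F)"
      using straight_pair_mem[of Gs Ls \<phi> l i 0] pure l i by (simp add: pure_pair_def)
    then have "row_finite (\<phi> l (i, 0))" by (rule irr_heavy_row_finite)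
    then show "mat_mult ?x (heavy_embed (Gs ! i) (\<lambda>s. \<phi> l (i, s)))
        = mat_mult (heavy_embed (Gs ! i) (\<lambda>s. \<phi> l (i, s))) ?x"
      using GL_row_finite[OF R] by (simp add: i block_diag_mult mat_mult_one_right)
  qed
  from arg_cong[OF this, of "\<lambda>M. M (Inl 0) (Inl 0)"] show False
    by (simp add: reflection_def mat_one_def quat_defs)
qed

lemma heavy_embed_reflection_neq_one:
  assumes "s < length (heavy_factors c)"
  shows "heavy_embed c (\<lambda>t. if t = s then reflection e else mat_one) \<noteq> mat_one"
proof
  assume *: "heavy_embed c (\<lambda>t. if t = s then reflection e else mat_one) = mat_one"
  have "heavy_embed c (\<lambda>t. if t = s then reflection e else mat_one) (Inl e) (Inl e) = 1"
    "heavy_embed c (\<lambda>t. if t = s then reflection e else mat_one) (Inr e) (Inr e) = 1"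
    unfolding * by (simp_all add: mat_one_def)
  then show False
    using assms
    by (cases c) (auto simp: less_Suc_eq reflection_def mat_one_def real_embedding.E_eq complex_embedding.E_eq
        real_block_def complex_block_def Let_def qcomponent_def qunit_def quat_defs split: if_splits)
qed

text \<open>
  The reflection in the basis vector \<open>e\<close> lies in the maximal heavy subgroup itself, and it would
  centralize \<open>L\<close>.
\<close>

lemma pure_pair_no_unit_block:
  assumes pure: "pure_pair Gs Ls \<phi>" and i: "i < length Gs" and s: "s < length (heavy_factors (Gs ! i))"
    and unit: "\<And>l y. l \<in> carrier (heavy_group Ls) \<Longrightarrow>
      \<phi> l (i, s) e y = mat_one e y \<and> \<phi> l (i, s) y e = mat_one y e"
  shows False
proof -
  have sp: "straight_pair Gs Ls \<phi>" using pure by (simp add: pure_pair_def)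
  let ?\<kappa> = "\<lambda>t. if t = s then reflection e else mat_one"
  have one: "mat_one \<in> carrier (irr_heavy_group F)" for F
    by (simp add: carrier_irr_heavy one_GL adjoint_one)
  have \<kappa>: "?\<kappa> t \<in> carrier (irr_heavy_group F)" for t F
    by (simp add: one reflection_heavy)
  have "heavy_embed (Gs ! i) ?\<kappa> = mat_one"
  proof (rule pure_pair_commuting_trivial[OF pure i])
    show "heavy_embed (Gs ! i) ?\<kappa> \<in> irr_classical_carrier (Gs ! i)"
      by (rule heavy_embed_closed) (rule \<kappa>)
    fix l assume l: "l \<in> carrier (heavy_group Ls)"
    note mem = straight_pair_mem[OF sp l i]
    have "mat_mult (?\<kappa> t) (\<phi> l (i, t)) = mat_mult (\<phi> l (i, t)) (?\<kappa> t)"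
      if t: "t < length (heavy_factors (Gs ! i))" for t
    proof -
      have rf: "row_finite (\<phi> l (i, t))"
        using mem[OF t] by (rule irr_heavy_row_finite)
      show ?thesis
      proof (cases "t = s")
        case True
        have "supported (- {e}) (\<phi> l (i, s))"
          using unit[OF l] by (simp add: supported_def)
        then have "mat_mult (reflection e) (\<phi> l (i, s)) = mat_mult (\<phi> l (i, s)) (reflection e)"
          using rf True reflection_supported[of e] supported_row_finite[OF _ reflection_supported[of e]]
          by (intro mat_mult_disjoint_commute[where D = "{e}" and E = "- {e}"]) simp_all
        then show ?thesis using True by simp
      next
        case False
        then show ?thesis using rf by (simp add: mat_mult_one_right)
      qed
    qed
    then have "heavy_embed (Gs ! i) (\<lambda>t. mat_mult (?\<kappa> t) (\<phi> l (i, t)))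
        = heavy_embed (Gs ! i) (\<lambda>t. mat_mult (\<phi> l (i, t)) (?\<kappa> t))"
      by (rule heavy_embed_cong)
    moreover have "heavy_embed (Gs ! i) (\<lambda>t. mat_mult (?\<kappa> t) (\<phi> l (i, t)))
        = mat_mult (heavy_embed (Gs ! i) ?\<kappa>) (heavy_embed (Gs ! i) (\<lambda>t. \<phi> l (i, t)))"
      using \<kappa> mem by (rule heavy_embed_mult)
    moreover have "heavy_embed (Gs ! i) (\<lambda>t. mat_mult (\<phi> l (i, t)) (?\<kappa> t))
        = mat_mult (heavy_embed (Gs ! i) (\<lambda>t. \<phi> l (i, t))) (heavy_embed (Gs ! i) ?\<kappa>)"
      using mem \<kappa> by (rule heavy_embed_mult)
    ultimately show "mat_mult (heavy_embed (Gs ! i) ?\<kappa>) (heavy_embed (Gs ! i) (\<lambda>t. \<phi> l (i, t)))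
        = mat_mult (heavy_embed (Gs ! i) (\<lambda>t. \<phi> l (i, t))) (heavy_embed (Gs ! i) ?\<kappa>)"
      by (simp only:)
  qed
  then show False using heavy_embed_reflection_neq_one[OF s] by blast
qed

lemma pure_pair_moving:
  assumes pure: "pure_pair Gs Ls \<phi>" and i: "i < length Gs" and s: "s < length (heavy_factors (Gs ! i))"
  shows "\<exists>\<pi>. (\<forall>N. \<phi> (shift Ls N) (i, s) = perm_mat (\<pi> N)) \<and> (\<forall>N x. \<pi> N (\<pi> N x) = x)
    \<and> (\<forall>a b. \<forall>\<^sub>F N in sequentially. \<pi> N a \<noteq> b)"
proof -
  have "(i, s) \<in> max_heavy_index Gs" using i s by (simp add: max_heavy_index_def)
  then have "straight_irr Ls (max_heavy_factor Gs (i, s)) (\<lambda>l. \<phi> l (i, s))"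
    using pure by (simp add: pure_pair_def straight_pair_def straight_hom_def)
  then show ?thesis
  proof (cases rule: straight_irr_cases)
    case (unit_block e)
    then show ?thesis using pure_pair_no_unit_block[OF pure i s] by blast
  next
    case (moving \<pi>)
    then show ?thesis by blast
  qed
qed

lemma pure_pair_shift:
  assumes pure: "pure_pair Gs Ls \<phi>" and i: "i < length Gs"
  obtains \<pi> where
    "\<And>N. heavy_embed (Gs ! i) (\<lambda>s. \<phi> (shift Ls N) (i, s)) = perm_mat (\<pi> N)"
    "\<And>N x. \<pi> N (\<pi> N x) = x"
    "\<And>a b. a \<in> moving_basis (Gs ! i) \<Longrightarrow> \<forall>\<^sub>F N in sequentially. \<pi> N a \<noteq> b"
proof -
  let ?c = "Gs ! i"
  have "\<exists>\<sigma>. \<forall>s. s < length (heavy_factors ?c) \<longrightarrow>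
      (\<forall>N. \<phi> (shift Ls N) (i, s) = perm_mat (\<sigma> s N)) \<and> (\<forall>N x. \<sigma> s N (\<sigma> s N x) = x)
      \<and> (\<forall>a b. \<forall>\<^sub>F N in sequentially. \<sigma> s N a \<noteq> b)"
    using pure_pair_moving[OF pure i] by (intro choice allI) blast
  then obtain \<sigma> where \<sigma>:
    "\<And>s N. s < length (heavy_factors ?c) \<Longrightarrow> \<phi> (shift Ls N) (i, s) = perm_mat (\<sigma> s N)"
    "\<And>s N x. s < length (heavy_factors ?c) \<Longrightarrow> \<sigma> s N (\<sigma> s N x) = x"
    "\<And>s a b. s < length (heavy_factors ?c) \<Longrightarrow> \<forall>\<^sub>F N in sequentially. \<sigma> s N a \<noteq> b"
    by blast
  show ?thesis
  proof (rule that[of "\<lambda>N. embedded_perm ?c (\<lambda>s. \<sigma> s N)"])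
    fix N
    show "heavy_embed ?c (\<lambda>s. \<phi> (shift Ls N) (i, s)) = perm_mat (embedded_perm ?c (\<lambda>s. \<sigma> s N))"
      unfolding heavy_embed_perm_mat[symmetric] by (rule heavy_embed_cong) (rule \<sigma>(1))
    show "embedded_perm ?c (\<lambda>s. \<sigma> s N) (embedded_perm ?c (\<lambda>s. \<sigma> s N) x) = x" for x
      by (rule embedded_perm_involution) (rule \<sigma>(2))
  next
    fix a b assume "a \<in> moving_basis ?c"
    then show "\<forall>\<^sub>F N in sequentially. embedded_perm ?c (\<lambda>s. \<sigma> s N) a \<noteq> b"
      by (intro embedded_perm_moving[where \<pi> = "\<lambda>N s. \<sigma> s N"] \<sigma>(3))
  qed
qed

lemma pure_pair_eventually_commute:
  assumes pure: "pure_pair Gs Ls \<phi>"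
    and a: "a \<in> carrier (classical_group Gs)" and b: "b \<in> carrier (classical_group Gs)"
  defines "\<theta> \<equiv> \<lambda>N. max_heavy_embed Gs (\<phi> (shift Ls N))"
  shows "\<theta> N \<otimes>\<^bsub>classical_group Gs\<^esub> \<theta> N = \<one>\<^bsub>classical_group Gs\<^esub>"
    and "\<forall>\<^sub>F N in sequentially.
      (\<theta> N \<otimes>\<^bsub>classical_group Gs\<^esub> a \<otimes>\<^bsub>classical_group Gs\<^esub> \<theta> N) \<otimes>\<^bsub>classical_group Gs\<^esub> b
        = b \<otimes>\<^bsub>classical_group Gs\<^esub> (\<theta> N \<otimes>\<^bsub>classical_group Gs\<^esub> a \<otimes>\<^bsub>classical_group Gs\<^esub> \<theta> N)"
proof -
  have comp: "\<theta> N k = heavy_embed (Gs ! k) (\<lambda>s. \<phi> (shift Ls N) (k, s))" if "k < length Gs" for N k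
    using that by (simp add: \<theta>_def max_heavy_embed_def)
  have sq: "mat_mult (\<theta> N k) (\<theta> N k) = mat_one" if k: "k < length Gs" for N k
    using pure_pair_shift[OF pure k] comp[OF k] by (metis perm_mat_square)
  show "\<theta> N \<otimes>\<^bsub>classical_group Gs\<^esub> \<theta> N = \<one>\<^bsub>classical_group Gs\<^esub>"
    unfolding mult_classical_group one_classical_group by (rule restrict_ext) (simp add: sq)
  have "\<forall>\<^sub>F N in sequentially. mat_mult (mat_mult (mat_mult (\<theta> N k) (a k)) (\<theta> N k)) (b k)
      = mat_mult (b k) (mat_mult (mat_mult (\<theta> N k) (a k)) (\<theta> N k))" if k: "k < length Gs" for k
  proof -
    have fin: "irr_classical_carrier (Gs ! k) \<subseteq> finite_matrices (moving_basis (Gs ! k)) HH"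
      using pure_pair_no_finite_part[OF pure k] by (intro irr_classical_moving_basis) blast
    have "a k \<in> irr_classical_carrier (Gs ! k)" "b k \<in> irr_classical_carrier (Gs ! k)"
      using a b k unfolding carrier_classical_group by auto
    then have ab: "a k \<in> finite_matrices (moving_basis (Gs ! k)) HH"
      "b k \<in> finite_matrices (moving_basis (Gs ! k)) HH" using fin by blast+
    obtain \<pi> where \<pi>: "\<And>N. heavy_embed (Gs ! k) (\<lambda>s. \<phi> (shift Ls N) (k, s)) = perm_mat (\<pi> N)"
      "\<And>N x. \<pi> N (\<pi> N x) = x"
      "\<And>a b. a \<in> moving_basis (Gs ! k) \<Longrightarrow> \<forall>\<^sub>F N in sequentially. \<pi> N a \<noteq> b"
      by (rule pure_pair_shift[OF pure k]) (rule that)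
    show ?thesis
      unfolding comp[OF k] \<pi>(1) using ab \<pi>(2,3) by (rule eventually_conj_commute)
  qed
  then have "\<forall>\<^sub>F N in sequentially. \<forall>k\<in>{..<length Gs}.
      mat_mult (mat_mult (mat_mult (\<theta> N k) (a k)) (\<theta> N k)) (b k)
      = mat_mult (b k) (mat_mult (mat_mult (\<theta> N k) (a k)) (\<theta> N k))"
    by (intro eventually_ball_finite ballI) simp_all
  then show "\<forall>\<^sub>F N in sequentially.
      (\<theta> N \<otimes>\<^bsub>classical_group Gs\<^esub> a \<otimes>\<^bsub>classical_group Gs\<^esub> \<theta> N) \<otimes>\<^bsub>classical_group Gs\<^esub> b
        = b \<otimes>\<^bsub>classical_group Gs\<^esub> (\<theta> N \<otimes>\<^bsub>classical_group Gs\<^esub> a \<otimes>\<^bsub>classical_group Gs\<^esub> \<theta> N)"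
  proof eventually_elim
    case (elim N)
    then show ?case
      unfolding mult_classical_group by (intro restrict_ext) simp
  qed
qed

lemma image_in_G_closed:
  assumes sp: "straight_pair Gs Ls \<phi>"
  shows "image_in_G Gs Ls \<phi> \<subseteq> carrier (classical_group Gs)"
    and "g \<in> image_in_G Gs Ls \<phi> \<Longrightarrow> h \<in> image_in_G Gs Ls \<phi>
      \<Longrightarrow> g \<otimes>\<^bsub>classical_group Gs\<^esub> h \<in> image_in_G Gs Ls \<phi>"
proof -
  show "image_in_G Gs Ls \<phi> \<subseteq> carrier (classical_group Gs)"
    unfolding image_in_G_def carrier_classical_group max_heavy_embed_def
    using straight_pair_embed_closed[OF sp] by auto
  assume "g \<in> image_in_G Gs Ls \<phi>" "h \<in> image_in_G Gs Ls \<phi>"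
  then obtain l m where l: "l \<in> carrier (heavy_group Ls)" "g = max_heavy_embed Gs (\<phi> l)"
    and m: "m \<in> carrier (heavy_group Ls)" "h = max_heavy_embed Gs (\<phi> m)"
    unfolding image_in_G_def by blast
  have "group (heavy_group Ls)"
    unfolding heavy_group_def by (rule product_group) (rule group_irr_heavy)
  then have lm: "l \<otimes>\<^bsub>heavy_group Ls\<^esub> m \<in> carrier (heavy_group Ls)"
    using l m by (simp add: group.is_monoid monoid.m_closed)
  have "\<phi> \<in> hom (heavy_group Ls) (product_group (max_heavy_index Gs) (\<lambda>i. irr_heavy_group (max_heavy_factor Gs i)))"
    using sp by (simp add: straight_pair_def straight_hom_def)
  from hom_mult[OF this l(1) m(1)]
  have phi: "\<phi> (l \<otimes>\<^bsub>heavy_group Ls\<^esub> m) = (\<lambda>p\<in>max_heavy_index Gs. mat_mult (\<phi> l p) (\<phi> m p))"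
    by simp
  have "max_heavy_embed Gs (\<phi> (l \<otimes>\<^bsub>heavy_group Ls\<^esub> m)) = g \<otimes>\<^bsub>classical_group Gs\<^esub> h"
    unfolding mult_classical_group max_heavy_embed_def[of Gs "\<phi> (l \<otimes>\<^bsub>heavy_group Ls\<^esub> m)"]
  proof (rule restrict_ext)
    fix i assume "i \<in> {..<length Gs}"
    then have i: "i < length Gs" by simp
    have "heavy_embed (Gs ! i) (\<lambda>s. \<phi> (l \<otimes>\<^bsub>heavy_group Ls\<^esub> m) (i, s))
        = heavy_embed (Gs ! i) (\<lambda>s. mat_mult (\<phi> l (i, s)) (\<phi> m (i, s)))"
      using i by (intro heavy_embed_cong) (simp add: phi max_heavy_index_def)
    also have "\<dots> = mat_mult (g i) (h i)"
      using straight_pair_mem[OF sp l(1) i] straight_pair_mem[OF sp m(1) i] i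
      by (simp add: heavy_embed_mult l m max_heavy_embed_def)
    finally show "heavy_embed (Gs ! i) (\<lambda>s. \<phi> (l \<otimes>\<^bsub>heavy_group Ls\<^esub> m) (i, s)) = mat_mult (g i) (h i)" .
  qed
  then show "g \<otimes>\<^bsub>classical_group Gs\<^esub> h \<in> image_in_G Gs Ls \<phi>"
    unfolding image_in_G_def using lm by (metis image_eqI)
qed

theorem mainTheorem3:
  fixes Gs :: "classical list"
    and Ls :: "fld list"
    and \<phi> :: "(nat \<Rightarrow> nat qmat) \<Rightarrow> nat \<times> nat \<Rightarrow> nat qmat"
    and \<rho> :: "(nat \<Rightarrow> (nat + nat) qmat) \<Rightarrow> 'h::complex_hilbert_space \<Rightarrow> 'h"
  assumes "pure_pair Gs Ls \<phi>"
    and "irreducible_unitary_rep (classical_group Gs) \<rho>"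
  shows "has_dim_at_most 1 (fixed_vectors \<rho> (image_in_G Gs Ls \<phi>))"
proof -
  have sp: "straight_pair Gs Ls \<phi>" using assms(1) by (simp add: pure_pair_def)
  let ?G = "classical_group Gs"
  let ?\<theta> = "\<lambda>N. max_heavy_embed Gs (\<phi> (shift Ls N))"
  interpret group ?G by (rule group_classical_group)
  have theta: "?\<theta> N \<in> image_in_G Gs Ls \<phi>" for N
    unfolding image_in_G_def using shift_carrier by blast
  interpret asymptotically_commuting_rep ?G \<rho> "image_in_G Gs Ls \<phi>" ?\<theta>
  proof unfold_locales
    show "\<rho> \<in> hom ?G unitary_group"
      using assms(2) by (simp add: irreducible_unitary_rep_def)
    show "image_in_G Gs Ls \<phi> \<noteq> {}" using theta by blast
  qed (fact image_in_G_closed[OF sp] theta pure_pair_eventually_commute[OF assms(1)]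
      pure_pair_eventually_commute(1)[OF assms(1) one_closed one_closed])+
  show ?thesis using assms(2) by (rule fixed_vectors_dim_le_1)
qed

end
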